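(* Let $\{\gamma_n\}_{n\in\mathbb N}\subset(0,\infty)$ with $\gamma_n\to\infty$ as $n\to\infty$, and for each $n$ let $\omega^{\gamma_n}\in\mathcal O$ be a solution (minimizer) of $(P_{\gamma})$ with $\gamma=\gamma_n$. Then there exists a subsequence of $\{\gamma_n\}_{n\in\mathbb N}$, still denoted by $\{\gamma_n\}_{n\in\mathbb N}$, such that $\{\omega^{\gamma_n}\}_{n\in\mathbb N}$ converges to an optimal solution $\omega_\star\in\mathcal O$ of $(P)$ in the sense of Hausdorff and in the sense of characteristic functions. Moreover, the solutions $(\mathbf E^{\gamma_n}(\omega^{\gamma_n}),\boldsymbol\lambda^{\gamma_n}(\omega^{\gamma_n}))$ of the penalized system for $\omega=\omega^{\gamma_n}$, $\gamma=\gamma_n$, and the solution $(\mathbf E(\omega_\star),\boldsymbol\lambda(\omega_\star))$ of the dual formulation of the variational inequality for $\omega=\omega_\star$ satisfy $$\lim_{n\to\infty}\|\mathbf E^{\gamma_n}(\omega^{\gamma_n})-\mathbf E(\omega_\star)\|_{\mathbf H(\mathbf{curl})}=0,\qquad \lim_{n\to\infty}\|\boldsymbol\lambda^{\gamma_n}(\omega^{\gamma_n})-\boldsymbol\lambda(\omega_\star)\|_{\mathbf H_0(\mathbf{curl})^*}=0,$$ where $\boldsymbol\lambda^{\gamma_n}(\omega^{\gamma_n})$ (resp. $\boldsymbol\lambda(\omega_\star)$) is extended by zero to $\Omega\setminus\omega^{\gamma_n}$ (resp. $\Omega\setminus\omega_\star$).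
   Context: Setting. $\Omega\subset\mathbb R^3$ is a bounded Lipschitz domain and $B\subset\Omega$ is a Lipschitz domain. $\mathbf H_0(\mathbf{curl})$ is the closure of $C_0^\infty(\Omega)^3$ in $\mathbf H(\mathbf{curl})=\{\mathbf v\in L^2(\Omega)^3:\mathbf{curl}\,\mathbf v\in L^2(\Omega)^3\}$ with the graph norm; $\mathbf H_0(\mathbf{curl})^*$ is its dual, in which $L^2(\Omega)^3$ functions act by the $L^2$ inner product. $\mathcal C^1(B,\cdot)$ is the Banach space of $C^1$ functions on $B$ that are bounded together with their first derivatives. Standing assumptions: $\mathbf E_d\in\mathcal C^1(B,\mathbb R^3)$; $\kappa\in\mathcal C^1(B)$ with $\kappa:B\to(0,\infty)$; $j_c>0$; $\epsilon,\nu:\Omega\to\mathbb R^{3\times3}$ lie in $L^\infty(\Omega,\mathbb R^{3\times3})\cap\mathcal C^1(B,\mathbb R^{3\times3})$, are symmetric and uniformly positive definite ($\xi^{\mathsf T}\nu(x)\xi\ge\underline\nu|\xi|^2$, $\xi^{\mathsf T}\epsilon(x)\xi\ge\underline\epsilon|\xi|^2$ for a.e. $x\in\Omega$, all $\xi\in\mathbb R^3$, with $\underline\nu,\underline\epsilon>0$); $\mathbf f\in L^2(\Omega)^3$ with $\mathbf f|_B\in\mathcal C^1(B,\mathbb R^3)$. Admissible shapes. $\mathcal O$ (assumed nonempty) is the class of all open sets $\omega\subset B$ that are Lipschitz with uniform Lipschitz constant $L$ (fixed), understood in the standard uniform sense (Lipschitz constant and size of the local graph charts uniform over boundary points and over $\mathcal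 O$), so that the following known compactness theorem holds: every sequence in $\mathcal O$ has a subsequence converging to some $\omega\in\mathcal O$ both in the sense of Hausdorff and in the sense of characteristic functions. Here $\omega_n\to\omega$ in the sense of Hausdorff means that the Hausdorff distance of the compact sets $\overline B\setminus\omega_n$ and $\overline B\setminus\omega$ tends to $0$; in the sense of characteristic functions means $\chi_{\omega_n}\to\chi_\omega$ in $L^p(\Omega)$ for all $1\le p<\infty$. $a(\mathbf v,\mathbf w)=\int_\Omega\nu\,\mathbf{curl}\,\mathbf v\cdot\mathbf{curl}\,\mathbf w\,dx+\int_\Omega\epsilon\mathbf v\cdot\mathbf w\,dx$. Variational inequality. For $\omega\in\mathcal O$, $\mathbf E(\omega)\in\mathbf H_0(\mathbf{curl})$ is the unique solution of $$a(\mathbf E,\mathbf v-\mathbf E)+j_c\int_\omega|\mathbf v|\,dx-j_c\int_\omega|\mathbf E|\,dx\ge\int_\Omega\mathbf f\cdot(\mathbf v-\mathbf E)\,dx\quad\forall\mathbf v\in\mathbf H_0(\mathbf{curl}).$$ Dual formulation: there is a unique $\boldsymbol\lambda=\boldsymbol\lambda(\omega)\in L^\infty(\omega)^3$ with $a(\mathbf E,\mathbf v)+\int_\omega\boldsymbol\lambda\cdot\mathbf v\,dx=\int_\Omega\mathbf f\cdot\mathbf v\,dx$ for all $\mathbf v\in\mathbf H_0(\mathbf{curl})$, and $|\boldsymbol\lambda(x)|\le j_c$, $\boldsymbol\lambda(x)\cdot\mathbf E(x)=j_c|\mathbf E(x)|$ for a.e. $x\in\omega$. Problem $(P)$: minimize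 $J(\omega)=\frac12\int_B\kappa|\mathbf E(\omega)-\mathbf E_d|^2dx+\int_\omega dx$ over $\omega\in\mathcal O$. Penalization. For $\gamma>0$ and $x\in\mathbb R$: $\max_\gamma\{1,x\}=x$ if $x-1\ge\frac1{2\gamma}$; $=1+\frac\gamma2(x-1+\frac1{2\gamma})^2$ if $|x-1|\le\frac1{2\gamma}$; $=1$ if $x-1\le-\frac1{2\gamma}$. Penalized system: $(\mathbf E^\gamma(\omega),\boldsymbol\lambda^\gamma(\omega))$ is the unique solution of $a(\mathbf E^\gamma,\mathbf v)+\int_\omega\boldsymbol\lambda^\gamma\cdot\mathbf v\,dx=\int_\Omega\mathbf f\cdot\mathbf v\,dx$ for all $\mathbf v\in\mathbf H_0(\mathbf{curl})$, with $\boldsymbol\lambda^\gamma(x)=\frac{j_c\gamma\mathbf E^\gamma(x)}{\max_\gamma\{1,\gamma|\mathbf E^\gamma(x)|\}}$ for a.e. $x\in\omega$. Problem $(P_\gamma)$: minimize $J_\gamma(\omega)=\frac12\int_B\kappa|\mathbf E^\gamma(\omega)-\mathbf E_d|^2dx+\int_\omega dx$ over $\omega\in\mathcal O$. *)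

theory Defs
  imports "HOL-Analysis.Analysis"
begin

section \<open>Function spaces\<close>

text \<open>
  Elements of Lebesgue spaces are represented by functions on the whole of \<open>\<real>\<^sup>3\<close> whose values
  outside the set under consideration are irrelevant and which are identified when they agree
  almost everywhere on that set.
\<close>

type_synonym R3 = "real^3"

definition square_integrable :: "R3 set \<Rightarrow> (R3 \<Rightarrow> R3) \<Rightarrow> bool" where
  "square_integrable S v \<longleftrightarrow>
     v \<in> borel_measurable (lebesgue_on S) \<and> integrable (lebesgue_on S) (\<lambda>x. (norm (v x))\<^sup>2)"

definition ess_bounded :: "R3 set \<Rightarrow> (R3 \<Rightarrow> 'b::euclidean_space) \<Rightarrow> bool" where
  "ess_bounded S f \<longleftrightarrow>
     f \<in> borel_measurable (lebesgue_on S) \<and> (\<exists>C. AE x in lebesgue_on S. norm (f x) \<le> C)"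

definition C1_bounded :: "R3 set \<Rightarrow> (R3 \<Rightarrow> 'b::real_normed_vector) \<Rightarrow> bool" where
  "C1_bounded B f \<longleftrightarrow>
     (\<exists>f' :: R3 \<Rightarrow> (R3 \<Rightarrow>\<^sub>L 'b).
        (\<forall>x\<in>B. (f has_derivative blinfun_apply (f' x)) (at x)) \<and>
        continuous_on B f' \<and> bounded (f ` B) \<and> bounded (f' ` B))"

definition partial :: "3 \<Rightarrow> (R3 \<Rightarrow> 'b::real_normed_vector) \<Rightarrow> R3 \<Rightarrow> 'b" where
  "partial i f x = frechet_derivative f (at x) (axis i 1)"

primrec cont_diff :: "nat \<Rightarrow> (R3 \<Rightarrow> 'b::real_normed_vector) \<Rightarrow> bool" where
  "cont_diff 0 f \<longleftrightarrow> continuous_on UNIV f"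
| "cont_diff (Suc k) f \<longleftrightarrow> (\<forall>x. f differentiable (at x)) \<and> (\<forall>i. cont_diff k (partial i f))"

definition test_functions :: "R3 set \<Rightarrow> (R3 \<Rightarrow> R3) set" where
  "test_functions \<Omega> =
     {\<phi>. (\<forall>k. cont_diff k \<phi>) \<and> compact (closure {x. \<phi> x \<noteq> 0}) \<and> closure {x. \<phi> x \<noteq> 0} \<subseteq> \<Omega>}"

definition curl :: "(R3 \<Rightarrow> R3) \<Rightarrow> R3 \<Rightarrow> R3" where
  "curl \<phi> x = vector
     [partial 2 \<phi> x $ 3 - partial 3 \<phi> x $ 2,
      partial 3 \<phi> x $ 1 - partial 1 \<phi> x $ 3,
      partial 1 \<phi> x $ 2 - partial 2 \<phi> x $ 1]"

definition has_weak_curl :: "R3 set \<Rightarrow> (R3 \<Rightarrow> R3) \<Rightarrow> (R3 \<Rightarrow> R3) \<Rightarrow> bool" where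
  "has_weak_curl \<Omega> v w \<longleftrightarrow> square_integrable \<Omega> v \<and> square_integrable \<Omega> w \<and>
     (\<forall>\<phi>\<in>test_functions \<Omega>.
        (\<integral>x. v x \<bullet> curl \<phi> x \<partial>lebesgue_on \<Omega>) = (\<integral>x. w x \<bullet> \<phi> x \<partial>lebesgue_on \<Omega>))"

definition Hcurl :: "R3 set \<Rightarrow> (R3 \<Rightarrow> R3) set" where
  "Hcurl \<Omega> = {v. \<exists>w. has_weak_curl \<Omega> v w}"

text \<open>A representative; the weak curl is determined up to a null set.\<close>

definition weak_curl :: "R3 set \<Rightarrow> (R3 \<Rightarrow> R3) \<Rightarrow> R3 \<Rightarrow> R3" where
  "weak_curl \<Omega> v = (SOME w. has_weak_curl \<Omega> v w)"

definition Hcurl_norm :: "R3 set \<Rightarrow> (R3 \<Rightarrow> R3) \<Rightarrow> real" where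
  "Hcurl_norm \<Omega> v =
     sqrt ((\<integral>x. (norm (v x))\<^sup>2 \<partial>lebesgue_on \<Omega>) + (\<integral>x. (norm (weak_curl \<Omega> v x))\<^sup>2 \<partial>lebesgue_on \<Omega>))"

definition H0curl :: "R3 set \<Rightarrow> (R3 \<Rightarrow> R3) set" where
  "H0curl \<Omega> =
     {v \<in> Hcurl \<Omega>. \<forall>e>0. \<exists>\<phi>\<in>test_functions \<Omega>. Hcurl_norm \<Omega> (\<lambda>x. v x - \<phi> x) < e}"

text \<open>The norm in the dual of \<open>H0curl \<Omega>\<close> of the functional \<open>v \<mapsto> \<integral>\<^bsub>\<Omega>\<^esub> g \<bullet> v\<close>, for
  square integrable \<open>g\<close>.\<close>

definition H0curl_dual_norm :: "R3 set \<Rightarrow> (R3 \<Rightarrow> R3) \<Rightarrow> real" where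
  "H0curl_dual_norm \<Omega> g =
     (SUP v \<in> {v \<in> H0curl \<Omega>. Hcurl_norm \<Omega> v \<le> 1}. \<bar>\<integral>x. g x \<bullet> v x \<partial>lebesgue_on \<Omega>\<bar>)"


section \<open>Lipschitz domains and admissible shapes\<close>

text \<open>
  In the open cylinder with centre \<open>x\<close>, axis \<open>e\<close>, radius \<open>r\<close> and half-height \<open>h\<close>, the set \<open>S\<close> lies
  exactly strictly below the graph of an \<open>L\<close>-Lipschitz function on the hyperplane orthogonal to
  \<open>e\<close>. For open \<open>S\<close> the part of the boundary in the cylinder is then the part of the graph in it.
\<close>

definition lipschitz_chart :: "R3 set \<Rightarrow> R3 \<Rightarrow> real \<Rightarrow> real \<Rightarrow> real \<Rightarrow> bool" where
  "lipschitz_chart S x L r h \<longleftrightarrow>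
     (\<exists>(e::R3) (\<phi>::R3 \<Rightarrow> real). norm e = 1 \<and> L-lipschitz_on {y. y \<bullet> e = 0} \<phi> \<and>
        (\<forall>y t. y \<bullet> e = 0 \<and> norm y < r \<and> \<bar>t\<bar> < h \<longrightarrow> (x + y + t *\<^sub>R e \<in> S \<longleftrightarrow> t < \<phi> y)))"

definition lipschitz_domain :: "R3 set \<Rightarrow> bool" where
  "lipschitz_domain S \<longleftrightarrow> open S \<and> connected S \<and> S \<noteq> {} \<and>
     (\<forall>x\<in>frontier S. \<exists>L>0. \<exists>r>0. \<exists>h>0. lipschitz_chart S x L r h)"

text \<open>The Lipschitz constant \<open>L\<close> and the chart sizes \<open>r\<close>, \<open>h\<close> are the same at all boundary points
  of all members of the class.\<close>

definition admissible :: "R3 set \<Rightarrow> real \<Rightarrow> real \<Rightarrow> real \<Rightarrow> R3 set set" where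
  "admissible B L r h =
     {\<omega>. open \<omega> \<and> \<omega> \<subseteq> B \<and> (\<forall>x\<in>frontier \<omega>. lipschitz_chart \<omega> x L r h)}"

text \<open>Used for nonempty compact sets only.\<close>

definition hausdorff_distance :: "R3 set \<Rightarrow> R3 set \<Rightarrow> real" where
  "hausdorff_distance K M = max (SUP x\<in>K. infdist x M) (SUP y\<in>M. infdist y K)"

definition converges_hausdorff :: "R3 set \<Rightarrow> (nat \<Rightarrow> R3 set) \<Rightarrow> R3 set \<Rightarrow> bool" where
  "converges_hausdorff B \<omega>s \<omega> \<longleftrightarrow>
     (\<lambda>n. hausdorff_distance (closure B - \<omega>s n) (closure B - \<omega>)) \<longlonglongrightarrow> 0"

definition converges_char :: "R3 set \<Rightarrow> (nat \<Rightarrow> R3 set) \<Rightarrow> R3 set \<Rightarrow> bool" where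
  "converges_char \<Omega> \<omega>s \<omega> \<longleftrightarrow>
     (\<forall>p::real. p \<ge> 1 \<longrightarrow>
        (\<lambda>n. (\<integral>x. \<bar>indicator (\<omega>s n) x - indicator \<omega> x\<bar> powr p \<partial>lebesgue_on \<Omega>) powr (1 / p))
          \<longlonglongrightarrow> 0)"


section \<open>The variational inequality, its dual formulation and the shape optimization problem\<close>

definition coefficient :: "R3 set \<Rightarrow> R3 set \<Rightarrow> (R3 \<Rightarrow> real^3^3) \<Rightarrow> bool" where
  "coefficient \<Omega> B A \<longleftrightarrow> ess_bounded \<Omega> A \<and> C1_bounded B A \<and>
     (AE x in lebesgue_on \<Omega>. transpose (A x) = A x) \<and>
     (\<exists>c>0. AE x in lebesgue_on \<Omega>. \<forall>\<xi>. \<xi> \<bullet> (A x *v \<xi>) \<ge> c * (norm \<xi>)\<^sup>2)"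

definition bilinear_form ::
  "R3 set \<Rightarrow> (R3 \<Rightarrow> real^3^3) \<Rightarrow> (R3 \<Rightarrow> real^3^3) \<Rightarrow> (R3 \<Rightarrow> R3) \<Rightarrow> (R3 \<Rightarrow> R3) \<Rightarrow> real" where
  "bilinear_form \<Omega> \<nu> \<epsilon> v w =
     (\<integral>x. (\<nu> x *v weak_curl \<Omega> v x) \<bullet> weak_curl \<Omega> w x \<partial>lebesgue_on \<Omega>) +
     (\<integral>x. (\<epsilon> x *v v x) \<bullet> w x \<partial>lebesgue_on \<Omega>)"

definition VI_solution ::
  "R3 set \<Rightarrow> (R3 \<Rightarrow> real^3^3) \<Rightarrow> (R3 \<Rightarrow> real^3^3) \<Rightarrow> real \<Rightarrow> (R3 \<Rightarrow> R3) \<Rightarrow> R3 set \<Rightarrow> (R3 \<Rightarrow> R3) \<Rightarrow> bool" where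
  "VI_solution \<Omega> \<nu> \<epsilon> j\<^sub>c f \<omega> E \<longleftrightarrow> E \<in> H0curl \<Omega> \<and>
     (\<forall>v\<in>H0curl \<Omega>.
        bilinear_form \<Omega> \<nu> \<epsilon> E (\<lambda>x. v x - E x)
          + j\<^sub>c * (\<integral>x. norm (v x) \<partial>lebesgue_on \<omega>) - j\<^sub>c * (\<integral>x. norm (E x) \<partial>lebesgue_on \<omega>)
        \<ge> (\<integral>x. f x \<bullet> (v x - E x) \<partial>lebesgue_on \<Omega>))"

text \<open>
  The solutions of the problems below are unique as elements of \<open>H0curl \<Omega>\<close> and of the
  essentially bounded functions on \<open>\<omega>\<close>, that is, up to null sets; \<open>SOME\<close> picks a representative.
\<close>

definition E_sol ::
  "R3 set \<Rightarrow> (R3 \<Rightarrow> real^3^3) \<Rightarrow> (R3 \<Rightarrow> real^3^3) \<Rightarrow> real \<Rightarrow> (R3 \<Rightarrow> R3) \<Rightarrow> R3 set \<Rightarrow> R3 \<Rightarrow> R3" where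
  "E_sol \<Omega> \<nu> \<epsilon> j\<^sub>c f \<omega> = (SOME E. VI_solution \<Omega> \<nu> \<epsilon> j\<^sub>c f \<omega> E)"

definition dual_multiplier ::
  "R3 set \<Rightarrow> (R3 \<Rightarrow> real^3^3) \<Rightarrow> (R3 \<Rightarrow> real^3^3) \<Rightarrow> real \<Rightarrow> (R3 \<Rightarrow> R3) \<Rightarrow> R3 set \<Rightarrow>
    (R3 \<Rightarrow> R3) \<Rightarrow> (R3 \<Rightarrow> R3) \<Rightarrow> bool" where
  "dual_multiplier \<Omega> \<nu> \<epsilon> j\<^sub>c f \<omega> E lam \<longleftrightarrow> ess_bounded \<omega> lam \<and>
     (\<forall>v\<in>H0curl \<Omega>.
        bilinear_form \<Omega> \<nu> \<epsilon> E v + (\<integral>x. lam x \<bullet> v x \<partial>lebesgue_on \<omega>) = (\<integral>x. f x \<bullet> v x \<partial>lebesgue_on \<Omega>)) \<and>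
     (AE x in lebesgue_on \<omega>. norm (lam x) \<le> j\<^sub>c) \<and>
     (AE x in lebesgue_on \<omega>. lam x \<bullet> E x = j\<^sub>c * norm (E x))"

definition lam_sol ::
  "R3 set \<Rightarrow> (R3 \<Rightarrow> real^3^3) \<Rightarrow> (R3 \<Rightarrow> real^3^3) \<Rightarrow> real \<Rightarrow> (R3 \<Rightarrow> R3) \<Rightarrow> R3 set \<Rightarrow> R3 \<Rightarrow> R3" where
  "lam_sol \<Omega> \<nu> \<epsilon> j\<^sub>c f \<omega> =
     (SOME lam. dual_multiplier \<Omega> \<nu> \<epsilon> j\<^sub>c f \<omega> (E_sol \<Omega> \<nu> \<epsilon> j\<^sub>c f \<omega>) lam)"

definition cost :: "R3 set \<Rightarrow> (R3 \<Rightarrow> real) \<Rightarrow> (R3 \<Rightarrow> R3) \<Rightarrow> (R3 \<Rightarrow> R3) \<Rightarrow> R3 set \<Rightarrow> real" where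
  "cost B \<kappa> E\<^sub>d E \<omega> =
     1/2 * (\<integral>x. \<kappa> x * (norm (E x - E\<^sub>d x))\<^sup>2 \<partial>lebesgue_on B) + (\<integral>x. 1 \<partial>lebesgue_on \<omega>)"

definition J ::
  "R3 set \<Rightarrow> R3 set \<Rightarrow> (R3 \<Rightarrow> real^3^3) \<Rightarrow> (R3 \<Rightarrow> real^3^3) \<Rightarrow> real \<Rightarrow> (R3 \<Rightarrow> R3) \<Rightarrow>
    (R3 \<Rightarrow> real) \<Rightarrow> (R3 \<Rightarrow> R3) \<Rightarrow> R3 set \<Rightarrow> real" where
  "J \<Omega> B \<nu> \<epsilon> j\<^sub>c f \<kappa> E\<^sub>d \<omega> = cost B \<kappa> E\<^sub>d (E_sol \<Omega> \<nu> \<epsilon> j\<^sub>c f \<omega>) \<omega>"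


section \<open>Penalization\<close>

definition max_pen :: "real \<Rightarrow> real \<Rightarrow> real" where
  "max_pen \<gamma> x =
     (if x - 1 \<ge> 1 / (2 * \<gamma>) then x
      else if \<bar>x - 1\<bar> \<le> 1 / (2 * \<gamma>) then 1 + \<gamma> / 2 * (x - 1 + 1 / (2 * \<gamma>))\<^sup>2
      else 1)"

definition penalized_solution ::
  "R3 set \<Rightarrow> (R3 \<Rightarrow> real^3^3) \<Rightarrow> (R3 \<Rightarrow> real^3^3) \<Rightarrow> real \<Rightarrow> (R3 \<Rightarrow> R3) \<Rightarrow> real \<Rightarrow> R3 set \<Rightarrow>
    (R3 \<Rightarrow> R3) \<times> (R3 \<Rightarrow> R3) \<Rightarrow> bool" where
  "penalized_solution \<Omega> \<nu> \<epsilon> j\<^sub>c f \<gamma> \<omega> = (\<lambda>(E, lam).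
     E \<in> H0curl \<Omega> \<and> ess_bounded \<omega> lam \<and>
     (\<forall>v\<in>H0curl \<Omega>.
        bilinear_form \<Omega> \<nu> \<epsilon> E v + (\<integral>x. lam x \<bullet> v x \<partial>lebesgue_on \<omega>) = (\<integral>x. f x \<bullet> v x \<partial>lebesgue_on \<Omega>)) \<and>
     (AE x in lebesgue_on \<omega>. lam x = (j\<^sub>c * \<gamma> / max_pen \<gamma> (\<gamma> * norm (E x))) *\<^sub>R E x))"

definition E_pen ::
  "R3 set \<Rightarrow> (R3 \<Rightarrow> real^3^3) \<Rightarrow> (R3 \<Rightarrow> real^3^3) \<Rightarrow> real \<Rightarrow> (R3 \<Rightarrow> R3) \<Rightarrow> real \<Rightarrow> R3 set \<Rightarrow> R3 \<Rightarrow> R3" where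
  "E_pen \<Omega> \<nu> \<epsilon> j\<^sub>c f \<gamma> \<omega> = fst (SOME p. penalized_solution \<Omega> \<nu> \<epsilon> j\<^sub>c f \<gamma> \<omega> p)"

definition lam_pen ::
  "R3 set \<Rightarrow> (R3 \<Rightarrow> real^3^3) \<Rightarrow> (R3 \<Rightarrow> real^3^3) \<Rightarrow> real \<Rightarrow> (R3 \<Rightarrow> R3) \<Rightarrow> real \<Rightarrow> R3 set \<Rightarrow> R3 \<Rightarrow> R3" where
  "lam_pen \<Omega> \<nu> \<epsilon> j\<^sub>c f \<gamma> \<omega> = snd (SOME p. penalized_solution \<Omega> \<nu> \<epsilon> j\<^sub>c f \<gamma> \<omega> p)"

definition J_pen ::
  "R3 set \<Rightarrow> R3 set \<Rightarrow> (R3 \<Rightarrow> real^3^3) \<Rightarrow> (R3 \<Rightarrow> real^3^3) \<Rightarrow> real \<Rightarrow> (R3 \<Rightarrow> R3) \<Rightarrow>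
    (R3 \<Rightarrow> real) \<Rightarrow> (R3 \<Rightarrow> R3) \<Rightarrow> real \<Rightarrow> R3 set \<Rightarrow> real" where
  "J_pen \<Omega> B \<nu> \<epsilon> j\<^sub>c f \<kappa> E\<^sub>d \<gamma> \<omega> = cost B \<kappa> E\<^sub>d (E_pen \<Omega> \<nu> \<epsilon> j\<^sub>c f \<gamma> \<omega>) \<omega>"

definition extend_zero :: "R3 set \<Rightarrow> (R3 \<Rightarrow> R3) \<Rightarrow> R3 \<Rightarrow> R3" where
  "extend_zero \<omega> g x = (if x \<in> \<omega> then g x else 0)"

end

theory Submission
  imports Defs "HOL-Complex_Analysis.Great_Picard"
begin

text \<open>
  No weak compactness is needed. The energies of the variational inequality and of the penalized
  problem are uniformly convex on \<open>H0curl \<Omega>\<close>, so minimizing sequences are Cauchy and solutions exist.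
  The multiplier represents in \<open>L\<^sup>2\<close> the functional \<open>v \<mapsto> \<integral> f \<bullet> v - a(E, v)\<close>, which the variational inequality
  bounds by \<open>j\<^sub>c \<integral>\<^bsub>\<omega>\<^esub> |v|\<close>; testing with smooth functions gives \<open>|lam| \<le> j\<^sub>c\<close> on \<open>\<omega>\<close> and \<open>lam = 0\<close> outside.

  Let \<open>E\<^sub>1\<close> solve the penalized problem on \<open>\<omega>\<^sub>1\<close> and \<open>E\<^sub>2\<close> the variational inequality on \<open>\<omega>\<^sub>2\<close>. Testing one
  with the other gives
  \<open>a(E\<^sub>2 - E\<^sub>1, E\<^sub>2 - E\<^sub>1) \<le> j\<^sub>c |\<chi>\<^sub>1 - \<chi>\<^sub>2|\<^sub>2 |E\<^sub>2 - E\<^sub>1|\<^sub>2 + O(1 / \<gamma>)\<close>,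
  so the fields converge strongly as soon as \<open>\<gamma> \<rightarrow> \<infinity>\<close> and the characteristic functions of the shapes
  converge in \<open>L\<^sup>2\<close>. The cost functionals converge accordingly, both along the minimizers and for a
  fixed competitor, which makes the limit shape optimal.

  For the compactness of the shapes, the distance functions to the complements converge uniformly by
  Arzela-Ascoli, which yields the Hausdorff limit. A boundary point of the limit is a limit of boundary
  points, and the charts there have a convergent subsequence as well. Hence the limit shape is
  admissible, its boundary is null, and the characteristic functions converge off that boundary.
\<close>

section \<open>Square integrable functions\<close>

text \<open>Hausdorff convergence of the complements does not by itself exclude a loss of volume: a
  point outside the closure of the limit might still lie in infinitely many of the shapes while
  points of their complements approach it. Segments from it to those points would cross the
  boundaries nearby, so a limit of charts could be centred at it. All chart functions vanish at 0,
  hence so does their limit, and the point would be in the closure after all. This is why chart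
  limits are built at every accumulation point of boundaries and not only at boundary points of the
  limit.

  The O(1 / \<gamma>) term is the gap between j |v| and the product of the regularized multiplier
  with v. It is bounded uniformly in v, so no a priori bound on the fields enters, and the norm of
  E2 - E1 on the right is absorbed by the coercive form on the left.

  Solutions are picked by \<open>SOME\<close>. Every estimate is proved for an arbitrary solution,
  and the existence theorems transfer it to the chosen one.\<close>

definition sqint :: "'a measure \<Rightarrow> ('a \<Rightarrow> 'b::euclidean_space) \<Rightarrow> bool" where
  "sqint M f \<longleftrightarrow> f \<in> borel_measurable M \<and> integrable M (\<lambda>x. (norm (f x))\<^sup>2)"

text \<open>On functions instead of classes this is a seminorm. The codomain stays general because
  fields, pairs of a field and its curl, and differences of indicators are all measured with
  it.\<close>

definition l2norm :: "'a measure \<Rightarrow> ('a \<Rightarrow> 'b::euclidean_space) \<Rightarrow> real" where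
  "l2norm M f = sqrt (\<integral>x. (norm (f x))\<^sup>2 \<partial>M)"

lemma sqint_measurable: "sqint M f \<Longrightarrow> f \<in> borel_measurable M"
  by (simp add: sqint_def)

lemma sqint_bound:
  assumes g: "sqint M g" and f: "f \<in> borel_measurable M" and le: "AE x in M. norm (f x) \<le> C * norm (g x)"
  shows "sqint M f"
proof -
  have "integrable M (\<lambda>x. C\<^sup>2 * (norm (g x))\<^sup>2)"
    using g by (simp add: sqint_def)
  then have "integrable M (\<lambda>x. (norm (f x))\<^sup>2)"
  proof (rule Bochner_Integration.integrable_bound)
    show "AE x in M. norm ((norm (f x))\<^sup>2) \<le> norm (C\<^sup>2 * (norm (g x))\<^sup>2)"
      using le
    proof eventually_elim
      case (elim x)
      then have "(norm (f x))\<^sup>2 \<le> (C * norm (g x))\<^sup>2"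
        by (intro power_mono) auto
      then show ?case by (simp add: power_mult_distrib)
    qed
  qed (use f in measurable)
  with f show ?thesis by (simp add: sqint_def)
qed

lemma sqint_norm_mult_integrable:
  assumes "sqint M f" "sqint M g"
  shows "integrable M (\<lambda>x. norm (f x) * norm (g x))"
proof -
  have i: "integrable M (\<lambda>x. (norm (f x))\<^sup>2 + (norm (g x))\<^sup>2)"
    using assms by (simp add: sqint_def)
  have [measurable]: "f \<in> borel_measurable M" "g \<in> borel_measurable M"
    using assms by (auto simp: sqint_def)
  show ?thesis
  proof (rule Bochner_Integration.integrable_bound[OF i])
    show "AE x in M. norm (norm (f x) * norm (g x)) \<le> norm ((norm (f x))\<^sup>2 + (norm (g x))\<^sup>2)"
    proof (rule AE_I2)
      fix x
      have "2 * (norm (f x) * norm (g x)) \<le> (norm (f x))\<^sup>2 + (norm (g x))\<^sup>2"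
        using sum_squares_bound[of "norm (f x)" "norm (g x)"] by simp
      moreover have "0 \<le> norm (f x) * norm (g x)" by simp
      ultimately show "norm (norm (f x) * norm (g x)) \<le> norm ((norm (f x))\<^sup>2 + (norm (g x))\<^sup>2)"
        unfolding real_norm_def by linarith
    qed
  qed measurable
qed

lemma sqint_inner_integrable:
  assumes "sqint M f" "sqint M g"
  shows "integrable M (\<lambda>x. f x \<bullet> g x)"
proof (rule Bochner_Integration.integrable_bound[OF sqint_norm_mult_integrable[OF assms]])
  show "(\<lambda>x. f x \<bullet> g x) \<in> borel_measurable M"
    using assms by (auto simp: sqint_def)
qed (auto simp: Cauchy_Schwarz_ineq2)

lemma sqint_scaleR: "sqint M f \<Longrightarrow> sqint M (\<lambda>x. c *\<^sub>R f x)"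
  by (rule sqint_bound[of M f _ "\<bar>c\<bar>"]) (auto simp: sqint_def)

lemma norm_add_square:
  fixes a b :: "'b::real_inner" shows "(norm (a + b))\<^sup>2 = (norm a)\<^sup>2 + 2 * (a \<bullet> b) + (norm b)\<^sup>2"
  by (simp add: power2_norm_eq_inner algebra_simps inner_commute)

lemma sqint_add:
  assumes "sqint M f" "sqint M g"
  shows "sqint M (\<lambda>x. f x + g x)"
  using assms sqint_inner_integrable[OF assms]
  by (auto simp: sqint_def norm_add_square)

lemma sqint_minus: "sqint M f \<Longrightarrow> sqint M (\<lambda>x. - f x)"
  using sqint_scaleR[of M f "-1"] by simp

lemma sqint_diff: "sqint M f \<Longrightarrow> sqint M g \<Longrightarrow> sqint M (\<lambda>x. f x - g x)"
  using sqint_add[OF _ sqint_minus] by fastforce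

lemma l2norm_nonneg [simp]: "0 \<le> l2norm M f"
  by (simp add: l2norm_def)

lemma l2norm_power2: "(l2norm M f)\<^sup>2 = (\<integral>x. (norm (f x))\<^sup>2 \<partial>M)"
  by (simp add: l2norm_def)

lemma l2norm_scaleR: "l2norm M (\<lambda>x. c *\<^sub>R f x) = \<bar>c\<bar> * l2norm M f"
  by (simp add: l2norm_def power_mult_distrib real_sqrt_mult)

lemma l2norm_minus_commute: "l2norm M (\<lambda>x. f x - g x) = l2norm M (\<lambda>x. g x - f x)"
  by (simp add: l2norm_def norm_minus_commute)

lemma l2norm_mono:
  assumes "sqint M g" "f \<in> borel_measurable M" "AE x in M. norm (f x) \<le> C * norm (g x)" "0 \<le> C"
  shows "l2norm M f \<le> C * l2norm M g"
proof -
  have "sqint M f" by (rule sqint_bound[OF assms(1-3)])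
  have "(\<integral>x. (norm (f x))\<^sup>2 \<partial>M) \<le> (\<integral>x. C\<^sup>2 * (norm (g x))\<^sup>2 \<partial>M)"
  proof (rule integral_mono_AE)
    show "AE x in M. (norm (f x))\<^sup>2 \<le> C\<^sup>2 * (norm (g x))\<^sup>2"
      using assms(3) by eventually_elim (metis norm_ge_zero power_mono power_mult_distrib)
  qed (use \<open>sqint M f\<close> assms(1) in \<open>auto simp: sqint_def\<close>)
  then have "sqrt (\<integral>x. (norm (f x))\<^sup>2 \<partial>M) \<le> sqrt (C\<^sup>2 * (\<integral>x. (norm (g x))\<^sup>2 \<partial>M))"
    by simp
  then show ?thesis
    using assms(4) by (simp add: l2norm_def real_sqrt_mult)
qed

lemma l2norm_cong_AE:
  assumes "AE x in M. f x = g x" "f \<in> borel_measurable M" "g \<in> borel_measurable M"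
  shows "l2norm M f = l2norm M g"
  unfolding l2norm_def using assms by (intro arg_cong[where f=sqrt] integral_cong_AE) auto

text \<open>The integral of (s |f| - t |g|)^2 is a nonnegative quadratic form in s and t. At s = c,
  t = b it gives c (a c - b^2) \<ge> 0, which says nothing when c = 0; that case is treated
  separately.\<close>

lemma l2_Cauchy_Schwarz_norm:
  assumes "sqint M f" "sqint M g"
  shows "(\<integral>x. norm (f x) * norm (g x) \<partial>M) \<le> l2norm M f * l2norm M g"
proof -
  define a b c where "a = (\<integral>x. (norm (f x))\<^sup>2 \<partial>M)" and "b = (\<integral>x. norm (f x) * norm (g x) \<partial>M)"
    and "c = (\<integral>x. (norm (g x))\<^sup>2 \<partial>M)"
  have nn: "0 \<le> a" "0 \<le> b" "0 \<le> c" by (auto simp: a_def b_def c_def)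
  have q: "0 \<le> s\<^sup>2 * a - 2 * s * t * b + t\<^sup>2 * c" for s t
  proof -
    have "0 \<le> (\<integral>x. (s * norm (f x) - t * norm (g x))\<^sup>2 \<partial>M)" by simp
    also have "\<dots> = (\<integral>x. s\<^sup>2 * (norm (f x))\<^sup>2 - 2 * s * t * (norm (f x) * norm (g x)) + t\<^sup>2 * (norm (g x))\<^sup>2 \<partial>M)"
      by (intro Bochner_Integration.integral_cong) (auto simp: power2_eq_square algebra_simps)
    also have "\<dots> = s\<^sup>2 * a - 2 * s * t * b + t\<^sup>2 * c"
      using assms sqint_norm_mult_integrable[OF assms] by (simp add: a_def b_def c_def sqint_def)
    finally show ?thesis .
  qed
  have "b\<^sup>2 \<le> a * c"
  proof (cases "c = 0")
    case True
    have "b = 0"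
    proof (rule ccontr)
      assume "b \<noteq> 0"
      with nn have "b > 0" by simp
      \<comment> \<open>With c = 0 the form is linear in t, and t = (a + 1) / b makes it a - 2 (a +
        1), which is negative.\<close>
      have "0 \<le> 1\<^sup>2 * a - 2 * 1 * ((a + 1) / b) * b + ((a + 1) / b)\<^sup>2 * c" by (rule q)
      with True \<open>b > 0\<close> have "a - 2 * (a + 1) \<ge> 0" by simp
      with nn show False by simp
    qed
    with True show ?thesis by simp
  next
    case False
    from q[of c b] have "0 \<le> c * (a * c - b\<^sup>2)" by (simp add: power2_eq_square algebra_simps)
    with False nn show ?thesis by (simp add: zero_le_mult_iff)
  qed
  then have "sqrt (b\<^sup>2) \<le> sqrt (a * c)" by (rule real_sqrt_le_mono)
  with nn show ?thesis
    by (simp add: a_def[symmetric] b_def[symmetric] c_def[symmetric] l2norm_def real_sqrt_mult)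
qed

lemma l2_Cauchy_Schwarz:
  assumes "sqint M f" "sqint M g"
  shows "\<bar>\<integral>x. f x \<bullet> g x \<partial>M\<bar> \<le> l2norm M f * l2norm M g"
proof -
  have "\<bar>\<integral>x. f x \<bullet> g x \<partial>M\<bar> \<le> (\<integral>x. \<bar>f x \<bullet> g x\<bar> \<partial>M)"
    by (rule integral_abs_bound)
  also have "\<dots> \<le> (\<integral>x. norm (f x) * norm (g x) \<partial>M)"
    using sqint_inner_integrable[OF assms] sqint_norm_mult_integrable[OF assms] Cauchy_Schwarz_ineq2 by (intro integral_mono) auto
  finally show ?thesis using l2_Cauchy_Schwarz_norm[OF assms] by simp
qed

lemma l2norm_triangle:
  assumes "sqint M f" "sqint M g"
  shows "l2norm M (\<lambda>x. f x + g x) \<le> l2norm M f + l2norm M g"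
proof (rule power2_le_imp_le)
  have "(l2norm M (\<lambda>x. f x + g x))\<^sup>2 = (l2norm M f)\<^sup>2 + 2 * (\<integral>x. f x \<bullet> g x \<partial>M) + (l2norm M g)\<^sup>2"
    unfolding l2norm_power2 norm_add_square
    using assms sqint_inner_integrable[OF assms] by (simp add: sqint_def)
  also have "\<dots> \<le> (l2norm M f + l2norm M g)\<^sup>2"
    using l2_Cauchy_Schwarz[OF assms] by (simp add: power2_eq_square algebra_simps)
  finally show "(l2norm M (\<lambda>x. f x + g x))\<^sup>2 \<le> (l2norm M f + l2norm M g)\<^sup>2" .
qed (auto intro: add_nonneg_nonneg)

lemma l2norm_triangle_diff:
  assumes "sqint M f" "sqint M g" "sqint M h"
  shows "l2norm M (\<lambda>x. f x - h x) \<le> l2norm M (\<lambda>x. f x - g x) + l2norm M (\<lambda>x. g x - h x)"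
  using l2norm_triangle[of M "\<lambda>x. f x - g x" "\<lambda>x. g x - h x"] assms by (simp add: sqint_diff)

lemma l2_inner_tendsto:
  fixes f g :: "nat \<Rightarrow> 'a \<Rightarrow> 'b::euclidean_space"
  assumes f: "\<And>n. sqint M (f n)" "sqint M f0" "(\<lambda>n. l2norm M (\<lambda>x. f n x - f0 x)) \<longlonglongrightarrow> 0"
    and g: "\<And>n. sqint M (g n)" "sqint M g0" "(\<lambda>n. l2norm M (\<lambda>x. g n x - g0 x)) \<longlonglongrightarrow> 0"
  shows "(\<lambda>n. \<integral>x. f n x \<bullet> g n x \<partial>M) \<longlonglongrightarrow> (\<integral>x. f0 x \<bullet> g0 x \<partial>M)"
proof (rule LIM_zero_cancel, rule Lim_null_comparison)
  let ?f = "\<lambda>n. l2norm M (\<lambda>x. f n x - f0 x)" and ?g = "\<lambda>n. l2norm M (\<lambda>x. g n x - g0 x)"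
  show "\<forall>\<^sub>F n in sequentially. norm ((\<integral>x. f n x \<bullet> g n x \<partial>M) - (\<integral>x. f0 x \<bullet> g0 x \<partial>M))
      \<le> ?f n * ?g n + ?f n * l2norm M g0 + l2norm M f0 * ?g n"
  proof (intro always_eventually allI)
    fix n
    note df = sqint_diff[OF f(1)[of n] f(2)] and dg = sqint_diff[OF g(1)[of n] g(2)]
    have "(\<integral>x. f n x \<bullet> g n x \<partial>M) - (\<integral>x. f0 x \<bullet> g0 x \<partial>M) = (\<integral>x. f n x \<bullet> g n x - f0 x \<bullet> g0 x \<partial>M)"
      using sqint_inner_integrable[OF f(1) g(1)] sqint_inner_integrable[OF f(2) g(2)] by simp
    \<comment> \<open>Expanding around the limits leaves only the norms of the differences and of
      the limits, so no uniform bound on \<open>f n\<close> and \<open>g n\<close> has to be found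
      first.\<close>
    also have "\<dots> = (\<integral>x. (f n x - f0 x) \<bullet> (g n x - g0 x) + (f n x - f0 x) \<bullet> g0 x + f0 x \<bullet> (g n x - g0 x) \<partial>M)"
      by (intro Bochner_Integration.integral_cong) (auto simp: inner_diff_left inner_diff_right)
    also have "\<dots> = (\<integral>x. (f n x - f0 x) \<bullet> (g n x - g0 x) \<partial>M) + (\<integral>x. (f n x - f0 x) \<bullet> g0 x \<partial>M)
        + (\<integral>x. f0 x \<bullet> (g n x - g0 x) \<partial>M)"
      using sqint_inner_integrable[OF df dg] sqint_inner_integrable[OF df g(2)] sqint_inner_integrable[OF f(2) dg]
      by simp
    finally show "norm ((\<integral>x. f n x \<bullet> g n x \<partial>M) - (\<integral>x. f0 x \<bullet> g0 x \<partial>M))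
        \<le> ?f n * ?g n + ?f n * l2norm M g0 + l2norm M f0 * ?g n"
      using l2_Cauchy_Schwarz[OF df dg] l2_Cauchy_Schwarz[OF df g(2)] l2_Cauchy_Schwarz[OF f(2) dg]
      unfolding real_norm_def by linarith
  qed
  have "(\<lambda>n. ?f n * ?g n + ?f n * l2norm M g0 + l2norm M f0 * ?g n) \<longlonglongrightarrow> 0 * 0 + 0 * l2norm M g0 + l2norm M f0 * 0"
    by (intro tendsto_intros f(3) g(3))
  then show "(\<lambda>n. ?f n * ?g n + ?f n * l2norm M g0 + l2norm M f0 * ?g n) \<longlonglongrightarrow> 0" by simp
qed

lemma l2norm_square_lin:
  assumes "sqint M u" "sqint M v"
  shows "(l2norm M (\<lambda>x. u x + t *\<^sub>R v x))\<^sup>2 = (l2norm M u)\<^sup>2 + 2 * t * (\<integral>x. u x \<bullet> v x \<partial>M) + t\<^sup>2 * (l2norm M v)\<^sup>2"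
  unfolding l2norm_power2 norm_add_square
  using assms sqint_inner_integrable[OF assms] by (simp add: sqint_def power_mult_distrib)

lemma (in finite_measure) sqint_const: "sqint M (\<lambda>x. c)"
  by (simp add: sqint_def)

lemma (in finite_measure) sqint_integrable_norm:
  assumes "sqint M f" shows "integrable M (\<lambda>x. norm (f x))"
  using sqint_norm_mult_integrable[OF assms sqint_const[of "1::real"]] by simp

lemma (in finite_measure) sqint_integrable:
  "sqint M f \<Longrightarrow> integrable M f"
  by (rule integrable_norm_cancel[OF sqint_integrable_norm]) (auto simp: sqint_def)

lemma (in finite_measure) l1_le_l2:
  assumes "sqint M f"
  shows "(\<integral>x. norm (f x) \<partial>M) \<le> l2norm M f * sqrt (measure M (space M))"
proof -
  have "l2norm M (\<lambda>x. 1::real) = sqrt (measure M (space M))"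
    by (simp add: l2norm_def)
  then show ?thesis
    using l2_Cauchy_Schwarz_norm[OF assms sqint_const[of "1::real"]] by simp
qed

text \<open>Riesz-Fischer. Along a fast subsequence the increments are summable in L1, because L1
  norms are controlled by L2 norms on a finite measure space. Hence the subsequence converges almost
  everywhere, and Fatou's lemma turns the pointwise limit into an L2 limit of the whole
  sequence.\<close>

theorem (in finite_measure) l2_complete:
  fixes f :: "nat \<Rightarrow> 'a \<Rightarrow> 'b::euclidean_space"
  assumes f: "\<And>n. sqint M (f n)"
    and Cauchy: "\<And>e. e > 0 \<Longrightarrow> \<exists>N. \<forall>m\<ge>N. \<forall>n\<ge>N. l2norm M (\<lambda>x. f m x - f n x) < e"
  obtains g where "sqint M g" "(\<lambda>n. l2norm M (\<lambda>x. f n x - g x)) \<longlonglongrightarrow> 0"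
proof -
  have [measurable]: "f n \<in> borel_measurable M" for n using f by (simp add: sqint_def)
  obtain N where N: "\<And>k m n. m \<ge> N k \<Longrightarrow> n \<ge> N k \<Longrightarrow> l2norm M (\<lambda>x. f m x - f n x) < (1/2)^k"
    using Cauchy[of "(1/2)^k" for k] by (metis zero_less_power half_gt_zero zero_less_one)
  \<comment> \<open>The maximum makes the indices monotone and at least \<open>N k\<close>; the
    summand k makes \<open>r k\<close> exceed any given bound, as the Fatou step requires.\<close>
  define r where "r k = Max (N ` {..k}) + k" for k
  have rN: "N k \<le> r k" for k
  proof -
    have "N k \<le> Max (N ` {..k})" by (rule Max_ge) auto
    then show ?thesis unfolding r_def by linarith
  qed
  have r_mono: "r k \<le> r (Suc k)" for k
  proof -
    have "Max (N ` {..k}) \<le> Max (N ` {..Suc k})" by (rule Max_mono) auto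
    then show ?thesis unfolding r_def by linarith
  qed
  have r_ge: "k \<le> r k" for k by (simp add: r_def)
  define u where "u k x = norm (f (r (Suc k)) x - f (r k) x)" for k x
  have [measurable]: "u k \<in> borel_measurable M" for k unfolding u_def by measurable
  have u_nonneg: "0 \<le> u k x" for k x by (simp add: u_def)
  define C where "C = sqrt (measure M (space M))"
  have iu: "integrable M (u k)" for k
    unfolding u_def by (intro sqint_integrable_norm sqint_diff f)
  have u1: "(\<integral>x. u k x \<partial>M) \<le> (1/2)^k * C" for k
  proof -
    have "(\<integral>x. u k x \<partial>M) \<le> l2norm M (\<lambda>x. f (r (Suc k)) x - f (r k) x) * C"
      unfolding u_def C_def by (intro l1_le_l2 sqint_diff f)
    also have "\<dots> \<le> (1/2)^k * C"
      using N[of k "r (Suc k)" "r k"] rN[of k] r_mono[of k] by (intro mult_right_mono) (auto simp: C_def)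
    finally show ?thesis .
  qed
  have "(\<integral>\<^sup>+x. (\<Sum>k. ennreal (u k x)) \<partial>M) = (\<Sum>k. \<integral>\<^sup>+x. ennreal (u k x) \<partial>M)"
    by (rule nn_integral_suminf) measurable
  also have "\<dots> \<le> (\<Sum>k. ennreal ((1/2)^k * C))"
  proof (rule suminf_le)
    show "(\<integral>\<^sup>+x. ennreal (u k x) \<partial>M) \<le> ennreal ((1/2)^k * C)" for k
      using u1[of k] by (subst nn_integral_eq_integral[OF iu]) (auto simp: u_nonneg ennreal_leI)
  qed auto
  also have "\<dots> < \<infinity>"
    by (subst suminf_ennreal2) (auto simp: C_def intro!: summable_mult2 summable_geometric)
  finally have "AE x in M. (\<Sum>k. ennreal (u k x)) \<noteq> \<infinity>"
    by (intro nn_integral_PInf_AE) auto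
  then have conv: "AE x in M. convergent (\<lambda>k. f (r k) x)"
  proof eventually_elim
    case (elim x)
    then have "summable (\<lambda>k. u k x)"
      by (intro summable_suminf_not_top) (auto simp: u_nonneg)
    then have "summable (\<lambda>k. f (r (Suc k)) x - f (r k) x)"
      unfolding u_def by (rule summable_norm_cancel)
    then have "convergent (\<lambda>n. \<Sum>k<n. f (r (Suc k)) x - f (r k) x)"
      by (simp add: summable_iff_convergent)
    then have "convergent (\<lambda>n. f (r n) x - f (r 0) x)"
      by (simp add: sum_lessThan_telescope[of "\<lambda>n. f (r n) x"])
    then obtain l where "(\<lambda>n. f (r n) x - f (r 0) x) \<longlonglongrightarrow> l" by (auto simp: convergent_def)
    then have "(\<lambda>n. f (r n) x - f (r 0) x + f (r 0) x) \<longlonglongrightarrow> l + f (r 0) x"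
      by (intro tendsto_add tendsto_const)
    then show ?case by (auto simp: convergent_def)
  qed
  define g where "g x = lim (\<lambda>k. f (r k) x)" for x
  have [measurable]: "g \<in> borel_measurable M" unfolding g_def by measurable
  have lim: "AE x in M. (\<lambda>k. f (r k) x) \<longlonglongrightarrow> g x"
    using conv by eventually_elim (simp add: g_def convergent_LIMSEQ_iff)
  \<comment> \<open>Stated for the nonnegative integral, since integrability of the difference with
    the limit is itself a consequence of this bound.\<close>
  have fatou: "(\<integral>\<^sup>+x. ennreal ((norm (f n x - g x))\<^sup>2) \<partial>M) \<le> ennreal (e\<^sup>2)"
    if e: "e > 0" and NN: "\<And>m n. m \<ge> K \<Longrightarrow> n \<ge> K \<Longrightarrow> l2norm M (\<lambda>x. f m x - f n x) < e" and n: "n \<ge> K" for n e K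
  proof -
    have "(\<integral>\<^sup>+x. ennreal ((norm (f n x - g x))\<^sup>2) \<partial>M)
        = (\<integral>\<^sup>+x. liminf (\<lambda>k. ennreal ((norm (f n x - f (r k) x))\<^sup>2)) \<partial>M)"
    proof (rule nn_integral_cong_AE)
      show "AE x in M. ennreal ((norm (f n x - g x))\<^sup>2) = liminf (\<lambda>k. ennreal ((norm (f n x - f (r k) x))\<^sup>2))"
        using lim
      proof eventually_elim
        case (elim x)
        then have "(\<lambda>k. ennreal ((norm (f n x - f (r k) x))\<^sup>2)) \<longlonglongrightarrow> ennreal ((norm (f n x - g x))\<^sup>2)"
          by (intro tendsto_intros)
        then show ?case by (intro lim_imp_Liminf[symmetric]) auto
      qed
    qed
    also have "\<dots> \<le> liminf (\<lambda>k. \<integral>\<^sup>+x. ennreal ((norm (f n x - f (r k) x))\<^sup>2) \<partial>M)"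
      by (rule nn_integral_liminf) measurable
    also have "\<dots> \<le> liminf (\<lambda>k. ennreal (e\<^sup>2))"
    proof (rule Liminf_mono)
      show "\<forall>\<^sub>F k in sequentially. (\<integral>\<^sup>+x. ennreal ((norm (f n x - f (r k) x))\<^sup>2) \<partial>M) \<le> ennreal (e\<^sup>2)"
        using eventually_ge_at_top[of K]
      proof eventually_elim
        case (elim k)
        have "l2norm M (\<lambda>x. f n x - f (r k) x) < e"
          using NN[of n "r k"] n r_ge[of k] elim by simp
        then have "(l2norm M (\<lambda>x. f n x - f (r k) x))\<^sup>2 \<le> e\<^sup>2" by (intro power_mono) auto
        moreover have "integrable M (\<lambda>x. (norm (f n x - f (r k) x))\<^sup>2)"
          using sqint_diff[OF f f] by (simp add: sqint_def)
        ultimately show ?case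
          by (subst nn_integral_eq_integral) (auto simp: l2norm_power2 ennreal_leI)
      qed
    qed
    also have "\<dots> = ennreal (e\<^sup>2)" by (simp add: Liminf_const)
    finally show ?thesis .
  qed
  have sq: "sqint M (\<lambda>x. f n x - g x) \<and> l2norm M (\<lambda>x. f n x - g x) \<le> e"
    if "e > 0" and "\<And>m n. m \<ge> K \<Longrightarrow> n \<ge> K \<Longrightarrow> l2norm M (\<lambda>x. f m x - f n x) < e" and "n \<ge> K" for n e K
  proof
    note F = fatou[OF that]
    then have i: "integrable M (\<lambda>x. (norm (f n x - g x))\<^sup>2)"
      by (intro integrableI_bounded) (auto simp: order.strict_trans1)
    then show "sqint M (\<lambda>x. f n x - g x)" by (simp add: sqint_def)
    have "(l2norm M (\<lambda>x. f n x - g x))\<^sup>2 \<le> e\<^sup>2"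
      using F by (simp add: nn_integral_eq_integral[OF i] l2norm_power2)
    then show "l2norm M (\<lambda>x. f n x - g x) \<le> e"
      using that(1) by (meson less_imp_le power2_le_imp_le)
  qed
  \<comment> \<open>The tail bound at level 0 is (1/2)^0 = 1, so one difference is square
    integrable, and with it the limit.\<close>
  have "sqint M (\<lambda>x. f (N 0) x - g x)"
    using sq[of 1 "N 0" "N 0"] N[of 0] by simp
  from sqint_diff[OF f[of "N 0"] this] have "sqint M g" by simp
  moreover have "(\<lambda>n. l2norm M (\<lambda>x. f n x - g x)) \<longlonglongrightarrow> 0"
  proof (rule LIMSEQ_I)
    fix e :: real assume "e > 0"
    then obtain K where "\<And>m n. m \<ge> K \<Longrightarrow> n \<ge> K \<Longrightarrow> l2norm M (\<lambda>x. f m x - f n x) < e / 2"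
      using Cauchy[of "e/2"] by (metis half_gt_zero)
    then have "\<forall>n\<ge>K. l2norm M (\<lambda>x. f n x - g x) \<le> e / 2"
      using sq[of "e/2" K] \<open>e > 0\<close> by auto
    then show "\<exists>K. \<forall>n\<ge>K. norm (l2norm M (\<lambda>x. f n x - g x) - 0) < e"
      using \<open>e > 0\<close> by (intro exI[of _ K]) fastforce
  qed
  ultimately show thesis by (rule that)
qed

section \<open>Smooth functions with compact support\<close>

lemma partial_eq: "(f has_derivative f') (at x) \<Longrightarrow> partial i f x = f' (axis i 1)"
  using frechet_derivative_at[of f f' x] by (simp add: partial_def)

text \<open>Derivatives are unique, so the partial derivatives may be read off from any explicit
  derivative. The smoothness inductions below are run in this form.\<close>

lemma cont_diff_SucI:
  assumes "\<And>x. (f has_derivative f' x) (at x)" "\<And>i. cont_diff k (\<lambda>x. f' x (axis i 1))"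
  shows "cont_diff (Suc k) f"
proof -
  have "partial i f = (\<lambda>x. f' x (axis i 1))" for i
    using partial_eq[OF assms(1)] by auto
  with assms show ?thesis
    by (auto simp: differentiable_def)
qed

lemma cont_diff_has_derivative:
  "cont_diff (Suc k) f \<Longrightarrow> (f has_derivative frechet_derivative f (at x)) (at x)"
  by (simp add: frechet_derivative_works[symmetric])

lemma cont_diff_SucD: "cont_diff (Suc k) f \<Longrightarrow> cont_diff k f"
proof (induction k arbitrary: f)
  case 0
  then have "continuous (at x) f" for x
    using differentiable_imp_continuous_within[of f x UNIV] by auto
  then show ?case by (simp add: continuous_at_imp_continuous_on)
next
  case (Suc k)
  have "\<forall>x. f differentiable (at x)" "\<forall>i. cont_diff (Suc k) (partial i f)"
    using Suc.prems[unfolded cont_diff.simps(2)[of "Suc k"]] by blast+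
  with Suc.IH have "\<forall>i. cont_diff k (partial i f)" by blast
  with \<open>\<forall>x. f differentiable (at x)\<close> show ?case unfolding cont_diff.simps by blast
qed

lemma cont_diff_continuous: "cont_diff k f \<Longrightarrow> continuous_on UNIV f"
proof (induction k)
  case (Suc k)
  from Suc.IH[OF cont_diff_SucD[OF Suc.prems]] show ?case .
qed simp

lemma cont_diff_const: "cont_diff k (\<lambda>x. c)"
proof (induction k arbitrary: c)
  case (Suc k)
  show ?case by (rule cont_diff_SucI[where f'="\<lambda>x h. 0"]) (auto intro: Suc)
qed simp

lemma cont_diff_add: "cont_diff k f \<Longrightarrow> cont_diff k g \<Longrightarrow> cont_diff k (\<lambda>x. f x + g x)"
proof (induction k arbitrary: f g)
  case (Suc k)
  show ?case
  proof (rule cont_diff_SucI)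
    show "((\<lambda>x. f x + g x) has_derivative
        (\<lambda>h. frechet_derivative f (at x) h + frechet_derivative g (at x) h)) (at x)" for x
      by (intro has_derivative_add cont_diff_has_derivative[of k] Suc.prems)
    show "cont_diff k (\<lambda>x. frechet_derivative f (at x) (axis i 1) + frechet_derivative g (at x) (axis i 1))" for i
      using Suc.prems by (intro Suc.IH) (auto simp: partial_def[abs_def])
  qed
qed (auto intro: continuous_intros)

text \<open>The product rule leaves one factor undifferentiated in each term, so the induction step
  also uses that this factor is k times differentiable (\<open>cont_diff_SucD\<close>).\<close>

lemma cont_diff_scaleR:
  fixes f :: "R3 \<Rightarrow> real"
  shows "cont_diff k f \<Longrightarrow> cont_diff k g \<Longrightarrow> cont_diff k (\<lambda>x. f x *\<^sub>R g x)"
proof (induction k arbitrary: f g)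
  case (Suc k)
  show ?case
  proof (rule cont_diff_SucI)
    show "((\<lambda>x. f x *\<^sub>R g x) has_derivative
        (\<lambda>h. f x *\<^sub>R frechet_derivative g (at x) h + frechet_derivative f (at x) h *\<^sub>R g x)) (at x)" for x
      by (intro has_derivative_scaleR cont_diff_has_derivative[of k] Suc.prems)
    show "cont_diff k (\<lambda>x. f x *\<^sub>R frechet_derivative g (at x) (axis i 1)
        + frechet_derivative f (at x) (axis i 1) *\<^sub>R g x)" for i
      using Suc.prems cont_diff_SucD[OF Suc.prems(1)] cont_diff_SucD[OF Suc.prems(2)]
      by (intro cont_diff_add Suc.IH) (auto simp: partial_def[abs_def])
  qed
qed (auto intro: continuous_intros)

lemma cont_diff_mult:
  fixes f g :: "R3 \<Rightarrow> real"
  shows "cont_diff k f \<Longrightarrow> cont_diff k g \<Longrightarrow> cont_diff k (\<lambda>x. f x * g x)"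
  using cont_diff_scaleR[of k f g] by simp

lemma cont_diff_cmult:
  "cont_diff k g \<Longrightarrow> cont_diff k (\<lambda>x. c *\<^sub>R g x)"
  using cont_diff_scaleR[OF cont_diff_const] .

lemma cont_diff_diff: "cont_diff k f \<Longrightarrow> cont_diff k g \<Longrightarrow> cont_diff k (\<lambda>x. f x - g x)"
  using cont_diff_add[OF _ cont_diff_cmult[of k g "-1"], of f] by simp

lemma cont_diff_prod:
  fixes f :: "'i \<Rightarrow> R3 \<Rightarrow> real"
  shows "(\<And>i. i \<in> I \<Longrightarrow> cont_diff k (f i)) \<Longrightarrow> cont_diff k (\<lambda>x. \<Prod>i\<in>I. f i x)"
  by (induction I rule: infinite_finite_induct) (auto intro: cont_diff_const cont_diff_mult)

lemma cont_diff_power: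
  fixes f :: "R3 \<Rightarrow> real" shows "cont_diff k f \<Longrightarrow> cont_diff k (\<lambda>x. f x ^ n)"
  by (induction n) (auto intro: cont_diff_const cont_diff_mult)

text \<open>The family is closed under differentiation, which makes the smoothness of
  \<open>t \<mapsto> exp (-1 / t)\<close> (extended by \<open>0\<close>) a plain induction.\<close>

definition flat_exp :: "nat \<Rightarrow> real \<Rightarrow> real" where
  "flat_exp m t = (if t > 0 then exp (- (1 / t)) / t ^ m else 0)"

text \<open>This is the difference quotient at 0, where \<open>flat_exp\<close> vanishes. From the
  right, s = 1 / t turns it into s^(m + 1) / exp s, which tends to 0.\<close>

lemma flat_exp_div_tendsto_0: "((\<lambda>t. flat_exp m t / t) \<longlongrightarrow> 0) (at 0)"
proof (rule filterlim_split_at)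
  show "((\<lambda>t. flat_exp m t / t) \<longlongrightarrow> 0) (at_left 0)"
    by (rule tendsto_eventually) (auto simp: eventually_at_filter flat_exp_def)
  have "filterlim inverse at_top (at_right (0::real))"
    by (rule filterlim_inverse_at_top_right)
  from filterlim_compose[OF tendsto_power_div_exp_0[of "Suc m"] this]
  have "((\<lambda>t::real. inverse t ^ Suc m / exp (inverse t)) \<longlongrightarrow> 0) (at_right 0)" .
  then show "((\<lambda>t. flat_exp m t / t) \<longlongrightarrow> 0) (at_right 0)"
  proof (rule Lim_transform_eventually)
    show "\<forall>\<^sub>F t in at_right 0. inverse t ^ Suc m / exp (inverse t) = flat_exp m t / (t::real)"
      by (auto simp: eventually_at_filter flat_exp_def exp_minus field_simps)
  qed
qed

lemma flat_exp_deriv: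
  "(flat_exp m has_real_derivative flat_exp (m + 2) t - m * flat_exp (m + 1) t) (at t)"
proof -
  consider "t > 0" | "t < 0" | "t = 0" by linarith
  then show ?thesis
  proof cases
    case 1
    have "((\<lambda>t. exp (- (1 / t)) / t ^ m) has_real_derivative
        (exp (- (1 / t)) * (1 / t\<^sup>2) * t ^ m - exp (- (1 / t)) * (m * t ^ (m - 1))) / (t ^ m * t ^ m)) (at t)"
      using 1 by (auto intro!: derivative_eq_intros simp: power2_eq_square)
    moreover have "(exp (- (1 / t)) * (1 / t\<^sup>2) * t ^ m - exp (- (1 / t)) * (m * t ^ (m - 1))) / (t ^ m * t ^ m)
        = flat_exp (m + 2) t - m * flat_exp (m + 1) t"
      using 1 by (cases m) (auto simp: flat_exp_def field_simps power2_eq_square)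
    ultimately have "((\<lambda>t. exp (- (1 / t)) / t ^ m) has_real_derivative
        flat_exp (m + 2) t - m * flat_exp (m + 1) t) (at t)" by simp
    then show ?thesis
      by (rule has_field_derivative_transform_within_open[where S="{0<..}"]) (use 1 in \<open>auto simp: flat_exp_def\<close>)
  next
    case 2
    have "((\<lambda>t. 0) has_real_derivative flat_exp (m + 2) t - m * flat_exp (m + 1) t) (at t)"
      using 2 by (auto simp: flat_exp_def)
    then show ?thesis
      by (rule has_field_derivative_transform_within_open[where S="{..<0}"]) (use 2 in \<open>auto simp: flat_exp_def\<close>)
  next
    case 3
    then show ?thesis
      using flat_exp_div_tendsto_0[of m] by (simp add: has_field_derivative_iff flat_exp_def)
  qed
qed

text \<open>The affine argument covers both the rising factor (a = 1) and the falling factor (a =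
  -1) of \<open>bump\<close>, and keeping m arbitrary lets the induction follow the derivatives
  within the family.\<close>

lemma cont_diff_flat_exp: "cont_diff k (\<lambda>x. flat_exp m (a * (x $ i) + b))"
proof (induction k arbitrary: m)
  case 0
  have "continuous_on UNIV (flat_exp m)"
    by (auto intro!: continuous_at_imp_continuous_on DERIV_isCont[OF flat_exp_deriv])
  then show ?case
    by (auto intro!: continuous_on_compose2[of UNIV "flat_exp m"] continuous_intros)
next
  case (Suc k)
  show ?case
  proof (rule cont_diff_SucI)
    show "((\<lambda>x. flat_exp m (a * (x $ i) + b)) has_derivative
       (\<lambda>h. (a * (h $ i)) * (flat_exp (m + 2) (a * (x $ i) + b) - m * flat_exp (m + 1) (a * (x $ i) + b)))) (at x)" for x
    proof -
      have "((\<lambda>x. a * (x $ i) + b) has_derivative (\<lambda>h. a * (h $ i))) (at x)"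
        by (auto intro!: derivative_eq_intros bounded_linear.has_derivative[OF bounded_linear_vec_nth])
      from has_derivative_compose[OF this flat_exp_deriv[unfolded has_field_derivative_def]]
      show ?thesis by (simp add: mult.commute)
    qed
    show "cont_diff k (\<lambda>x. (a * (axis j 1 $ i)) * (flat_exp (m + 2) (a * (x $ i) + b)
        - m * flat_exp (m + 1) (a * (x $ i) + b)))" for j
      by (intro cont_diff_mult cont_diff_const cont_diff_diff Suc.IH)
  qed
qed

section \<open>Bump functions on boxes and smooth cut-offs\<close>

lemma flat_exp_0: "0 \<le> flat_exp 0 t" "flat_exp 0 t \<le> 1" "flat_exp 0 t > 0 \<longleftrightarrow> t > 0"
  by (auto simp: flat_exp_def)

text \<open>A product over coordinates, so that smoothness reduces to functions of one variable; it
  is positive exactly on the open box.\<close>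

definition bump :: "R3 \<Rightarrow> R3 \<Rightarrow> R3 \<Rightarrow> real" where
  "bump a b x = (\<Prod>i\<in>UNIV. flat_exp 0 (x $ i - a $ i) * flat_exp 0 (b $ i - x $ i))"

lemma cont_diff_bump: "cont_diff k (bump a b)"
proof -
  have "cont_diff k (\<lambda>x. \<Prod>i\<in>UNIV. flat_exp 0 (1 * (x $ i) + - a $ i) * flat_exp 0 ((-1) * (x $ i) + b $ i))"
    by (intro cont_diff_prod cont_diff_mult cont_diff_flat_exp)
  then show ?thesis by (simp add: bump_def[abs_def])
qed

lemma bump_bounds: "0 \<le> bump a b x" "bump a b x \<le> 1"
  unfolding bump_def by (auto intro!: prod_nonneg prod_le_1 mult_nonneg_nonneg mult_le_one simp: flat_exp_0)

lemma bump_pos: "x \<in> box a b \<Longrightarrow> 0 < bump a b x"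
  unfolding bump_def by (intro prod_pos) (auto simp: mem_box_cart flat_exp_0 intro!: mult_pos_pos)

lemma bump_zero: "x \<notin> cbox a b \<Longrightarrow> bump a b x = 0"
proof -
  assume "x \<notin> cbox a b"
  then obtain i where "x $ i < a $ i \<or> b $ i < x $ i" by (auto simp: mem_box_cart not_le)
  then have "flat_exp 0 (x $ i - a $ i) * flat_exp 0 (b $ i - x $ i) = 0" by (auto simp: flat_exp_def)
  then show ?thesis unfolding bump_def by (intro prod_zero) auto
qed

text \<open>The condition of \<open>test_functions\<close> with a general codomain: scalar weights
  are needed besides vector fields.\<close>

definition smooth_compact :: "R3 set \<Rightarrow> (R3 \<Rightarrow> 'b::real_normed_vector) \<Rightarrow> bool" where
  "smooth_compact \<Omega> \<phi> \<longleftrightarrow> (\<forall>k. cont_diff k \<phi>) \<and> compact (closure {x. \<phi> x \<noteq> 0}) \<and> closure {x. \<phi> x \<noteq> 0} \<subseteq> \<Omega>"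

lemma test_functions_iff: "\<phi> \<in> test_functions \<Omega> \<longleftrightarrow> smooth_compact \<Omega> \<phi>"
  by (simp add: test_functions_def smooth_compact_def)

lemma smooth_compactI:
  assumes "\<And>k. cont_diff k \<phi>" "compact K" "K \<subseteq> \<Omega>" "\<And>x. x \<notin> K \<Longrightarrow> \<phi> x = 0"
  shows "smooth_compact \<Omega> \<phi>"
proof -
  have "closure {x. \<phi> x \<noteq> 0} \<subseteq> K"
    using assms(2,4) by (intro closure_minimal compact_imp_closed) auto
  moreover from this have "compact (closure {x. \<phi> x \<noteq> 0})"
    using assms(2) by (meson closed_closure compact_closure bounded_subset compact_imp_bounded closure_subset subset_trans)
  ultimately show ?thesis
    using assms(1,3) by (auto simp: smooth_compact_def)
qed

lemma smooth_compactE: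
  assumes "smooth_compact \<Omega> \<phi>"
  obtains K where "compact K" "K \<subseteq> \<Omega>" "\<And>x. x \<notin> K \<Longrightarrow> \<phi> x = 0" "\<And>k. cont_diff k \<phi>"
proof (rule that[of "closure {x. \<phi> x \<noteq> 0}"])
  show "\<phi> x = 0" if "x \<notin> closure {x. \<phi> x \<noteq> 0}" for x
    using that closure_subset[of "{x. \<phi> x \<noteq> 0}"] by blast
qed (use assms in \<open>auto simp: smooth_compact_def\<close>)

lemma smooth_compact_add:
  assumes "smooth_compact \<Omega> \<phi>" "smooth_compact \<Omega> \<psi>"
  shows "smooth_compact \<Omega> (\<lambda>x. \<phi> x + \<psi> x)"
proof -
  obtain K where K: "compact K" "K \<subseteq> \<Omega>" "\<And>x. x \<notin> K \<Longrightarrow> \<phi> x = 0" "\<And>k. cont_diff k \<phi>"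
    using smooth_compactE[OF assms(1)] by metis
  obtain M where M: "compact M" "M \<subseteq> \<Omega>" "\<And>x. x \<notin> M \<Longrightarrow> \<psi> x = 0" "\<And>k. cont_diff k \<psi>"
    using smooth_compactE[OF assms(2)] by metis
  show ?thesis
    by (rule smooth_compactI[of _ "K \<union> M"]) (use K M in \<open>auto intro: cont_diff_add\<close>)
qed

lemma smooth_compact_scaleR:
  assumes "smooth_compact \<Omega> (f :: R3 \<Rightarrow> real)" "\<And>k. cont_diff k g"
  shows "smooth_compact \<Omega> (\<lambda>x. f x *\<^sub>R g x)"
  by (rule smooth_compactE[OF assms(1)], rule smooth_compactI) (use assms(2) in \<open>auto intro: cont_diff_scaleR\<close>)

lemma smooth_compact_cmult:
  assumes "smooth_compact \<Omega> g"
  shows "smooth_compact \<Omega> (\<lambda>x. c *\<^sub>R g x)"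
  by (rule smooth_compactE[OF assms(1)], rule smooth_compactI) (auto intro: cont_diff_cmult)

lemma smooth_compact_zero: "smooth_compact \<Omega> (\<lambda>x. 0)"
  by (rule smooth_compactI[of _ "{}"]) (auto intro: cont_diff_const)

lemma smooth_compact_mono: "smooth_compact U \<phi> \<Longrightarrow> U \<subseteq> \<Omega> \<Longrightarrow> smooth_compact \<Omega> \<phi>"
  by (auto simp: smooth_compact_def)

text \<open>If \<open>0 \<le> b\<^sub>k \<le> 1\<close> are bump functions whose positivity sets cover \<open>U\<close>, then the functions
  \<open>1 - (\<Prod>k<n. (1 - b\<^sub>k / 2) ^ n)\<close> vanish where \<open>b\<^sub>0, \<dots>, b\<^bsub>n-1\<^esub>\<close> do, hence have compact support, and
  tend to the indicator function of \<open>U\<close>.\<close>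

lemma open_indicator_smooth_approx:
  assumes "open U"
  obtains G :: "nat \<Rightarrow> R3 \<Rightarrow> real" where "\<And>n. smooth_compact U (G n)" "\<And>n x. 0 \<le> G n x" "\<And>n x. G n x \<le> 1"
    "\<And>x. (\<lambda>n. G n x) \<longlonglongrightarrow> indicator U x"
proof (cases "U = {}")
  case True
  then show thesis
    by (intro that[of "\<lambda>n x. 0"]) (auto intro: smooth_compact_zero)
next
  case False
  define F where "F = {box a b | a b :: R3. cbox a b \<subseteq> U}"
  have "\<Union>F = U"
  proof
    show "\<Union>F \<subseteq> U" using box_subset_cbox by (auto simp: F_def)
    show "U \<subseteq> \<Union>F"
    proof
      fix x assume "x \<in> U"
      obtain a b where "cbox a b \<subseteq> U" "x \<in> box a b"
        using open_contains_cbox[OF assms \<open>x \<in> U\<close>] by metis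
      then show "x \<in> \<Union>F" by (auto simp: F_def)
    qed
  qed
  moreover have "\<And>S. S \<in> F \<Longrightarrow> open S" by (auto simp: F_def)
  ultimately obtain F' where F': "F' \<subseteq> F" "countable F'" "\<Union>F' = U"
    by (metis Lindelof)
  with False have "F' \<noteq> {}" by auto
  then have ran: "range (from_nat_into F') = F'"
    using F' by (simp add: range_from_nat_into)
  have "\<exists>a b. from_nat_into F' k = box a b \<and> cbox a b \<subseteq> U" for k
  proof -
    have "from_nat_into F' k \<in> F" using F'(1) from_nat_into[OF \<open>F' \<noteq> {}\<close>] by blast
    then show ?thesis by (auto simp: F_def)
  qed
  then obtain a b where ab: "\<And>k. from_nat_into F' k = box (a k) (b k)" "\<And>k. cbox (a k) (b k) \<subseteq> U"
    by metis
  define G where "G n x = 1 - (\<Prod>k<n. (1 - bump (a k) (b k) x / 2) ^ n)" for n :: nat and x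
  have fac: "0 \<le> 1 - bump (a k) (b k) x / 2" "1 - bump (a k) (b k) x / 2 \<le> 1" for k x
    using bump_bounds[of "a k" "b k" x] by auto
  have pr: "0 \<le> (\<Prod>k<n. (1 - bump (a k) (b k) x / 2) ^ n)" "(\<Prod>k<n. (1 - bump (a k) (b k) x / 2) ^ n) \<le> 1" for n x
    using fac by (auto intro!: prod_nonneg prod_le_1 power_le_one)
  show thesis
  proof (rule that[of G])
    show "0 \<le> G n x" "G n x \<le> 1" for n x using pr[of x n] by (auto simp: G_def)
    have Gz: "G n x = 0" if "\<And>k. k < n \<Longrightarrow> x \<notin> cbox (a k) (b k)" for n x
      using that by (simp add: G_def bump_zero)
    show "smooth_compact U (G n)" for n
    proof (rule smooth_compactI[of _ "\<Union>k<n. cbox (a k) (b k)"])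
      have "cont_diff j (\<lambda>x. 1 - (\<Prod>k<n. (1 - (1/2) *\<^sub>R bump (a k) (b k) x) ^ n))" for j
        by (intro cont_diff_diff cont_diff_const cont_diff_prod cont_diff_power cont_diff_cmult cont_diff_bump)
      then show "cont_diff j (G n)" for j by (simp add: G_def[abs_def])
    qed (use ab Gz in auto)
    show "(\<lambda>n. G n x) \<longlonglongrightarrow> indicator U x" for x
    proof (cases "x \<in> U")
      case True
      then obtain S where "S \<in> F'" "x \<in> S" using F' by auto
      then obtain k where k: "x \<in> box (a k) (b k)"
        using ran ab(1) by (metis (no_types, opaque_lifting) imageE)
      define c where "c = 1 - bump (a k) (b k) x / 2"
      have c: "0 \<le> c" "c < 1" using fac[of k x] bump_pos[OF k] by (auto simp: c_def)
      \<comment> \<open>The exponent n lets a single box around x suffice: its factor c < 1 already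
        bounds the whole product by c^n.\<close>
      have "(\<lambda>n. \<Prod>k<n. (1 - bump (a k) (b k) x / 2) ^ n) \<longlonglongrightarrow> 0"
      proof (rule real_tendsto_sandwich[of "\<lambda>n. 0" _ _ "\<lambda>n. c ^ n"])
        show "\<forall>\<^sub>F n in sequentially. (\<Prod>k<n. (1 - bump (a k) (b k) x / 2) ^ n) \<le> c ^ n"
          using eventually_gt_at_top[of k]
        proof eventually_elim
          case (elim n)
          then have "(\<Prod>k<n. (1 - bump (a k) (b k) x / 2) ^ n)
             = c ^ n * (\<Prod>k\<in>{..<n} - {k}. (1 - bump (a k) (b k) x / 2) ^ n)"
            by (subst prod.remove[of _ k]) (auto simp: c_def)
          also have "\<dots> \<le> c ^ n * 1"
            using c fac by (intro mult_left_mono prod_le_1) (auto intro!: power_le_one)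
          finally show ?case by simp
        qed
      qed (use pr c in \<open>auto intro: LIMSEQ_realpow_zero\<close>)
      then have "(\<lambda>n. G n x) \<longlonglongrightarrow> 1 - 0"
        unfolding G_def by (intro tendsto_diff tendsto_const)
      then show ?thesis using True by simp
    next
      case False
      then have "G n x = 0" for n using ab(2) by (intro Gz) auto
      then show ?thesis using False by simp
    qed
  qed
qed

section \<open>Integration by parts against compactly supported functions\<close>

lemma integral_translate_lborel:
  fixes g :: "'a::euclidean_space \<Rightarrow> real"
  assumes "g \<in> borel_measurable borel"
  shows "(\<integral>x. g (x + c) \<partial>lborel) = (\<integral>x. g x \<partial>lborel)"
proof -
  have "(\<integral>x. g x \<partial>lborel) = (\<integral>x. g x \<partial>distr lborel borel ((+) c))"
    by (simp add: lborel_distr_plus)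
  also have "\<dots> = (\<integral>x. g (x + c) \<partial>lborel)"
    using assms by (subst integral_distr) (auto simp: add.commute)
  finally show ?thesis by simp
qed

lemma integrable_compact_support:
  fixes f :: "R3 \<Rightarrow> 'b::euclidean_space"
  assumes "continuous_on UNIV f" "compact K" "\<And>x. x \<notin> K \<Longrightarrow> f x = 0"
  shows "integrable lborel f" "\<Omega> \<in> sets lebesgue \<Longrightarrow> integrable (lebesgue_on \<Omega>) f"
proof -
  have "integrable lborel (\<lambda>x. indicator K x *\<^sub>R f x)"
    using assms by (intro borel_integrable_compact) (auto intro: continuous_on_subset)
  also have "(\<lambda>x. indicator K x *\<^sub>R f x) = f"
    using assms(3) by (auto simp: indicator_def)
  finally show i: "integrable lborel f" .
  show "integrable (lebesgue_on \<Omega>) f" if "\<Omega> \<in> sets lebesgue"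
  proof -
    have "integrable lebesgue f" using i by (simp add: integrable_completion)
    then show ?thesis
      using that by (simp add: integrable_restrict_space integrable_mult_indicator)
  qed
qed

text \<open>Testing takes place on \<Omega>, translation invariance on the whole space. For
  functions vanishing outside \<Omega> the two integrals coincide.\<close>

lemma integral_lebesgue_on_eq_lborel:
  fixes f :: "R3 \<Rightarrow> 'b::euclidean_space"
  assumes "f \<in> borel_measurable borel" "\<Omega> \<in> sets lebesgue" "\<And>x. x \<notin> \<Omega> \<Longrightarrow> f x = 0"
  shows "(\<integral>x. f x \<partial>lebesgue_on \<Omega>) = (\<integral>x. f x \<partial>lborel)"
proof -
  have "(\<integral>x. f x \<partial>lebesgue_on \<Omega>) = (\<integral>x. indicator \<Omega> x *\<^sub>R f x \<partial>lebesgue)"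
    using assms(2) by (simp add: integral_restrict_space)
  also have "(\<lambda>x. indicator \<Omega> x *\<^sub>R f x) = f"
    using assms(3) by (auto simp: indicator_def)
  also have "(\<integral>x. f x \<partial>lebesgue) = (\<integral>x. f x \<partial>lborel)"
    using assms(1) by (simp add: integral_completion)
  finally show ?thesis .
qed

lemma cont_diff_1D:
  assumes "cont_diff (Suc 0) g"
  shows "(g has_derivative frechet_derivative g (at x)) (at x)" "continuous_on UNIV (partial i g)"
    "continuous_on UNIV g"
  using assms cont_diff_continuous[OF assms] by (auto simp: frechet_derivative_works[symmetric])

lemma partial_eq_0_outside:
  assumes "compact K" "\<And>x. x \<notin> K \<Longrightarrow> g x = 0" "x \<notin> K"
  shows "partial i g x = 0"
proof -
  have "((\<lambda>x. 0) has_derivative (\<lambda>h. 0)) (at x)" by simp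
  then have "(g has_derivative (\<lambda>h. 0)) (at x)"
    by (rule has_derivative_transform_within_open[of _ _ _ _ "- K"])
       (use assms in \<open>auto simp: open_Compl compact_imp_closed\<close>)
  then show ?thesis by (rule partial_eq)
qed

text \<open>Difference quotients have integral \<open>0\<close> by translation invariance.\<close>

lemma integral_partial_eq_0:
  fixes g :: "R3 \<Rightarrow> real"
  assumes cd: "cont_diff (Suc 0) g" and K: "compact K" "\<And>x. x \<notin> K \<Longrightarrow> g x = 0"
  shows "(\<integral>x. partial i g x \<partial>lborel) = 0"
proof -
  define e :: R3 where "e = axis i 1"
  have ne: "norm e = 1" by (simp add: e_def)
  define p where "p = partial i g"
  have cp: "continuous_on UNIV p" and cg: "continuous_on UNIV g"
    using cont_diff_1D[OF cd] by (auto simp: p_def)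
  have p0: "p x = 0" if "x \<notin> K" for x
    using partial_eq_0_outside[OF K that] by (simp add: p_def)
  have "bounded (p ` K)"
    using cp K(1) by (intro compact_imp_bounded compact_continuous_image) (auto intro: continuous_on_subset)
  then obtain C0 where C0: "\<And>x. x \<in> K \<Longrightarrow> norm (p x) \<le> C0" by (auto simp: bounded_iff)
  define C where "C = max C0 0"
  have C: "\<bar>p x\<bar> \<le> C" for x
    using C0[of x] p0[of x] by (cases "x \<in> K") (auto simp: C_def)
  obtain R where R: "\<And>x. x \<in> K \<Longrightarrow> norm x \<le> R"
    using compact_imp_bounded[OF K(1)] by (auto simp: bounded_iff)
  have line: "((\<lambda>t. g (x + t *\<^sub>R e)) has_real_derivative p (x + t *\<^sub>R e)) (at t)" for x t
  proof -
    have "((\<lambda>t. g (x + t *\<^sub>R e)) has_derivative (\<lambda>h. frechet_derivative g (at (x + t *\<^sub>R e)) (h *\<^sub>R e))) (at t)"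
      by (rule has_derivative_compose[OF _ cont_diff_1D(1)[OF cd], of "\<lambda>t. x + t *\<^sub>R e"])
         (auto intro!: derivative_eq_intros)
    moreover have "frechet_derivative g (at (x + t *\<^sub>R e)) (h *\<^sub>R e) = p (x + t *\<^sub>R e) * h" for h
      using linear_scale[OF has_derivative_linear[OF cont_diff_1D(1)[OF cd]]]
      by (simp add: p_def partial_def e_def mult.commute)
    ultimately show ?thesis
      by (simp add: has_field_derivative_def)
  qed
  define D where "D n x = real (Suc n) * (g (x + (1 / real (Suc n)) *\<^sub>R e) - g x)" for n x
  have mvt: "\<exists>\<xi>. 0 < \<xi> \<and> \<xi> < 1 / real (Suc n) \<and> D n x = p (x + \<xi> *\<^sub>R e)" for n x
  proof -
    obtain \<xi> where "0 < \<xi>" "\<xi> < 1 / real (Suc n)"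
      "g (x + (1 / real (Suc n)) *\<^sub>R e) - g (x + 0 *\<^sub>R e) = (1 / real (Suc n) - 0) * p (x + \<xi> *\<^sub>R e)"
      using MVT2[of 0 "1 / real (Suc n)" "\<lambda>t. g (x + t *\<^sub>R e)" "\<lambda>t. p (x + t *\<^sub>R e)"] line by auto
    then show ?thesis by (intro exI[of _ \<xi>]) (auto simp: D_def)
  qed
  have "(\<lambda>n. \<integral>x. D n x \<partial>lborel) \<longlonglongrightarrow> (\<integral>x. p x \<partial>lborel)"
  \<comment> \<open>By the mean value theorem \<open>D n x\<close> is a value of p at distance less
    than 1 from x, and p vanishes off K, which has radius at most R. Hence the radius R + 1.\<close>
  proof (rule integral_dominated_convergence[where w="\<lambda>x. C * indicator (cball 0 (R + 1)) x"])
    show "p \<in> borel_measurable lborel" using cp by (simp add: borel_measurable_continuous_onI)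
    have "D n \<in> borel_measurable borel" for n
      unfolding D_def using cg
      by (intro borel_measurable_continuous_onI continuous_intros continuous_on_compose2[OF cg]) auto
    then show "D n \<in> borel_measurable lborel" for n by simp
    show "integrable lborel (\<lambda>x::R3. C * indicator (cball 0 (R + 1)) x :: real)"
      by (intro integrable_mult_right integrable_real_indicator) (use emeasure_bounded_finite[OF bounded_cball, of "0::R3" "R + 1"] in auto)
    show "AE x in lborel. (\<lambda>n. D n x) \<longlonglongrightarrow> p x"
    proof (rule AE_I2)
      fix x
      from mvt[of _ x] obtain \<xi> where \<xi>: "\<And>n. 0 < \<xi> n \<and> \<xi> n < 1 / real (Suc n) \<and> D n x = p (x + \<xi> n *\<^sub>R e)"
        by metis
      have "\<xi> \<longlonglongrightarrow> 0"
        by (rule real_tendsto_sandwich[of "\<lambda>n. 0" _ _ "\<lambda>n. 1 / real (Suc n)"])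
           (use \<xi> LIMSEQ_Suc[OF lim_1_over_n] in \<open>auto intro!: always_eventually less_imp_le\<close>)
      then have "(\<lambda>n. x + \<xi> n *\<^sub>R e) \<longlonglongrightarrow> x + 0 *\<^sub>R e" by (intro tendsto_intros)
      then have "(\<lambda>n. p (x + \<xi> n *\<^sub>R e)) \<longlonglongrightarrow> p x"
        using cp by (intro isCont_tendsto_compose[of _ p]) (auto simp: continuous_on_eq_continuous_at)
      then show "(\<lambda>n. D n x) \<longlonglongrightarrow> p x" using \<xi> by simp
    qed
    show "AE x in lborel. norm (D n x) \<le> C * indicator (cball 0 (R + 1)) x" for n
    proof (rule AE_I2)
      fix x
      show "norm (D n x) \<le> C * indicator (cball 0 (R + 1)) x"
      proof (cases "x \<in> cball 0 (R + 1)")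
        case True
        then show ?thesis using mvt[of n x] C by auto
      next
        case False
        obtain \<xi> where \<xi>: "0 < \<xi>" "\<xi> < 1 / real (Suc n)" "D n x = p (x + \<xi> *\<^sub>R e)" using mvt by blast
        have "\<xi> < 1" using \<xi>(2) by (rule order_less_le_trans) simp
        moreover have "norm x \<le> norm (x + \<xi> *\<^sub>R e) + \<xi>"
          using norm_triangle_ineq4[of "x + \<xi> *\<^sub>R e" "\<xi> *\<^sub>R e"] \<xi>(1) ne by simp
        ultimately have "x + \<xi> *\<^sub>R e \<notin> K" using R[of "x + \<xi> *\<^sub>R e"] False by auto
        then show ?thesis using False \<xi>(3) p0 by simp
      qed
    qed
  qed
  moreover have "(\<integral>x. D n x \<partial>lborel) = 0" for n
  proof -
    have gm: "g \<in> borel_measurable borel" using cg by (rule borel_measurable_continuous_onI)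
    have ig: "integrable lborel g" by (rule integrable_compact_support(1)[OF cg K])
    have tr: "integrable lborel (\<lambda>x. g (x + c))" for c
    proof (rule integrable_compact_support(1))
      show "continuous_on UNIV (\<lambda>x. g (x + c))"
        by (rule continuous_on_compose2[OF cg]) (auto intro!: continuous_intros)
      show "compact ((\<lambda>x. x - c) ` K)" using K(1)
        by (rule compact_continuous_image[rotated]) (auto intro!: continuous_intros)
      show "g (x + c) = 0" if "x \<notin> (\<lambda>x. x - c) ` K" for x
        using that K(2)[of "x + c"] by (metis add_diff_cancel_right' image_eqI)
    qed
    show ?thesis
      using ig tr by (simp add: D_def integral_translate_lborel[OF gm])
  qed
  ultimately show ?thesis
    using LIMSEQ_unique[OF _ tendsto_const[of 0 sequentially]] by (simp add: p_def)
qed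

lemma partial_mult:
  fixes f g :: "R3 \<Rightarrow> real"
  assumes "f differentiable at x" "g differentiable at x"
  shows "partial i (\<lambda>x. f x * g x) x = f x * partial i g x + partial i f x * g x"
  using partial_eq[OF has_derivative_mult[OF assms[unfolded frechet_derivative_works]]]
  by (simp add: partial_def)

text \<open>The support of g localizes the product f g, whose partial derivative then integrates to
  0; f may be any continuously differentiable function.\<close>

lemma integral_by_parts:
  fixes f g :: "R3 \<Rightarrow> real"
  assumes f: "cont_diff (Suc 0) f" and g: "cont_diff (Suc 0) g"
    and K: "compact K" "\<And>x. x \<notin> K \<Longrightarrow> g x = 0" "K \<subseteq> \<Omega>" and \<Omega>: "\<Omega> \<in> sets lebesgue"
  shows "integrable (lebesgue_on \<Omega>) (\<lambda>x. f x * partial i g x)"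
    "integrable (lebesgue_on \<Omega>) (\<lambda>x. partial i f x * g x)"
    "(\<integral>x. f x * partial i g x \<partial>lebesgue_on \<Omega>) = - (\<integral>x. partial i f x * g x \<partial>lebesgue_on \<Omega>)"
proof -
  note c = cont_diff_1D[OF f] cont_diff_1D[OF g]
  show i: "integrable (lebesgue_on \<Omega>) (\<lambda>x. f x * partial i g x)"
    by (rule integrable_compact_support(2)[OF _ K(1) _ \<Omega>])
       (use c partial_eq_0_outside[OF K(1,2)] in \<open>auto intro!: continuous_intros\<close>)
  show j: "integrable (lebesgue_on \<Omega>) (\<lambda>x. partial i f x * g x)"
    by (rule integrable_compact_support(2)[OF _ K(1) _ \<Omega>])
       (use c K(2) in \<open>auto intro!: continuous_intros\<close>)
  have "(\<integral>x. partial i (\<lambda>x. f x * g x) x \<partial>lebesgue_on \<Omega>) = (\<integral>x. partial i (\<lambda>x. f x * g x) x \<partial>lborel)"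
  proof (rule integral_lebesgue_on_eq_lborel[OF _ \<Omega>])
    show "partial i (\<lambda>x. f x * g x) \<in> borel_measurable borel"
      using cont_diff_1D(2)[OF cont_diff_mult[OF f g]] by (rule borel_measurable_continuous_onI)
    show "partial i (\<lambda>x. f x * g x) x = 0" if "x \<notin> \<Omega>" for x
      using that K by (intro partial_eq_0_outside[OF K(1)]) auto
  qed
  also have "\<dots> = 0"
    by (rule integral_partial_eq_0[OF cont_diff_mult[OF f g] K(1)]) (simp add: K(2))
  finally have "0 = (\<integral>x. partial i (\<lambda>x. f x * g x) x \<partial>lebesgue_on \<Omega>)" ..
  also have "\<dots> = (\<integral>x. f x * partial i g x + partial i f x * g x \<partial>lebesgue_on \<Omega>)"
    using f g by (intro Bochner_Integration.integral_cong) (auto simp: partial_mult)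
  also have "\<dots> = (\<integral>x. f x * partial i g x \<partial>lebesgue_on \<Omega>) + (\<integral>x. partial i f x * g x \<partial>lebesgue_on \<Omega>)"
    by (rule Bochner_Integration.integral_add[OF i j])
  finally show "(\<integral>x. f x * partial i g x \<partial>lebesgue_on \<Omega>) = - (\<integral>x. partial i f x * g x \<partial>lebesgue_on \<Omega>)"
    by simp
qed

lemma partial_component:
  assumes "f differentiable at x"
  shows "partial i f x $ j = partial i (\<lambda>x. f x $ j) x"
  using partial_eq[OF bounded_linear.has_derivative[OF bounded_linear_vec_nth assms[unfolded frechet_derivative_works]]]
  by (simp add: partial_def)

lemma cont_diff_component:
  assumes "cont_diff (Suc 0) f" shows "cont_diff (Suc 0) (\<lambda>x. f x $ j)"
proof -
  have d: "f differentiable at x" for x using assms by simp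
  show ?thesis
  proof (rule cont_diff_SucI)
    show "((\<lambda>x. f x $ j) has_derivative (\<lambda>h. frechet_derivative f (at x) h $ j)) (at x)" for x
      using bounded_linear.has_derivative[OF bounded_linear_vec_nth d[unfolded frechet_derivative_works]] .
    show "cont_diff 0 (\<lambda>x. frechet_derivative f (at x) (axis i 1) $ j)" for i
      using assms by (auto simp: partial_def[abs_def] intro!: continuous_intros)
  qed
qed

lemma inner_curl_expand:
  fixes u :: R3
  shows "u \<bullet> curl \<psi> x = u $ 1 * partial 2 \<psi> x $ 3 - u $ 1 * partial 3 \<psi> x $ 2
    + u $ 2 * partial 3 \<psi> x $ 1 - u $ 2 * partial 1 \<psi> x $ 3
    + u $ 3 * partial 1 \<psi> x $ 2 - u $ 3 * partial 2 \<psi> x $ 1"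
  by (simp add: curl_def inner_vec_def sum_3 algebra_simps)

text \<open>In the six component terms the minus sign of each integration by parts is cancelled by
  the antisymmetry of the curl, so the curl is formally symmetric.\<close>

lemma integral_curl_by_parts:
  assumes f: "cont_diff (Suc 0) \<phi>" and g: "cont_diff (Suc 0) \<psi>"
    and K: "compact K" "\<And>x. x \<notin> K \<Longrightarrow> \<psi> x = 0" "K \<subseteq> \<Omega>" and \<Omega>: "\<Omega> \<in> sets lebesgue"
  shows "(\<integral>x. \<phi> x \<bullet> curl \<psi> x \<partial>lebesgue_on \<Omega>) = (\<integral>x. curl \<phi> x \<bullet> \<psi> x \<partial>lebesgue_on \<Omega>)"
proof -
  have K0: "\<psi> x $ j = 0" if "x \<notin> K" for x j using K(2)[OF that] by simp
  note parts = integral_by_parts[OF cont_diff_component[OF f] cont_diff_component[OF g] K(1) K0 K(3) \<Omega>]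
  have comp: "partial i \<phi> x $ j = partial i (\<lambda>x. \<phi> x $ j) x"
       "partial i \<psi> x $ j = partial i (\<lambda>x. \<psi> x $ j) x" for i j x
    using f g by (auto intro!: partial_component)
  show ?thesis
    unfolding inner_commute[of "curl \<phi> _"] inner_curl_expand comp
    by (simp add: parts mult.commute[of "\<psi> _ $ _"])
qed

text \<open>A one-sided fundamental lemma of the calculus of variations. Dominated convergence
  extends the inequality from smooth weights to indicators of open sets and then of countable
  intersections of them. Such an intersection agrees with the set h > 0 up to a null set, so the
  positive part of h has integral 0.\<close>

lemma nonneg_test_imp_AE_nonpos:
  fixes h :: "R3 \<Rightarrow> real"
  assumes \<Omega>: "open \<Omega>" and h: "integrable (lebesgue_on \<Omega>) h"
    and test: "\<And>g. smooth_compact \<Omega> g \<Longrightarrow> (\<And>x. 0 \<le> g x) \<Longrightarrow> (\<integral>x. h x * g x \<partial>lebesgue_on \<Omega>) \<le> 0"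
  shows "AE x in lebesgue_on \<Omega>. h x \<le> 0"
proof -
  let ?M = "lebesgue_on \<Omega>"
  have \<Omega>s: "\<Omega> \<in> sets lebesgue" using \<Omega> by simp
  have [measurable]: "h \<in> borel_measurable ?M" using h by simp
  have ind: "indicator S \<in> borel_measurable ?M" if "S \<in> sets lebesgue" for S :: "R3 set"
    using that \<Omega>s by (intro measurable_restrict_space1) auto
  have openU: "(\<integral>x. h x * indicator U x \<partial>?M) \<le> 0" if "open U" for U
  proof -
    have "open (U \<inter> \<Omega>)" using that \<Omega> by auto
    then obtain G where G: "\<And>n. smooth_compact (U \<inter> \<Omega>) (G n)" "\<And>n x. 0 \<le> G n x" "\<And>n x. G n x \<le> 1"
      "\<And>x. (\<lambda>n. G n x) \<longlonglongrightarrow> (indicator (U \<inter> \<Omega>) x :: real)"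
      using open_indicator_smooth_approx by metis
    have "(\<lambda>n. \<integral>x. h x * G n x \<partial>?M) \<longlonglongrightarrow> (\<integral>x. h x * indicator (U \<inter> \<Omega>) x \<partial>?M)"
    proof (rule integral_dominated_convergence[where w="\<lambda>x. norm (h x)"])
      show "AE x in ?M. (\<lambda>n. h x * G n x) \<longlonglongrightarrow> h x * indicator (U \<inter> \<Omega>) x"
        using G(4) by (auto intro!: tendsto_intros)
      have "G n \<in> borel_measurable borel" for n
        using G(1)[of n] cont_diff_continuous[of 0 "G n"]
        by (auto simp: smooth_compact_def intro!: borel_measurable_continuous_onI)
      then have "G n \<in> borel_measurable ?M" for n
        by (intro measurable_restrict_space1 measurable_completion) simp
      then show "(\<lambda>x. h x * G n x) \<in> borel_measurable ?M" for n by measurable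
      show "(\<lambda>x. h x * indicator (U \<inter> \<Omega>) x) \<in> borel_measurable ?M"
        using ind[of "U \<inter> \<Omega>"] that \<Omega> by (intro borel_measurable_times) auto
      show "AE x in ?M. norm (h x * G n x) \<le> norm (h x)" for n
        using G(2,3) by (intro AE_I2) (auto simp: abs_mult intro!: mult_left_le)
    qed (use h in auto)
    moreover have "(\<integral>x. h x * G n x \<partial>?M) \<le> 0" for n
      using smooth_compact_mono[OF G(1)] G(2) by (intro test) auto
    ultimately have "(\<integral>x. h x * indicator (U \<inter> \<Omega>) x \<partial>?M) \<le> 0"
      by (intro LIMSEQ_le_const2) auto
    also have "(\<integral>x. h x * indicator (U \<inter> \<Omega>) x \<partial>?M) = (\<integral>x. h x * indicator U x \<partial>?M)"
      by (intro Bochner_Integration.integral_cong) (auto simp: indicator_def)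
    finally show ?thesis .
  qed
  define A where "A = {x \<in> space ?M. h x > 0}"
  have "A \<in> sets ?M" unfolding A_def by measurable
  then have "A \<in> sets lebesgue" using \<Omega>s by (simp add: sets_restrict_space_iff)
  then obtain C T where CT: "gdelta C" "T \<in> null_sets lebesgue" "A \<union> T = C" "disjnt A T"
    by (rule lebesgue_set_almost_gdelta)
  from CT(1) obtain F :: "nat \<Rightarrow> R3 set" where F: "\<And>n. open (F n)" "C = (\<Inter>n. F n)"
    by (auto elim!: gdelta.cases)
  \<comment> \<open>Finite intersections stay open and their indicators converge pointwise to that
    of C.\<close>
  define D where "D n = (\<Inter>k\<le>n. F k)" for n
  have oD: "open (D n)" for n using F by (auto simp: D_def)
  have "C \<in> sets lebesgue" using F by (auto intro!: sets.countable_INT)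
  have "(\<lambda>n. \<integral>x. h x * indicator (D n) x \<partial>?M) \<longlonglongrightarrow> (\<integral>x. h x * indicator C x \<partial>?M)"
  proof (rule integral_dominated_convergence[where w="\<lambda>x. norm (h x)"])
    show "AE x in ?M. (\<lambda>n. h x * indicator (D n) x) \<longlonglongrightarrow> h x * indicator C x"
    proof (intro AE_I2 tendsto_mult tendsto_const)
      fix x
      show "(\<lambda>n. indicator (D n) x) \<longlonglongrightarrow> (indicator C x :: real)"
      proof (cases "x \<in> C")
        case True
        then show ?thesis using F by (auto simp: D_def)
      next
        case False
        then obtain m where "x \<notin> F m" using F by auto
        then have "\<forall>n\<ge>m. indicator (D n) x = (0::real)" by (auto simp: D_def indicator_def)
        then have "\<forall>\<^sub>F n in sequentially. indicator (D n) x = (0::real)"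
          by (auto simp: eventually_sequentially)
        then show ?thesis using False by (simp add: tendsto_eventually)
      qed
    qed
    show "(\<lambda>x. h x * indicator (D n) x) \<in> borel_measurable ?M" for n
      using ind[of "D n"] oD by (intro borel_measurable_times) auto
    show "(\<lambda>x. h x * indicator C x) \<in> borel_measurable ?M"
      using ind[OF \<open>C \<in> sets lebesgue\<close>] by (intro borel_measurable_times) auto
    show "AE x in ?M. norm (h x * indicator (D n) x) \<le> norm (h x)" for n
      by (intro AE_I2) (auto simp: indicator_def)
  qed (use h in auto)
  then have le: "(\<integral>x. h x * indicator C x \<partial>?M) \<le> 0"
    by (rule LIMSEQ_le_const2) (use openU oD in auto)
  have "AE x in lebesgue. x \<notin> T" using CT(2) by (rule AE_not_in)
  then have "AE x in ?M. x \<notin> T"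
    using \<Omega>s by (simp add: AE_restrict_space_iff) (auto elim: eventually_mono)
  then have eq: "AE x in ?M. h x * indicator C x = max (h x) 0"
    using AE_space
  proof eventually_elim
    case (elim x)
    then have "x \<in> C \<longleftrightarrow> h x > 0" using CT(3) by (auto simp: A_def)
    then show ?case by (auto simp: indicator_def)
  qed
  have im: "integrable ?M (\<lambda>x. max (h x) 0)" using h by (intro integrable_max) auto
  have "(\<integral>x. h x * indicator C x \<partial>?M) = (\<integral>x. max (h x) 0 \<partial>?M)"
    using eq ind[OF \<open>C \<in> sets lebesgue\<close>]
    by (intro integral_cong_AE borel_measurable_times borel_measurable_max) auto
  moreover have "0 \<le> (\<integral>x. max (h x) 0 \<partial>?M)" by (rule integral_nonneg_AE) auto
  ultimately have "(\<integral>x. max (h x) 0 \<partial>?M) = 0"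
    using le by linarith
  then have "AE x in ?M. max (h x) 0 = 0"
    using im by (subst (asm) integral_nonneg_eq_0_iff_AE) auto
  then show ?thesis by eventually_elim (simp add: max_def split: if_splits)
qed

section \<open>The spaces of fields with square integrable curl\<close>

lemma square_integrable_eq: "square_integrable S v \<longleftrightarrow> sqint (lebesgue_on S) v"
  by (simp add: square_integrable_def sqint_def)

text \<open>The norm on matrices is the Frobenius norm here, and Cauchy-Schwarz applies to each
  row.\<close>

lemma norm_matrix_vector_le:
  fixes A :: "real^'n^'m" shows "norm (A *v x) \<le> norm A * norm x"
proof -
  have "norm (A *v x) \<le> L2_set (\<lambda>i. norm (A $ i) * norm x) UNIV"
    unfolding norm_vec_def[of "A *v x"]
    by (intro L2_set_mono) (auto simp: matrix_vector_mul_component Cauchy_Schwarz_ineq2)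
  also have "\<dots> = norm A * norm x"
    by (simp add: norm_vec_def L2_set_left_distrib)
  finally show ?thesis .
qed

lemma borel_measurable_matrix_vector:
  fixes A :: "'a \<Rightarrow> real^'n^'m"
  assumes "A \<in> borel_measurable M" "g \<in> borel_measurable M"
  shows "(\<lambda>x. A x *v g x) \<in> borel_measurable M"
  by (rule borel_measurable_continuous_Pair[OF assms])
     (auto simp: matrix_vector_mult_def intro!: continuous_intros)

text \<open>Testing with a scalar weight times a constant vector u gives lam . u \<le> g |u| almost
  everywhere; inserting u = \<open>lam x\<close> gives the bound. With g = 0 this yields uniqueness
  of the weak curl, with g a multiple of an indicator the pointwise bound on the multiplier.\<close>

lemma AE_norm_le_if_test_le:
  fixes lam :: "R3 \<Rightarrow> R3"
  assumes \<Omega>: "open \<Omega>" and lam: "integrable (lebesgue_on \<Omega>) lam" and g: "integrable (lebesgue_on \<Omega>) g"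
    and test: "\<And>\<phi>. \<phi> \<in> test_functions \<Omega> \<Longrightarrow>
      (\<integral>x. lam x \<bullet> \<phi> x \<partial>lebesgue_on \<Omega>) \<le> (\<integral>x. g x * norm (\<phi> x) \<partial>lebesgue_on \<Omega>)"
  shows "AE x in lebesgue_on \<Omega>. norm (lam x) \<le> g x"
proof -
  let ?M = "lebesgue_on \<Omega>"
  have dir: "AE x in ?M. lam x \<bullet> u - g x * norm u \<le> 0" for u
  proof (rule nonneg_test_imp_AE_nonpos[OF \<Omega>])
    show i: "integrable ?M (\<lambda>x. lam x \<bullet> u - g x * norm u)"
      using lam g by simp
    fix s :: "R3 \<Rightarrow> real" assume s: "smooth_compact \<Omega> s" "\<And>x. 0 \<le> s x"
    have sb: "s \<in> borel_measurable ?M"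
      using s(1) cont_diff_continuous[of 0 s] \<Omega>
      by (intro measurable_restrict_space1 measurable_completion)
         (auto simp: smooth_compact_def intro!: borel_measurable_continuous_onI)
    obtain K where K: "compact K" "\<And>x. x \<notin> K \<Longrightarrow> s x = 0" "continuous_on UNIV s"
      using smooth_compactE[OF s(1)] cont_diff_continuous by metis
    have "bounded (s ` K)"
      using K by (intro compact_imp_bounded compact_continuous_image) (auto intro: continuous_on_subset)
    then obtain C where C: "\<And>x. x \<in> K \<Longrightarrow> norm (s x) \<le> C" by (auto simp: bounded_iff)
    have sC: "norm (s x) \<le> max C 0" for x
      using C[of x] K(2)[of x] by (cases "x \<in> K") auto
    have mult: "integrable ?M (\<lambda>x. k x * s x)" if "integrable ?M k" for k :: "R3 \<Rightarrow> real"
    proof (rule Bochner_Integration.integrable_bound)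
      show "integrable ?M (\<lambda>x. max C 0 * k x)" using that by simp
      show "(\<lambda>x. k x * s x) \<in> borel_measurable ?M"
        using that sb by (intro borel_measurable_times) auto
      show "AE x in ?M. norm (k x * s x) \<le> norm (max C 0 * k x)"
      proof (rule AE_I2)
        fix x
        have "norm (k x * s x) \<le> norm (k x) * max C 0"
          unfolding norm_mult by (intro mult_left_mono sC) auto
        then show "norm (k x * s x) \<le> norm (max C 0 * k x)" by (simp add: abs_mult mult.commute)
      qed
    qed
    have "(\<lambda>x. s x *\<^sub>R u) \<in> test_functions \<Omega>"
      using s(1) by (simp add: test_functions_iff smooth_compact_scaleR cont_diff_const)
    from test[OF this]
    have "(\<integral>x. (lam x \<bullet> u) * s x \<partial>?M) \<le> (\<integral>x. (g x * norm u) * s x \<partial>?M)"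
      using s(2) by (simp add: mult_ac)
    then show "(\<integral>x. (lam x \<bullet> u - g x * norm u) * s x \<partial>?M) \<le> 0"
      using mult[of "\<lambda>x. lam x \<bullet> u"] mult[of "\<lambda>x. g x * norm u"] lam g
      by (simp add: left_diff_distrib)
  qed
  \<comment> \<open>The exceptional null set depends on u. A countable dense set of directions gives
    a common one, and continuity in u reaches all directions.\<close>
  obtain D :: "R3 set" where D: "countable D" "\<And>X. open X \<Longrightarrow> X \<noteq> {} \<Longrightarrow> \<exists>d\<in>D. d \<in> X"
    by (rule countable_dense_setE) blast
  have "AE x in ?M. \<forall>u\<in>D. lam x \<bullet> u - g x * norm u \<le> 0"
    using D(1) dir by (simp add: AE_ball_countable)
  then show ?thesis
  proof eventually_elim
    case (elim x)
    have "closed {u. lam x \<bullet> u - g x * norm u \<le> 0}"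
      by (intro closed_Collect_le continuous_intros)
    then have "- {u. lam x \<bullet> u - g x * norm u \<le> 0} = {}"
      using D(2)[of "- {u. lam x \<bullet> u - g x * norm u \<le> 0}"] elim by (auto simp: open_Compl)
    then have le: "lam x \<bullet> lam x - g x * norm (lam x) \<le> 0" "\<And>u. lam x \<bullet> u - g x * norm u \<le> 0"
      by auto
    show ?case
    proof (cases "lam x = 0")
      case True
      \<comment> \<open>Division by |lam x| is impossible here; any unit direction shows that
        \<open>g x\<close> is nonnegative.\<close>
      with le(2)[of "axis 1 1"] show ?thesis by simp
    next
      case False
      have "norm (lam x) * norm (lam x) \<le> g x * norm (lam x)"
        using le(1) by (simp add: dot_square_norm power2_eq_square)
      with False show ?thesis by simp
    qed
  qed
qed

section \<open>Weak curls, the graph norm and completeness\<close>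

locale curl_domain =
  fixes \<Omega> :: "R3 set"
  assumes open_\<Omega>: "open \<Omega>" and bounded_\<Omega>: "bounded \<Omega>"
begin

abbreviation "M \<equiv> lebesgue_on \<Omega>"

lemma sets_\<Omega>: "\<Omega> \<in> sets lebesgue" using open_\<Omega> by simp

sublocale fin: finite_measure M
proof
  have "emeasure lebesgue \<Omega> < \<infinity>"
    using emeasure_bounded_finite[OF bounded_\<Omega>] open_\<Omega> by simp
  then show "emeasure M (space M) \<noteq> \<infinity>"
    using sets_\<Omega> by (simp add: emeasure_restrict_space)
qed

lemma sqint_compact_support:
  fixes f :: "R3 \<Rightarrow> R3"
  assumes "continuous_on UNIV f" "compact K" "\<And>x. x \<notin> K \<Longrightarrow> f x = 0"
  shows "sqint M f"
proof -
  have "integrable M f" by (rule integrable_compact_support(2)[OF assms sets_\<Omega>])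
  moreover have "integrable M (\<lambda>x. (norm (f x))\<^sup>2)"
    by (rule integrable_compact_support(2)[OF _ assms(2) _ sets_\<Omega>])
       (use assms in \<open>auto intro!: continuous_intros\<close>)
  ultimately show ?thesis by (simp add: sqint_def)
qed

lemma test_sqint: "\<phi> \<in> test_functions \<Omega> \<Longrightarrow> sqint M \<phi>"
  unfolding test_functions_iff
  by (erule smooth_compactE, rule sqint_compact_support) (auto intro: cont_diff_continuous)

lemma continuous_curl: assumes "cont_diff (Suc 0) \<phi>" shows "continuous_on UNIV (curl \<phi>)"
proof -
  note c = continuous_on_diff continuous_on_component cont_diff_1D(2)[OF assms]
  have "continuous_on UNIV (\<lambda>x. curl \<phi> x $ 1)" "continuous_on UNIV (\<lambda>x. curl \<phi> x $ 2)"
    "continuous_on UNIV (\<lambda>x. curl \<phi> x $ 3)"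
    unfolding curl_def vector_3 by (intro c)+
  then have "continuous_on UNIV (\<lambda>x. curl \<phi> x $ i)" for i
    using exhaust_3[of i] by auto
  then have "continuous_on UNIV (\<lambda>x. \<chi> i. curl \<phi> x $ i)"
    by (intro continuous_on_vec_lambda)
  then show ?thesis by simp
qed

lemma test_curl_sqint: assumes "\<phi> \<in> test_functions \<Omega>" shows "sqint M (curl \<phi>)"
proof -
  obtain K where K: "compact K" "K \<subseteq> \<Omega>" "\<And>x. x \<notin> K \<Longrightarrow> \<phi> x = 0" "\<And>k. cont_diff k \<phi>"
    using smooth_compactE[OF assms[unfolded test_functions_iff]] by metis
  show ?thesis
  proof (rule sqint_compact_support[OF _ K(1)])
    show "continuous_on UNIV (curl \<phi>)" by (rule continuous_curl[OF K(4)])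
    show "curl \<phi> x = 0" if "x \<notin> K" for x
      using partial_eq_0_outside[OF K(1,3) that]
      by (simp add: curl_def vec_eq_iff forall_3)
  qed
qed

lemma test_has_weak_curl:
  assumes "\<phi> \<in> test_functions \<Omega>" shows "has_weak_curl \<Omega> \<phi> (curl \<phi>)"
  unfolding has_weak_curl_def square_integrable_eq
proof (intro conjI ballI test_sqint[OF assms] test_curl_sqint[OF assms])
  fix \<psi> assume "\<psi> \<in> test_functions \<Omega>"
  then obtain K where K: "compact K" "K \<subseteq> \<Omega>" "\<And>x. x \<notin> K \<Longrightarrow> \<psi> x = 0" "\<And>k. cont_diff k \<psi>"
    using smooth_compactE[of \<Omega> \<psi>] unfolding test_functions_iff by metis
  have "cont_diff (Suc 0) \<phi>" using assms unfolding test_functions_iff smooth_compact_def by blast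
  then show "(\<integral>x. \<phi> x \<bullet> curl \<psi> x \<partial>M) = (\<integral>x. curl \<phi> x \<bullet> \<psi> x \<partial>M)"
    by (rule integral_curl_by_parts[OF _ K(4) K(1,3,2) sets_\<Omega>])
qed

lemma has_weak_curlD:
  assumes "has_weak_curl \<Omega> v w"
  shows "sqint M v" "sqint M w"
    "\<phi> \<in> test_functions \<Omega> \<Longrightarrow> (\<integral>x. v x \<bullet> curl \<phi> x \<partial>M) = (\<integral>x. w x \<bullet> \<phi> x \<partial>M)"
  using assms by (auto simp: has_weak_curl_def square_integrable_eq)

lemma has_weak_curl_unique:
  assumes "has_weak_curl \<Omega> v w" "has_weak_curl \<Omega> v w'"
  shows "AE x in M. w x = w' x"
proof -
  have w: "sqint M w" "sqint M w'" using assms has_weak_curlD by auto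
  have "AE x in M. norm (w x - w' x) \<le> 0"
  proof (rule AE_norm_le_if_test_le[OF open_\<Omega>])
    show "integrable M (\<lambda>x. w x - w' x)" by (intro fin.sqint_integrable sqint_diff w)
    fix \<phi> assume \<phi>: "\<phi> \<in> test_functions \<Omega>"
    have "(\<integral>x. (w x - w' x) \<bullet> \<phi> x \<partial>M) = (\<integral>x. w x \<bullet> \<phi> x \<partial>M) - (\<integral>x. w' x \<bullet> \<phi> x \<partial>M)"
      using sqint_inner_integrable[OF w(1) test_sqint[OF \<phi>]] sqint_inner_integrable[OF w(2) test_sqint[OF \<phi>]]
      by (simp add: inner_diff_left)
    then show "(\<integral>x. (w x - w' x) \<bullet> \<phi> x \<partial>M) \<le> (\<integral>x. 0 * norm (\<phi> x) \<partial>M)"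
      using has_weak_curlD(3)[OF assms(1) \<phi>] has_weak_curlD(3)[OF assms(2) \<phi>] by simp
  qed simp
  then show ?thesis by eventually_elim simp
qed

lemma has_weak_curl_lin:
  assumes "has_weak_curl \<Omega> v w" "has_weak_curl \<Omega> v' w'"
  shows "has_weak_curl \<Omega> (\<lambda>x. a *\<^sub>R v x + b *\<^sub>R v' x) (\<lambda>x. a *\<^sub>R w x + b *\<^sub>R w' x)"
  unfolding has_weak_curl_def square_integrable_eq
proof (intro conjI ballI)
  note h = has_weak_curlD[OF assms(1)] has_weak_curlD[OF assms(2)]
  show "sqint M (\<lambda>x. a *\<^sub>R v x + b *\<^sub>R v' x)" "sqint M (\<lambda>x. a *\<^sub>R w x + b *\<^sub>R w' x)"
    by (intro sqint_add sqint_scaleR h)+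
  fix \<phi> assume \<phi>: "\<phi> \<in> test_functions \<Omega>"
  note s = test_sqint[OF \<phi>] test_curl_sqint[OF \<phi>]
  show "(\<integral>x. (a *\<^sub>R v x + b *\<^sub>R v' x) \<bullet> curl \<phi> x \<partial>M) = (\<integral>x. (a *\<^sub>R w x + b *\<^sub>R w' x) \<bullet> \<phi> x \<partial>M)"
    using h(3)[OF \<phi>] h(6)[OF \<phi>] sqint_inner_integrable[OF h(1) s(2)] sqint_inner_integrable[OF h(2) s(1)]
      sqint_inner_integrable[OF h(4) s(2)] sqint_inner_integrable[OF h(5) s(1)]
    by (simp add: inner_add_left)
qed

lemma has_weak_curl_weak_curl: "v \<in> Hcurl \<Omega> \<Longrightarrow> has_weak_curl \<Omega> v (weak_curl \<Omega> v)"
  unfolding Hcurl_def weak_curl_def by (simp add: someI_ex)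

lemma weak_curl_eq: "has_weak_curl \<Omega> v w \<Longrightarrow> AE x in M. weak_curl \<Omega> v x = w x"
  using has_weak_curl_unique[OF has_weak_curl_weak_curl] by (auto simp: Hcurl_def)

text \<open>The graph norm of \<open>v\<close> is the \<open>L\<^sup>2\<close> norm of the pair of \<open>v\<close> and its curl.\<close>

definition curl_pair :: "(R3 \<Rightarrow> R3) \<Rightarrow> R3 \<Rightarrow> R3 \<times> R3" where
  "curl_pair v x = (v x, weak_curl \<Omega> v x)"

lemma sqint_Pair: "sqint M f \<Longrightarrow> sqint M g \<Longrightarrow> sqint M (\<lambda>x. (f x :: R3, g x :: R3))"
  by (auto simp: sqint_def norm_Pair)

lemma Hcurl_sqint:
  assumes "v \<in> Hcurl \<Omega>" shows "sqint M v" "sqint M (weak_curl \<Omega> v)" "sqint M (curl_pair v)"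
  using has_weak_curlD[OF has_weak_curl_weak_curl[OF assms]] sqint_Pair
  by (auto simp: curl_pair_def[abs_def])

lemma Hcurl_norm_eq: "v \<in> Hcurl \<Omega> \<Longrightarrow> Hcurl_norm \<Omega> v = l2norm M (curl_pair v)"
  using Hcurl_sqint[of v]
  by (simp add: Hcurl_norm_def l2norm_def curl_pair_def norm_Pair sqint_def)

text \<open>The representative chosen by \<open>weak_curl\<close> respects linear combinations only
  up to null sets, so each algebraic rule comes with an almost everywhere identity.\<close>

lemma Hcurl_lin:
  assumes "u \<in> Hcurl \<Omega>" "v \<in> Hcurl \<Omega>"
  shows "(\<lambda>x. a *\<^sub>R u x + b *\<^sub>R v x) \<in> Hcurl \<Omega>"
    "AE x in M. weak_curl \<Omega> (\<lambda>x. a *\<^sub>R u x + b *\<^sub>R v x) x = a *\<^sub>R weak_curl \<Omega> u x + b *\<^sub>R weak_curl \<Omega> v x"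
  using has_weak_curl_lin[OF assms[THEN has_weak_curl_weak_curl], of a b] weak_curl_eq
  by (auto simp: Hcurl_def)

lemma Hcurl_diff:
  assumes "u \<in> Hcurl \<Omega>" "v \<in> Hcurl \<Omega>"
  shows "(\<lambda>x. u x - v x) \<in> Hcurl \<Omega>"
    "AE x in M. weak_curl \<Omega> (\<lambda>x. u x - v x) x = weak_curl \<Omega> u x - weak_curl \<Omega> v x"
  using Hcurl_lin[OF assms, of 1 "-1"] by simp_all

lemma Hcurl_add:
  assumes "u \<in> Hcurl \<Omega>" "v \<in> Hcurl \<Omega>"
  shows "(\<lambda>x. u x + v x) \<in> Hcurl \<Omega>"
    "AE x in M. weak_curl \<Omega> (\<lambda>x. u x + v x) x = weak_curl \<Omega> u x + weak_curl \<Omega> v x"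
  using Hcurl_lin[OF assms, of 1 1] by simp_all

lemma Hcurl_scaleR:
  assumes "u \<in> Hcurl \<Omega>"
  shows "(\<lambda>x. c *\<^sub>R u x) \<in> Hcurl \<Omega>"
    "AE x in M. weak_curl \<Omega> (\<lambda>x. c *\<^sub>R u x) x = c *\<^sub>R weak_curl \<Omega> u x"
  using Hcurl_lin[OF assms assms, of c 0] by simp_all

lemma test_Hcurl: "\<phi> \<in> test_functions \<Omega> \<Longrightarrow> \<phi> \<in> Hcurl \<Omega>"
  using test_has_weak_curl by (auto simp: Hcurl_def)

lemma Hcurl_norm_diff_eq:
  assumes "u \<in> Hcurl \<Omega>" "v \<in> Hcurl \<Omega>"
  shows "Hcurl_norm \<Omega> (\<lambda>x. u x - v x) = l2norm M (\<lambda>x. curl_pair u x - curl_pair v x)"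
proof -
  note d = Hcurl_diff[OF assms]
  have "l2norm M (curl_pair (\<lambda>x. u x - v x)) = l2norm M (\<lambda>x. curl_pair u x - curl_pair v x)"
  proof (rule l2norm_cong_AE)
    show "AE x in M. curl_pair (\<lambda>x. u x - v x) x = curl_pair u x - curl_pair v x"
      using d(2) by eventually_elim (simp add: curl_pair_def)
    show "curl_pair (\<lambda>x. u x - v x) \<in> borel_measurable M"
      using Hcurl_sqint[OF d(1)] by (simp add: sqint_measurable)
    show "(\<lambda>x. curl_pair u x - curl_pair v x) \<in> borel_measurable M"
      by (intro sqint_measurable sqint_diff Hcurl_sqint assms)
  qed
  then show ?thesis by (simp add: Hcurl_norm_eq[OF d(1)])
qed

lemma Hcurl_norm_scaleR:
  assumes "u \<in> Hcurl \<Omega>" shows "Hcurl_norm \<Omega> (\<lambda>x. c *\<^sub>R u x) = \<bar>c\<bar> * Hcurl_norm \<Omega> u"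
proof -
  note d = Hcurl_scaleR[OF assms, of c]
  have "l2norm M (curl_pair (\<lambda>x. c *\<^sub>R u x)) = l2norm M (\<lambda>x. c *\<^sub>R curl_pair u x)"
  proof (rule l2norm_cong_AE)
    show "AE x in M. curl_pair (\<lambda>x. c *\<^sub>R u x) x = c *\<^sub>R curl_pair u x"
      using d(2) by eventually_elim (simp add: curl_pair_def)
  qed (intro sqint_measurable sqint_scaleR Hcurl_sqint assms d(1))+
  then show ?thesis by (simp add: Hcurl_norm_eq d(1) assms l2norm_scaleR)
qed

lemma Hcurl_norm_nonneg: "0 \<le> Hcurl_norm \<Omega> v"
  by (simp add: Hcurl_norm_def)

lemma Hcurl_norm_minus_commute:
  "u \<in> Hcurl \<Omega> \<Longrightarrow> v \<in> Hcurl \<Omega> \<Longrightarrow> Hcurl_norm \<Omega> (\<lambda>x. u x - v x) = Hcurl_norm \<Omega> (\<lambda>x. v x - u x)"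
  by (simp add: Hcurl_norm_diff_eq) (rule l2norm_minus_commute)

lemma Hcurl_norm_triangle_diff:
  assumes "u \<in> Hcurl \<Omega>" "v \<in> Hcurl \<Omega>" "w \<in> Hcurl \<Omega>"
  shows "Hcurl_norm \<Omega> (\<lambda>x. u x - w x) \<le> Hcurl_norm \<Omega> (\<lambda>x. u x - v x) + Hcurl_norm \<Omega> (\<lambda>x. v x - w x)"
  using assms by (simp add: Hcurl_norm_diff_eq l2norm_triangle_diff Hcurl_sqint)

lemma Hcurl_norm_triangle:
  assumes "u \<in> Hcurl \<Omega>" "v \<in> Hcurl \<Omega>"
  shows "Hcurl_norm \<Omega> (\<lambda>x. u x + v x) \<le> Hcurl_norm \<Omega> u + Hcurl_norm \<Omega> v"
proof -
  note d = Hcurl_add[OF assms]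
  have "l2norm M (curl_pair (\<lambda>x. u x + v x)) = l2norm M (\<lambda>x. curl_pair u x + curl_pair v x)"
  proof (rule l2norm_cong_AE)
    show "AE x in M. curl_pair (\<lambda>x. u x + v x) x = curl_pair u x + curl_pair v x"
      using d(2) by eventually_elim (simp add: curl_pair_def)
  qed (intro sqint_measurable sqint_add Hcurl_sqint assms d(1))+
  then show ?thesis
    using assms by (simp add: Hcurl_norm_eq d(1) l2norm_triangle Hcurl_sqint)
qed

lemma l2norm_le_Hcurl_norm: "v \<in> Hcurl \<Omega> \<Longrightarrow> l2norm M v \<le> Hcurl_norm \<Omega> v"
  unfolding l2norm_def Hcurl_norm_def by (auto intro!: add_increasing2)

lemma Hcurl_norm_0: "Hcurl_norm \<Omega> (\<lambda>x. 0) = 0"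
proof -
  have "(\<lambda>x. 0) \<in> test_functions \<Omega>" by (simp add: test_functions_iff smooth_compact_zero)
  from Hcurl_norm_scaleR[OF test_Hcurl[OF this], of 0] show ?thesis by simp
qed

lemma H0curl_Hcurl: "v \<in> H0curl \<Omega> \<Longrightarrow> v \<in> Hcurl \<Omega>"
  by (simp add: H0curl_def)

lemma test_H0curl: "\<phi> \<in> test_functions \<Omega> \<Longrightarrow> \<phi> \<in> H0curl \<Omega>"
  by (auto simp: H0curl_def test_Hcurl Hcurl_norm_0 intro!: bexI[of _ \<phi>])

lemma H0curl_zero: "(\<lambda>x. 0) \<in> H0curl \<Omega>"
  by (rule test_H0curl) (simp add: test_functions_iff smooth_compact_zero)

lemma H0curl_approx:
  assumes "v \<in> H0curl \<Omega>" "e > 0"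
  obtains \<phi> where "\<phi> \<in> test_functions \<Omega>" "Hcurl_norm \<Omega> (\<lambda>x. v x - \<phi> x) < e"
  using assms unfolding H0curl_def by blast

text \<open>Two approximations with error e / 2 are chained. Membership thus reduces to
  approximation by elements already known to belong to the space, which serves the vector space laws
  as well as limits.\<close>

lemma H0curl_closed:
  assumes v: "v \<in> Hcurl \<Omega>" and approx: "\<And>e. e > 0 \<Longrightarrow> \<exists>u\<in>H0curl \<Omega>. Hcurl_norm \<Omega> (\<lambda>x. v x - u x) < e"
  shows "v \<in> H0curl \<Omega>"
  unfolding H0curl_def
proof (intro CollectI conjI allI impI v)
  fix e :: real assume "e > 0"
  then obtain u where u: "u \<in> H0curl \<Omega>" "Hcurl_norm \<Omega> (\<lambda>x. v x - u x) < e / 2"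
    using approx[of "e / 2"] by auto
  obtain \<phi> where \<phi>: "\<phi> \<in> test_functions \<Omega>" "Hcurl_norm \<Omega> (\<lambda>x. u x - \<phi> x) < e / 2"
    by (rule H0curl_approx[OF u(1) half_gt_zero[OF \<open>e > 0\<close>]])
  have "Hcurl_norm \<Omega> (\<lambda>x. v x - \<phi> x) < e"
    using Hcurl_norm_triangle_diff[OF v H0curl_Hcurl[OF u(1)] test_Hcurl[OF \<phi>(1)]] u(2) \<phi>(2) by simp
  with \<phi>(1) show "\<exists>\<phi>\<in>test_functions \<Omega>. Hcurl_norm \<Omega> (\<lambda>x. v x - \<phi> x) < e" by blast
qed

lemma H0curl_scaleR:
  assumes "v \<in> H0curl \<Omega>" shows "(\<lambda>x. c *\<^sub>R v x) \<in> H0curl \<Omega>"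
proof (rule H0curl_closed)
  have v: "v \<in> Hcurl \<Omega>" by (rule H0curl_Hcurl[OF assms])
  then show "(\<lambda>x. c *\<^sub>R v x) \<in> Hcurl \<Omega>" by (rule Hcurl_scaleR)
  fix e :: real assume "e > 0"
  \<comment> \<open>The added 1 covers c = 0.\<close>
  then have "e / (\<bar>c\<bar> + 1) > 0" by simp
  then obtain \<phi> where \<phi>: "\<phi> \<in> test_functions \<Omega>" "Hcurl_norm \<Omega> (\<lambda>x. v x - \<phi> x) < e / (\<bar>c\<bar> + 1)"
    by (rule H0curl_approx[OF assms])
  have "(\<lambda>x. c *\<^sub>R \<phi> x) \<in> H0curl \<Omega>"
    using \<phi>(1) by (intro test_H0curl) (simp add: test_functions_iff smooth_compact_cmult)
  moreover have "Hcurl_norm \<Omega> (\<lambda>x. c *\<^sub>R v x - c *\<^sub>R \<phi> x) < e"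
  proof -
    have "Hcurl_norm \<Omega> (\<lambda>x. c *\<^sub>R v x - c *\<^sub>R \<phi> x) = \<bar>c\<bar> * Hcurl_norm \<Omega> (\<lambda>x. v x - \<phi> x)"
      using Hcurl_norm_scaleR[OF Hcurl_diff(1)[OF v test_Hcurl[OF \<phi>(1)]], of c] by (simp add: scaleR_diff_right)
    also have "\<dots> \<le> (\<bar>c\<bar> + 1) * Hcurl_norm \<Omega> (\<lambda>x. v x - \<phi> x)"
      by (intro mult_right_mono Hcurl_norm_nonneg) simp
    also have "\<dots> < e" using \<phi>(2) by (simp add: pos_less_divide_eq mult.commute)
    finally show ?thesis .
  qed
  ultimately show "\<exists>u\<in>H0curl \<Omega>. Hcurl_norm \<Omega> (\<lambda>x. c *\<^sub>R v x - u x) < e"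
    by (intro bexI[where x="\<lambda>x. c *\<^sub>R \<phi> x"])
qed

lemma H0curl_add:
  assumes "u \<in> H0curl \<Omega>" "v \<in> H0curl \<Omega>" shows "(\<lambda>x. u x + v x) \<in> H0curl \<Omega>"
proof (rule H0curl_closed)
  have u: "u \<in> Hcurl \<Omega>" and v: "v \<in> Hcurl \<Omega>" using assms H0curl_Hcurl by auto
  then show "(\<lambda>x. u x + v x) \<in> Hcurl \<Omega>" by (rule Hcurl_add)
  fix e :: real assume "e > 0"
  then have e2: "e / 2 > 0" by simp
  obtain \<phi> where \<phi>: "\<phi> \<in> test_functions \<Omega>" "Hcurl_norm \<Omega> (\<lambda>x. u x - \<phi> x) < e / 2"
    by (rule H0curl_approx[OF assms(1) e2])
  obtain \<psi> where \<psi>: "\<psi> \<in> test_functions \<Omega>" "Hcurl_norm \<Omega> (\<lambda>x. v x - \<psi> x) < e / 2"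
    by (rule H0curl_approx[OF assms(2) e2])
  have "(\<lambda>x. \<phi> x + \<psi> x) \<in> H0curl \<Omega>"
    using \<phi>(1) \<psi>(1) by (intro test_H0curl) (simp add: test_functions_iff smooth_compact_add)
  moreover have "Hcurl_norm \<Omega> (\<lambda>x. (u x + v x) - (\<phi> x + \<psi> x)) < e"
    using Hcurl_norm_triangle[OF Hcurl_diff(1)[OF u test_Hcurl[OF \<phi>(1)]] Hcurl_diff(1)[OF v test_Hcurl[OF \<psi>(1)]]]
      \<phi>(2) \<psi>(2) by (simp add: algebra_simps)
  ultimately show "\<exists>w\<in>H0curl \<Omega>. Hcurl_norm \<Omega> (\<lambda>x. (u x + v x) - w x) < e"
    by (intro bexI[where x="\<lambda>x. \<phi> x + \<psi> x"])
qed

lemma H0curl_diff: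
  assumes "u \<in> H0curl \<Omega>" "v \<in> H0curl \<Omega>" shows "(\<lambda>x. u x - v x) \<in> H0curl \<Omega>"
  using H0curl_add[OF assms(1) H0curl_scaleR[OF assms(2), of "-1"]] by simp

text \<open>The curl is a closed operator: fields and curls converge together in L2, and the
  defining identity of the weak curl passes to the limit for each fixed test function.\<close>

theorem H0curl_complete:
  assumes v: "\<And>n. v n \<in> H0curl \<Omega>"
    and Cauchy: "\<And>e. e > 0 \<Longrightarrow> \<exists>N. \<forall>m\<ge>N. \<forall>n\<ge>N. Hcurl_norm \<Omega> (\<lambda>x. v m x - v n x) < e"
  obtains u where "u \<in> H0curl \<Omega>" "(\<lambda>n. Hcurl_norm \<Omega> (\<lambda>x. v n x - u x)) \<longlonglongrightarrow> 0"
proof -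
  have vH: "v n \<in> Hcurl \<Omega>" for n using v H0curl_Hcurl by auto
  obtain V where V: "sqint M V" "(\<lambda>n. l2norm M (\<lambda>x. curl_pair (v n) x - V x)) \<longlonglongrightarrow> 0"
  proof (rule fin.l2_complete[of "\<lambda>n. curl_pair (v n)"])
    show "sqint M (curl_pair (v n))" for n by (rule Hcurl_sqint(3)[OF vH])
    show "\<exists>N. \<forall>m\<ge>N. \<forall>n\<ge>N. l2norm M (\<lambda>x. curl_pair (v m) x - curl_pair (v n) x) < e" if "e > 0" for e
      using Cauchy[OF that] unfolding Hcurl_norm_diff_eq[OF vH vH] .
  qed blast
  define u w where "u x = fst (V x)" and "w x = snd (V x)" for x
  have nle: "norm (fst p) \<le> norm p" "norm (snd p) \<le> norm p" for p :: "R3 \<times> R3"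
    using norm_fst_le[of "fst p" "snd p"] norm_snd_le[of "snd p" "fst p"] by simp_all
  have "u \<in> borel_measurable M" "w \<in> borel_measurable M"
    unfolding u_def[abs_def] w_def[abs_def]
    by (intro borel_measurable_continuous_on[where f=fst] borel_measurable_continuous_on[where f=snd]
        continuous_intros sqint_measurable V)+
  then have uw: "sqint M u" "sqint M w"
    using sqint_bound[OF V(1), of u 1] sqint_bound[OF V(1), of w 1] nle
    by (auto simp: u_def w_def)
  have le: "l2norm M (\<lambda>x. v n x - u x) \<le> l2norm M (\<lambda>x. curl_pair (v n) x - V x)"
    "l2norm M (\<lambda>x. weak_curl \<Omega> (v n) x - w x) \<le> l2norm M (\<lambda>x. curl_pair (v n) x - V x)" for n
  proof -
    have s: "sqint M (\<lambda>x. curl_pair (v n) x - V x)" by (intro sqint_diff Hcurl_sqint vH V)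
    have b: "norm (v n x - u x) \<le> 1 * norm (curl_pair (v n) x - V x)"
      "norm (weak_curl \<Omega> (v n) x - w x) \<le> 1 * norm (curl_pair (v n) x - V x)" for x
      using nle[of "curl_pair (v n) x - V x"] by (auto simp: curl_pair_def u_def w_def)
    have m: "(\<lambda>x. v n x - u x) \<in> borel_measurable M" "(\<lambda>x. weak_curl \<Omega> (v n) x - w x) \<in> borel_measurable M"
      by (intro sqint_measurable sqint_diff Hcurl_sqint vH uw)+
    show "l2norm M (\<lambda>x. v n x - u x) \<le> l2norm M (\<lambda>x. curl_pair (v n) x - V x)"
      using l2norm_mono[OF s m(1), of 1] b(1) by simp
    show "l2norm M (\<lambda>x. weak_curl \<Omega> (v n) x - w x) \<le> l2norm M (\<lambda>x. curl_pair (v n) x - V x)"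
      using l2norm_mono[OF s m(2), of 1] b(2) by simp
  qed
  have lims: "(\<lambda>n. l2norm M (\<lambda>x. v n x - u x)) \<longlonglongrightarrow> 0"
    "(\<lambda>n. l2norm M (\<lambda>x. weak_curl \<Omega> (v n) x - w x)) \<longlonglongrightarrow> 0"
    by (rule real_tendsto_sandwich[OF _ _ tendsto_const V(2)]; use le in auto)+
  have "has_weak_curl \<Omega> u w"
    unfolding has_weak_curl_def square_integrable_eq
  proof (intro conjI ballI uw)
    fix \<phi> assume \<phi>: "\<phi> \<in> test_functions \<Omega>"
    have "(\<lambda>n. \<integral>x. v n x \<bullet> curl \<phi> x \<partial>M) \<longlonglongrightarrow> (\<integral>x. u x \<bullet> curl \<phi> x \<partial>M)"
      by (rule l2_inner_tendsto[OF Hcurl_sqint(1)[OF vH] uw(1) lims(1) test_curl_sqint[OF \<phi>] test_curl_sqint[OF \<phi>]])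
         (simp add: l2norm_def)
    moreover have "(\<lambda>n. \<integral>x. weak_curl \<Omega> (v n) x \<bullet> \<phi> x \<partial>M) \<longlonglongrightarrow> (\<integral>x. w x \<bullet> \<phi> x \<partial>M)"
      by (rule l2_inner_tendsto[OF Hcurl_sqint(2)[OF vH] uw(2) lims(2) test_sqint[OF \<phi>] test_sqint[OF \<phi>]])
         (simp add: l2norm_def)
    moreover have "(\<integral>x. v n x \<bullet> curl \<phi> x \<partial>M) = (\<integral>x. weak_curl \<Omega> (v n) x \<bullet> \<phi> x \<partial>M)" for n
      by (rule has_weak_curlD(3)[OF has_weak_curl_weak_curl[OF vH] \<phi>])
    ultimately show "(\<integral>x. u x \<bullet> curl \<phi> x \<partial>M) = (\<integral>x. w x \<bullet> \<phi> x \<partial>M)"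
      using LIMSEQ_unique by simp
  qed
  then have uH: "u \<in> Hcurl \<Omega>" and wu: "AE x in M. weak_curl \<Omega> u x = w x"
    using weak_curl_eq by (auto simp: Hcurl_def)
  have "l2norm M (\<lambda>x. curl_pair (v n) x - curl_pair u x) = l2norm M (\<lambda>x. curl_pair (v n) x - V x)" for n
  proof (rule l2norm_cong_AE)
    show "AE x in M. curl_pair (v n) x - curl_pair u x = curl_pair (v n) x - V x"
      using wu by eventually_elim (simp add: curl_pair_def u_def w_def)
  qed (intro sqint_measurable sqint_diff Hcurl_sqint vH uH V)+
  then have lim: "(\<lambda>n. Hcurl_norm \<Omega> (\<lambda>x. v n x - u x)) \<longlonglongrightarrow> 0"
    using V(2) by (simp add: Hcurl_norm_diff_eq[OF vH uH])
  have "u \<in> H0curl \<Omega>"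
  proof (rule H0curl_closed[OF uH])
    fix e :: real assume "e > 0"
    then obtain n where "Hcurl_norm \<Omega> (\<lambda>x. v n x - u x) < e"
      using LIMSEQ_D[OF lim, of e] Hcurl_norm_nonneg by fastforce
    then show "\<exists>w\<in>H0curl \<Omega>. Hcurl_norm \<Omega> (\<lambda>x. u x - w x) < e"
      using v Hcurl_norm_minus_commute[OF uH vH] by (metis)
  qed
  from that[OF this lim] show thesis .
qed

end

section \<open>The energy\<close>

lemma measurable_lebesgue_on_subset:
  "f \<in> borel_measurable (lebesgue_on \<Omega>) \<Longrightarrow> \<omega> \<subseteq> \<Omega> \<Longrightarrow> f \<in> borel_measurable (lebesgue_on \<omega>)"
  by (rule measurable_restrict_mono)

lemma integral_lebesgue_on_subset:
  fixes f :: "R3 \<Rightarrow> 'b::euclidean_space"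
  assumes sets: "\<Omega> \<in> sets lebesgue" "\<omega> \<in> sets lebesgue" and sub: "\<omega> \<subseteq> \<Omega>"
  shows "integrable (lebesgue_on \<Omega>) f \<Longrightarrow> integrable (lebesgue_on \<omega>) f"
    "(\<integral>x. f x \<partial>lebesgue_on \<omega>) = (\<integral>x. indicator \<omega> x *\<^sub>R f x \<partial>lebesgue_on \<Omega>)"
    "integrable (lebesgue_on \<Omega>) f \<Longrightarrow> integrable (lebesgue_on \<Omega>) (\<lambda>x. indicator \<omega> x *\<^sub>R f x)"
proof -
  have eq: "(\<lambda>x. indicator \<Omega> x *\<^sub>R indicator \<omega> x *\<^sub>R f x) = (\<lambda>x. indicator \<omega> x *\<^sub>R f x)"
    using sub by (intro ext) (auto split: split_indicator)
  show "(\<integral>x. f x \<partial>lebesgue_on \<omega>) = (\<integral>x. indicator \<omega> x *\<^sub>R f x \<partial>lebesgue_on \<Omega>)"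
    using sets by (simp add: integral_restrict_space eq del: scaleR_scaleR)
  assume i: "integrable (lebesgue_on \<Omega>) f"
  then have "integrable lebesgue (\<lambda>x. indicator \<Omega> x *\<^sub>R f x)"
    using sets by (simp add: integrable_restrict_space)
  then have "integrable lebesgue (\<lambda>x. indicator \<omega> x *\<^sub>R indicator \<Omega> x *\<^sub>R f x)"
    by (rule integrable_mult_indicator[rotated]) (use sets in auto)
  also have "(\<lambda>x. indicator \<omega> x *\<^sub>R indicator \<Omega> x *\<^sub>R f x) = (\<lambda>x. indicator \<omega> x *\<^sub>R f x)"
    using sub by (intro ext) (auto split: split_indicator)
  finally have *: "integrable lebesgue (\<lambda>x. indicator \<omega> x *\<^sub>R f x)" .
  then show "integrable (lebesgue_on \<omega>) f"
    using sets by (simp add: integrable_restrict_space)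
  from * show "integrable (lebesgue_on \<Omega>) (\<lambda>x. indicator \<omega> x *\<^sub>R f x)"
    using sets by (simp add: integrable_restrict_space eq del: scaleR_scaleR)
qed

lemma AE_lebesgue_on_subset:
  assumes "\<Omega> \<in> sets lebesgue" "\<omega> \<in> sets lebesgue" "\<omega> \<subseteq> \<Omega>" "AE x in lebesgue_on \<Omega>. P x"
  shows "AE x in lebesgue_on \<omega>. P x"
  using assms by (auto simp: AE_restrict_space_iff elim!: eventually_mono)

lemma sqint_lebesgue_on_subset:
  fixes f :: "R3 \<Rightarrow> 'b::euclidean_space"
  assumes "\<Omega> \<in> sets lebesgue" "\<omega> \<in> sets lebesgue" "\<omega> \<subseteq> \<Omega>" "sqint (lebesgue_on \<Omega>) f"
  shows "sqint (lebesgue_on \<omega>) f" "l2norm (lebesgue_on \<omega>) f \<le> l2norm (lebesgue_on \<Omega>) f"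
proof -
  note i = integral_lebesgue_on_subset[where f="\<lambda>x. (norm (f x))\<^sup>2", OF assms(1-3)]
  show "sqint (lebesgue_on \<omega>) f"
    using assms(3,4) i(1) by (auto simp: sqint_def intro: measurable_lebesgue_on_subset)
  have "(\<integral>x. indicator \<omega> x *\<^sub>R (norm (f x))\<^sup>2 \<partial>lebesgue_on \<Omega>) \<le> (\<integral>x. (norm (f x))\<^sup>2 \<partial>lebesgue_on \<Omega>)"
    using i(3) assms(4) by (intro integral_mono) (auto simp: sqint_def indicator_def)
  then show "l2norm (lebesgue_on \<omega>) f \<le> l2norm (lebesgue_on \<Omega>) f"
    unfolding l2norm_def i(2) by simp
qed

text \<open>Here q is the gain from convexity at an approximate midpoint. No value lies below the
  infimum, so the gain of two near-minimizers is at most the mean of their excesses. It is used with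
  the graph norm for the energies and with the L2 norm for the representation of
  functionals.\<close>

lemma minimizing_sequence:
  fixes F :: "'v \<Rightarrow> real"
  assumes V: "V \<noteq> {}" and bdd: "\<And>v. v \<in> V \<Longrightarrow> m \<le> F v"
    and mid: "\<And>u v. u \<in> V \<Longrightarrow> v \<in> V \<Longrightarrow> \<exists>w\<in>V. F w \<le> (F u + F v) / 2 - q u v"
  obtains s where "\<And>n::nat. s n \<in> V" "(\<lambda>n. F (s n)) \<longlonglongrightarrow> Inf (F ` V)"
    "\<And>e. e > 0 \<Longrightarrow> \<exists>N. \<forall>m\<ge>N. \<forall>n\<ge>N. q (s m) (s n) < e" "\<And>v. v \<in> V \<Longrightarrow> Inf (F ` V) \<le> F v"
proof -
  let ?I = "Inf (F ` V)"
  have bb: "bdd_below (F ` V)" using bdd by (auto intro!: bdd_belowI)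
  have le: "?I \<le> F v" if "v \<in> V" for v using that bb by (auto intro: cInf_lower)
  have "\<exists>v\<in>V. F v < ?I + 1 / real (Suc n)" for n
    using cInf_lessD[of "F ` V" "?I + 1 / real (Suc n)"] V by auto
  then obtain s where s: "\<And>n. s n \<in> V" "\<And>n. F (s n) < ?I + 1 / real (Suc n)" by metis
  have "(\<lambda>n. F (s n)) \<longlonglongrightarrow> ?I"
  proof (rule real_tendsto_sandwich[where f="\<lambda>n. ?I" and h="\<lambda>n. ?I + 1 / real (Suc n)"])
    show "(\<lambda>n. ?I + 1 / real (Suc n)) \<longlonglongrightarrow> ?I"
      using tendsto_add[OF tendsto_const LIMSEQ_Suc[OF lim_1_over_n], of ?I] by simp
    show "(\<lambda>n. ?I) \<longlonglongrightarrow> ?I" by simp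
    show "\<forall>\<^sub>F n in sequentially. ?I \<le> F (s n)"
      using le[OF s(1)] by (intro always_eventually allI)
    show "\<forall>\<^sub>F n in sequentially. F (s n) \<le> ?I + 1 / real (Suc n)"
      using less_imp_le[OF s(2)] by (intro always_eventually allI)
  qed
  moreover have "\<exists>N. \<forall>m\<ge>N. \<forall>n\<ge>N. q (s m) (s n) < e" if e: "e > 0" for e
  proof -
    obtain N where N: "1 / real (Suc N) < e" by (rule nat_approx_posE[OF e])
    show ?thesis
    proof (intro exI[of _ N] allI impI)
      fix m n assume "m \<ge> N" "n \<ge> N"
      then have "1 / real (Suc m) \<le> 1 / real (Suc N)" "1 / real (Suc n) \<le> 1 / real (Suc N)"
        by (auto intro!: divide_left_mono)
      moreover obtain w where w: "w \<in> V" "F w \<le> (F (s m) + F (s n)) / 2 - q (s m) (s n)"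
        using mid[OF s(1) s(1)] by blast
      moreover note le[OF w(1)]
      \<comment> \<open>Both values exceed the infimum by less than 1 / (N + 1), while the value at
        w does not fall below it.\<close>
      ultimately show "q (s m) (s n) < e"
        using s(2)[of m] s(2)[of n] N by argo
    qed
  qed
  ultimately show thesis by (rule that[OF s(1) _ _ le])
qed

text \<open>First order optimality: divide by t and let t = 1 / (n + 1) tend to 0.\<close>

lemma linear_term_nonneg:
  fixes b c :: real
  assumes "\<And>t. 0 < t \<Longrightarrow> t \<le> 1 \<Longrightarrow> 0 \<le> t * b + t\<^sup>2 * c"
  shows "0 \<le> b"
proof -
  have "(\<lambda>n. b + 1 / real (Suc n) * c) \<longlonglongrightarrow> b + 0 * c"
    by (intro tendsto_intros LIMSEQ_Suc[OF lim_1_over_n])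
  moreover have "0 \<le> b + 1 / real (Suc n) * c" for n
  proof -
    define t where "t = 1 / real (Suc n)"
    have t: "0 < t" "t \<le> 1" by (auto simp: t_def)
    have "t * b + t\<^sup>2 * c = t * (b + t * c)" by (simp add: power2_eq_square algebra_simps)
    with assms[OF t] t(1) have "0 \<le> b + t * c" by (simp add: zero_le_mult_iff)
    then show ?thesis by (simp add: t_def)
  qed
  ultimately show ?thesis using LIMSEQ_le_const[of "\<lambda>n. b + 1 / real (Suc n) * c" b 0] by simp
qed

section \<open>Coefficient matrices as bounded, symmetric and coercive operators on L2\<close>

context curl_domain
begin

lemma coefficient_sqint:
  assumes A: "coefficient \<Omega> B A"
  shows "sqint M g \<Longrightarrow> sqint M (\<lambda>x. A x *v g x)"
    and "\<exists>C\<ge>0. \<forall>g. sqint M g \<longrightarrow> l2norm M (\<lambda>x. A x *v g x) \<le> C * l2norm M g"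
proof -
  obtain C0 where C0: "AE x in M. norm (A x) \<le> C0"
    using assms by (auto simp: coefficient_def ess_bounded_def)
  define C where "C = max C0 0"
  have C: "C \<ge> 0" by (simp add: C_def)
  have bnd: "AE x in M. norm (A x *v g x) \<le> C * norm (g x)" for g
    using C0
  proof eventually_elim
    case (elim x)
    have "norm (A x *v g x) \<le> norm (A x) * norm (g x)" by (rule norm_matrix_vector_le)
    also have "\<dots> \<le> C * norm (g x)" using elim by (intro mult_right_mono) (auto simp: C_def)
    finally show ?case .
  qed
  have meas: "(\<lambda>x. A x *v g x) \<in> borel_measurable M" if "sqint M g" for g
    using A that by (intro borel_measurable_matrix_vector) (auto simp: sqint_def coefficient_def ess_bounded_def)
  show "sqint M (\<lambda>x. A x *v g x)" if "sqint M g"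
    by (rule sqint_bound[OF that meas[OF that] bnd])
  show "\<exists>C\<ge>0. \<forall>g. sqint M g \<longrightarrow> l2norm M (\<lambda>x. A x *v g x) \<le> C * l2norm M g"
    using l2norm_mono[OF _ meas bnd C] C by (intro exI[of _ C]) simp
qed

lemma coefficient_commute:
  assumes A: "coefficient \<Omega> B A" and g: "sqint M g" and h: "sqint M h"
  shows "(\<integral>x. (A x *v g x) \<bullet> h x \<partial>M) = (\<integral>x. (A x *v h x) \<bullet> g x \<partial>M)"
proof (rule integral_cong_AE)
  have sym: "AE x in M. transpose (A x) = A x" using A by (simp add: coefficient_def)
  then show "AE x in M. (A x *v g x) \<bullet> h x = (A x *v h x) \<bullet> g x"
  proof eventually_elim
    case (elim x)
    have "(A x *v g x) \<bullet> h x = (g x v* transpose (A x)) \<bullet> h x"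
      by (simp add: vector_transpose_matrix)
    also have "\<dots> = g x \<bullet> (A x *v h x)" using elim by (simp add: dot_lmul_matrix)
    finally show ?case by (simp add: inner_commute)
  qed
qed (intro borel_measurable_inner sqint_measurable coefficient_sqint(1)[OF A] g h)+

lemma coefficient_coercive:
  assumes A: "coefficient \<Omega> B A"
  shows "\<exists>c>0. \<forall>g. sqint M g \<longrightarrow> c * (l2norm M g)\<^sup>2 \<le> (\<integral>x. (A x *v g x) \<bullet> g x \<partial>M)"
proof -
  obtain c where c: "c > 0" "AE x in M. \<forall>\<xi>. \<xi> \<bullet> (A x *v \<xi>) \<ge> c * (norm \<xi>)\<^sup>2"
    using assms by (auto simp: coefficient_def)
  have "c * (l2norm M g)\<^sup>2 \<le> (\<integral>x. (A x *v g x) \<bullet> g x \<partial>M)" if g: "sqint M g" for g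
  proof -
    have "(\<integral>x. c * (norm (g x))\<^sup>2 \<partial>M) \<le> (\<integral>x. (A x *v g x) \<bullet> g x \<partial>M)"
    proof (rule integral_mono_AE)
      show "AE x in M. c * (norm (g x))\<^sup>2 \<le> (A x *v g x) \<bullet> g x"
        using c(2) by eventually_elim (simp add: inner_commute)
      show "integrable M (\<lambda>x. (A x *v g x) \<bullet> g x)"
        by (rule sqint_inner_integrable[OF coefficient_sqint(1)[OF A g] g])
    qed (use g in \<open>simp add: sqint_def\<close>)
    then show ?thesis by (simp add: l2norm_power2)
  qed
  with c(1) show ?thesis by (intro exI[of _ c]) simp
qed

end

section \<open>The bilinear form and the minimization of convex energies\<close>

locale curl_form = curl_domain +
  fixes B :: "R3 set" and \<nu> \<epsilon> :: "R3 \<Rightarrow> real^3^3"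
  assumes eps: "coefficient \<Omega> B \<epsilon>" and nu: "coefficient \<Omega> B \<nu>"
begin

abbreviation "a \<equiv> bilinear_form \<Omega> \<nu> \<epsilon>"

lemma form_commute:
  assumes "u \<in> Hcurl \<Omega>" "v \<in> Hcurl \<Omega>" shows "a u v = a v u"
  unfolding bilinear_form_def
    coefficient_commute[OF eps Hcurl_sqint(1)[OF assms(1)] Hcurl_sqint(1)[OF assms(2)]]
    coefficient_commute[OF nu Hcurl_sqint(2)[OF assms(1)] Hcurl_sqint(2)[OF assms(2)]] ..

lemma form_lin_right:
  assumes u: "u \<in> Hcurl \<Omega>" and v: "v \<in> Hcurl \<Omega>" and w: "w \<in> Hcurl \<Omega>"
  shows "a u (\<lambda>x. s *\<^sub>R v x + t *\<^sub>R w x) = s * a u v + t * a u w"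
proof -
  note sq = Hcurl_sqint(1,2)[OF u] Hcurl_sqint(1,2)[OF v] Hcurl_sqint(1,2)[OF w]
  have e: "sqint M (\<lambda>x. \<epsilon> x *v u x)" by (rule coefficient_sqint(1)[OF eps sq(1)])
  have n: "sqint M (\<lambda>x. \<nu> x *v weak_curl \<Omega> u x)" by (rule coefficient_sqint(1)[OF nu sq(2)])
  note i = sqint_inner_integrable[OF e sq(3)] sqint_inner_integrable[OF e sq(5)]
    sqint_inner_integrable[OF n sq(4)] sqint_inner_integrable[OF n sq(6)]
  have "(\<integral>x. (\<nu> x *v weak_curl \<Omega> u x) \<bullet> weak_curl \<Omega> (\<lambda>x. s *\<^sub>R v x + t *\<^sub>R w x) x \<partial>M)
     = (\<integral>x. (\<nu> x *v weak_curl \<Omega> u x) \<bullet> (s *\<^sub>R weak_curl \<Omega> v x + t *\<^sub>R weak_curl \<Omega> w x) \<partial>M)"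
  proof (rule integral_cong_AE)
    show "AE x in M. (\<nu> x *v weak_curl \<Omega> u x) \<bullet> weak_curl \<Omega> (\<lambda>x. s *\<^sub>R v x + t *\<^sub>R w x) x
        = (\<nu> x *v weak_curl \<Omega> u x) \<bullet> (s *\<^sub>R weak_curl \<Omega> v x + t *\<^sub>R weak_curl \<Omega> w x)"
      using Hcurl_lin(2)[OF v w, of s t] by eventually_elim simp
  qed (intro borel_measurable_inner sqint_measurable[OF n] sqint_measurable[OF sqint_add]
        sqint_scaleR sq sqint_measurable[OF Hcurl_sqint(2)[OF Hcurl_lin(1)[OF v w]]])+
  then show ?thesis
    unfolding bilinear_form_def using i by (simp add: inner_add_right algebra_simps)
qed

lemma form_bounded:
  obtains C where "C \<ge> 0" "\<And>u v. u \<in> Hcurl \<Omega> \<Longrightarrow> v \<in> Hcurl \<Omega> \<Longrightarrow> \<bar>a u v\<bar> \<le> C * Hcurl_norm \<Omega> u * Hcurl_norm \<Omega> v"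
proof -
  note ms = coefficient_sqint(1)[OF eps] coefficient_sqint(1)[OF nu]
  obtain Ce where Ce: "Ce \<ge> 0" "\<forall>g. sqint M g \<longrightarrow> l2norm M (\<lambda>x. \<epsilon> x *v g x) \<le> Ce * l2norm M g"
    using coefficient_sqint(2)[OF eps] by (elim exE conjE)
  obtain Cn where Cn: "Cn \<ge> 0" "\<forall>g. sqint M g \<longrightarrow> l2norm M (\<lambda>x. \<nu> x *v g x) \<le> Cn * l2norm M g"
    using coefficient_sqint(2)[OF nu] by (elim exE conjE)
  have cl: "l2norm M (weak_curl \<Omega> v) \<le> Hcurl_norm \<Omega> v" for v
    unfolding l2norm_def Hcurl_norm_def by (auto intro!: add_increasing)
  have "\<bar>a u v\<bar> \<le> (Cn + Ce) * Hcurl_norm \<Omega> u * Hcurl_norm \<Omega> v"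
    if u: "u \<in> Hcurl \<Omega>" and v: "v \<in> Hcurl \<Omega>" for u v
  proof -
    note sq = Hcurl_sqint(1,2)[OF u] Hcurl_sqint(1,2)[OF v]
    have part: "\<bar>\<integral>x. f x \<bullet> g x \<partial>M\<bar> \<le> C * Hcurl_norm \<Omega> u * Hcurl_norm \<Omega> v"
      if f: "sqint M f" "l2norm M f \<le> C * l2norm M f'" "l2norm M f' \<le> Hcurl_norm \<Omega> u" "C \<ge> 0"
        and g: "sqint M g" "l2norm M g \<le> Hcurl_norm \<Omega> v" for f g f' :: "R3 \<Rightarrow> R3" and C
    proof -
      have "l2norm M f \<le> C * Hcurl_norm \<Omega> u"
        using f(2) mult_left_mono[OF f(3,4)] by simp
      then have "l2norm M f * l2norm M g \<le> (C * Hcurl_norm \<Omega> u) * Hcurl_norm \<Omega> v"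
        using g(2) f(4) by (intro mult_mono) (auto simp: Hcurl_norm_nonneg)
      with l2_Cauchy_Schwarz[OF f(1) g(1)] show ?thesis by simp
    qed
    have "\<bar>\<integral>x. (\<nu> x *v weak_curl \<Omega> u x) \<bullet> weak_curl \<Omega> v x \<partial>M\<bar> \<le> Cn * Hcurl_norm \<Omega> u * Hcurl_norm \<Omega> v"
      by (rule part[OF ms(2)[OF sq(2)] Cn(2)[rule_format, OF sq(2)] cl Cn(1) sq(4) cl])
    moreover have "\<bar>\<integral>x. (\<epsilon> x *v u x) \<bullet> v x \<partial>M\<bar> \<le> Ce * Hcurl_norm \<Omega> u * Hcurl_norm \<Omega> v"
      by (rule part[OF ms(1)[OF sq(1)] Ce(2)[rule_format, OF sq(1)] l2norm_le_Hcurl_norm[OF u] Ce(1) sq(3) l2norm_le_Hcurl_norm[OF v]])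
    ultimately show ?thesis
      unfolding bilinear_form_def by (simp add: distrib_right)
  qed
  with Ce(1) Cn(1) show thesis by (intro that[of "Cn + Ce"]) auto
qed

lemma form_coercive:
  obtains c where "c > 0" "\<And>u. u \<in> Hcurl \<Omega> \<Longrightarrow> c * (Hcurl_norm \<Omega> u)\<^sup>2 \<le> a u u"
proof -
  obtain ce where ce: "ce > 0" "\<forall>g. sqint M g \<longrightarrow> ce * (l2norm M g)\<^sup>2 \<le> (\<integral>x. (\<epsilon> x *v g x) \<bullet> g x \<partial>M)"
    using coefficient_coercive[OF eps] by (elim exE conjE)
  obtain cn where cn: "cn > 0" "\<forall>g. sqint M g \<longrightarrow> cn * (l2norm M g)\<^sup>2 \<le> (\<integral>x. (\<nu> x *v g x) \<bullet> g x \<partial>M)"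
    using coefficient_coercive[OF nu] by (elim exE conjE)
  have "min cn ce * (Hcurl_norm \<Omega> u)\<^sup>2 \<le> a u u" if u: "u \<in> Hcurl \<Omega>" for u
  proof -
    have "min cn ce * (Hcurl_norm \<Omega> u)\<^sup>2
        = min cn ce * (l2norm M u)\<^sup>2 + min cn ce * (l2norm M (weak_curl \<Omega> u))\<^sup>2"
      by (simp add: Hcurl_norm_def l2norm_power2 distrib_left)
    also have "\<dots> \<le> ce * (l2norm M u)\<^sup>2 + cn * (l2norm M (weak_curl \<Omega> u))\<^sup>2"
      by (intro add_mono mult_right_mono) auto
    also have "\<dots> \<le> a u u"
      unfolding bilinear_form_def using ce(2)[rule_format, OF Hcurl_sqint(1)[OF u]] cn(2)[rule_format, OF Hcurl_sqint(2)[OF u]] by simp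
    finally show ?thesis .
  qed
  with ce(1) cn(1) show thesis by (intro that[of "min cn ce"]) auto
qed

lemma form_diff_right:
  assumes "u \<in> Hcurl \<Omega>" "v \<in> Hcurl \<Omega>" "w \<in> Hcurl \<Omega>"
  shows "a u (\<lambda>x. v x - w x) = a u v - a u w"
  using form_lin_right[OF assms, of 1 "-1"] by simp

lemma form_scale_right:
  assumes "u \<in> Hcurl \<Omega>" "v \<in> Hcurl \<Omega>"
  shows "a u (\<lambda>x. t *\<^sub>R v x) = t * a u v"
  using form_lin_right[OF assms assms(2), of t 0] by simp

lemma form_diff_left:
  assumes "u \<in> Hcurl \<Omega>" "v \<in> Hcurl \<Omega>" "w \<in> Hcurl \<Omega>"
  shows "a (\<lambda>x. u x - v x) w = a u w - a v w"
  using form_diff_right[OF assms(3,1,2)] form_commute[OF Hcurl_diff(1)[OF assms(1,2)] assms(3)]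
    form_commute[OF assms(1,3)] form_commute[OF assms(2,3)] by simp

lemma form_square_lin:
  assumes "u \<in> Hcurl \<Omega>" "v \<in> Hcurl \<Omega>"
  shows "a (\<lambda>x. u x + t *\<^sub>R v x) (\<lambda>x. u x + t *\<^sub>R v x) = a u u + 2 * t * a u v + t\<^sup>2 * a v v"
proof -
  let ?w = "\<lambda>x. u x + t *\<^sub>R v x"
  have w: "?w \<in> Hcurl \<Omega>" using Hcurl_lin(1)[OF assms, of 1 t] by simp
  have "a ?w ?w = a ?w u + t * a ?w v" using form_lin_right[OF w assms, of 1 t] by simp
  also have "a ?w u = a u u + t * a u v"
    using form_lin_right[OF assms(1) assms, of 1 t] form_commute[OF w assms(1)] by simp
  also have "a ?w v = a u v + t * a v v"
    using form_lin_right[OF assms(2) assms, of 1 t] form_commute[OF w assms(2)] form_commute[OF assms] by simp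
  finally show ?thesis by (simp add: power2_eq_square algebra_simps)
qed

text \<open>One existence theorem for both problems. G stands for the nonsmooth integral of j |v| or
  for the potential of the penalized field; it is kept as a convex term and never differentiated, so
  that the minimizer satisfies a variational inequality instead of an equation.\<close>

theorem energy_variational_inequality:
  assumes G0: "\<And>v. v \<in> H0curl \<Omega> \<Longrightarrow> 0 \<le> G v"
    and Gconv: "\<And>u v t. u \<in> H0curl \<Omega> \<Longrightarrow> v \<in> H0curl \<Omega> \<Longrightarrow> 0 \<le> t \<Longrightarrow> t \<le> 1 \<Longrightarrow>
      G (\<lambda>x. u x + t *\<^sub>R (v x - u x)) \<le> (1 - t) * G u + t * G v"
    and GLip: "\<And>u v. u \<in> H0curl \<Omega> \<Longrightarrow> v \<in> H0curl \<Omega> \<Longrightarrow> \<bar>G u - G v\<bar> \<le> K * Hcurl_norm \<Omega> (\<lambda>x. u x - v x)"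
    and f: "sqint M f"
  obtains E where "E \<in> H0curl \<Omega>"
    "\<And>v. v \<in> H0curl \<Omega> \<Longrightarrow> a E (\<lambda>x. v x - E x) + G v - G E \<ge> (\<integral>x. f x \<bullet> (v x - E x) \<partial>M)"
proof -
  obtain C where C: "C \<ge> 0" "\<And>u v. u \<in> Hcurl \<Omega> \<Longrightarrow> v \<in> Hcurl \<Omega> \<Longrightarrow> \<bar>a u v\<bar> \<le> C * Hcurl_norm \<Omega> u * Hcurl_norm \<Omega> v"
    by (rule form_bounded) blast
  obtain c where c: "c > 0" "\<And>u. u \<in> Hcurl \<Omega> \<Longrightarrow> c * (Hcurl_norm \<Omega> u)\<^sup>2 \<le> a u u"
    by (rule form_coercive) blast
  note H = H0curl_Hcurl
  define l where "l v = (\<integral>x. f x \<bullet> v x \<partial>M)" for v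
  have l_lin: "l (\<lambda>x. u x + t *\<^sub>R v x) = l u + t * l v" if "u \<in> H0curl \<Omega>" "v \<in> H0curl \<Omega>" for u v t
    using sqint_inner_integrable[OF f Hcurl_sqint(1)[OF H[OF that(1)]]]
      sqint_inner_integrable[OF f Hcurl_sqint(1)[OF H[OF that(2)]]]
    by (simp add: l_def inner_add_right)
  have l_bd: "\<bar>l v\<bar> \<le> l2norm M f * Hcurl_norm \<Omega> v" if "v \<in> H0curl \<Omega>" for v
  proof -
    have "\<bar>l v\<bar> \<le> l2norm M f * l2norm M v"
      unfolding l_def by (rule l2_Cauchy_Schwarz[OF f Hcurl_sqint(1)[OF H[OF that]]])
    also have "\<dots> \<le> l2norm M f * Hcurl_norm \<Omega> v"
      by (intro mult_left_mono l2norm_le_Hcurl_norm H that) simp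
    finally show ?thesis .
  qed
  define F where "F v = a v v / 2 + G v - l v" for v
  \<comment> \<open>At t = 1/2 the gain t (1 - t) / 2 of the quadratic part is 1/8, and c is the
    coercivity constant.\<close>
  define q where "q u v = c / 8 * (Hcurl_norm \<Omega> (\<lambda>x. u x - v x))\<^sup>2" for u v :: "R3 \<Rightarrow> R3"
  have lin: "(\<lambda>x. u x + t *\<^sub>R v x) \<in> H0curl \<Omega>" if "u \<in> H0curl \<Omega>" "v \<in> H0curl \<Omega>" for u v t
    by (intro H0curl_add H0curl_scaleR that)
  have F_dir: "F (\<lambda>x. u x + t *\<^sub>R (v x - u x)) \<le>
      (1 - t) * F u + t * F v - t * (1 - t) / 2 * a (\<lambda>x. v x - u x) (\<lambda>x. v x - u x)"
    if u: "u \<in> H0curl \<Omega>" and v: "v \<in> H0curl \<Omega>" and t: "0 \<le> t" "t \<le> 1" for u v t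
  proof -
    let ?d = "\<lambda>x. v x - u x"
    have d: "?d \<in> H0curl \<Omega>" by (rule H0curl_diff[OF v u])
    have "a (\<lambda>x. u x + t *\<^sub>R ?d x) (\<lambda>x. u x + t *\<^sub>R ?d x) = a u u + 2 * t * a u ?d + t\<^sup>2 * a ?d ?d"
      by (rule form_square_lin[OF H[OF u] H[OF d]])
    moreover have "a v v = a u u + 2 * a u ?d + a ?d ?d"
      using form_square_lin[OF H[OF u] H[OF d], of 1] by simp
    moreover have "l (\<lambda>x. u x + t *\<^sub>R ?d x) = l u + t * l ?d" "l v = l u + l ?d"
      using l_lin[OF u d, of t] l_lin[OF u d, of 1] by simp_all
    moreover note Gconv[OF u v t]
    moreover have "(1 - t) * (a u u / 2 + G u - l u) + t * ((a u u + 2 * a u ?d + a ?d ?d) / 2 + G v - (l u + l ?d))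
        - t * (1 - t) / 2 * a ?d ?d
        = (a u u + 2 * t * a u ?d + t\<^sup>2 * a ?d ?d) / 2 + ((1 - t) * G u + t * G v) - (l u + t * l ?d)"
      by (simp add: field_simps power2_eq_square)
    ultimately show ?thesis unfolding F_def by simp
  qed
  \<comment> \<open>Coercivity against the linear term leaves c n^2 / 2 - k n with n and k the two
    norms, and completing the square bounds this below by -k^2 / (2 c).\<close>
  have low: "- (l2norm M f)\<^sup>2 / (2 * c) \<le> F v" if v: "v \<in> H0curl \<Omega>" for v
  proof -
    let ?n = "Hcurl_norm \<Omega> v" and ?k = "l2norm M f"
    have "F v \<ge> c * ?n\<^sup>2 / 2 - ?k * ?n"
      using c(2)[OF H[OF v]] G0[OF v] l_bd[OF v] by (simp add: F_def)
    moreover have "c * ?n\<^sup>2 / 2 - ?k * ?n = (c * ?n - ?k)\<^sup>2 / (2 * c) - ?k\<^sup>2 / (2 * c)"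
      using c(1) by (simp add: field_simps power2_eq_square)
    moreover have "(c * ?n - ?k)\<^sup>2 / (2 * c) \<ge> 0" using c(1) by simp
    ultimately show ?thesis by simp
  qed
  obtain s where s: "\<And>n::nat. s n \<in> H0curl \<Omega>" "(\<lambda>n. F (s n)) \<longlonglongrightarrow> Inf (F ` H0curl \<Omega>)"
    "\<And>e. e > 0 \<Longrightarrow> \<exists>N. \<forall>m\<ge>N. \<forall>n\<ge>N. q (s m) (s n) < e" "\<And>v. v \<in> H0curl \<Omega> \<Longrightarrow> Inf (F ` H0curl \<Omega>) \<le> F v"
  proof (rule minimizing_sequence[of "H0curl \<Omega>" "- (l2norm M f)\<^sup>2 / (2 * c)" F q])
    show "H0curl \<Omega> \<noteq> {}" using H0curl_zero by blast
    show "\<exists>w\<in>H0curl \<Omega>. F w \<le> (F u + F v) / 2 - q u v" if "u \<in> H0curl \<Omega>" "v \<in> H0curl \<Omega>" for u v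
    proof (rule bexI)
      show "(\<lambda>x. u x + (1/2) *\<^sub>R (v x - u x)) \<in> H0curl \<Omega>"
        by (rule lin[OF that(1) H0curl_diff[OF that(2,1)]])
      have "q u v \<le> a (\<lambda>x. v x - u x) (\<lambda>x. v x - u x) / 8"
        using c(2)[OF H[OF H0curl_diff[OF that(2,1)]]]
        unfolding q_def Hcurl_norm_minus_commute[OF H[OF that(1)] H[OF that(2)]] by simp
      with F_dir[OF that, of "1/2"] show "F (\<lambda>x. u x + (1/2) *\<^sub>R (v x - u x)) \<le> (F u + F v) / 2 - q u v"
        by (simp add: add_divide_distrib)
    qed
  qed (use low in blast)+
  obtain E where E: "E \<in> H0curl \<Omega>" "(\<lambda>n. Hcurl_norm \<Omega> (\<lambda>x. s n x - E x)) \<longlonglongrightarrow> 0"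
  proof (rule H0curl_complete[of s])
    fix e :: real assume "e > 0"
    then obtain N where N: "\<forall>m\<ge>N. \<forall>n\<ge>N. q (s m) (s n) < c / 8 * e\<^sup>2"
      using s(3)[of "c / 8 * e\<^sup>2"] c(1) by auto
    show "\<exists>N. \<forall>m\<ge>N. \<forall>n\<ge>N. Hcurl_norm \<Omega> (\<lambda>x. s m x - s n x) < e"
    proof (intro exI[of _ N] allI impI)
      fix m n assume "m \<ge> N" "n \<ge> N"
      with N have "(Hcurl_norm \<Omega> (\<lambda>x. s m x - s n x))\<^sup>2 < e\<^sup>2"
        using c(1) by (simp add: q_def)
      then show "Hcurl_norm \<Omega> (\<lambda>x. s m x - s n x) < e"
        using \<open>e > 0\<close> by (simp add: power_less_imp_less_base)
    qed
  qed (use s in blast)+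
  have "(\<lambda>n. F (s n)) \<longlonglongrightarrow> F E"
  proof (rule LIM_zero_cancel, rule tendsto_rabs_zero_cancel, rule real_tendsto_sandwich[where f="\<lambda>n. 0"])
    let ?h = "\<lambda>n. Hcurl_norm \<Omega> (\<lambda>x. s n x - E x)"
    show "\<forall>\<^sub>F n in sequentially. \<bar>F (s n) - F E\<bar>
        \<le> C * Hcurl_norm \<Omega> E * ?h n + C * ?h n * ?h n / 2 + K * ?h n + l2norm M f * ?h n"
    proof (intro always_eventually allI)
      fix n
      let ?d = "\<lambda>x. s n x - E x"
      have d: "?d \<in> H0curl \<Omega>" by (rule H0curl_diff[OF s(1) E(1)])
      have "a (s n) (s n) = a E E + 2 * a E ?d + a ?d ?d"
        using form_square_lin[OF H[OF E(1)] H[OF d], of 1] by simp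
      moreover have "l (s n) = l E + l ?d" using l_lin[OF E(1) d, of 1] by simp
      \<comment> \<open>Expanding the quadratic part around E makes every term carry at least one
        factor that tends to 0 with the distance to E.\<close>
      ultimately have "F (s n) - F E = a E ?d + a ?d ?d / 2 + (G (s n) - G E) - l ?d"
        by (simp add: F_def add_divide_distrib)
      then show "\<bar>F (s n) - F E\<bar> \<le> C * Hcurl_norm \<Omega> E * ?h n + C * ?h n * ?h n / 2 + K * ?h n + l2norm M f * ?h n"
        using C(2)[OF H[OF E(1)] H[OF d]] C(2)[OF H[OF d] H[OF d]] GLip[OF s(1) E(1), of n] l_bd[OF d] by linarith
    qed
    have "(\<lambda>n. C * Hcurl_norm \<Omega> E * ?h n + C * ?h n * ?h n / 2 + K * ?h n + l2norm M f * ?h n) \<longlonglongrightarrow>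
        C * Hcurl_norm \<Omega> E * 0 + C * 0 * 0 / 2 + K * 0 + l2norm M f * 0"
      by (intro tendsto_intros E(2)) auto
    then show "(\<lambda>n. C * Hcurl_norm \<Omega> E * ?h n + C * ?h n * ?h n / 2 + K * ?h n + l2norm M f * ?h n) \<longlonglongrightarrow> 0" by simp
  qed auto
  with s(2) have "Inf (F ` H0curl \<Omega>) = F E" by (rule LIMSEQ_unique)
  with s(4) have min: "F E \<le> F v" if "v \<in> H0curl \<Omega>" for v using that by simp
  show thesis
  proof (rule that[OF E(1)])
    fix v assume v: "v \<in> H0curl \<Omega>"
    let ?d = "\<lambda>x. v x - E x"
    have d: "?d \<in> H0curl \<Omega>" by (rule H0curl_diff[OF v E(1)])
    \<comment> \<open>E is compared with E + t (v - E). Convexity bounds the increment of G linearly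
      in t, so only the quadratic form contributes at order t^2.\<close>
    have "0 \<le> a E ?d + G v - G E - l ?d"
    proof (rule linear_term_nonneg)
      fix t :: real assume t: "0 < t" "t \<le> 1"
      have "a (\<lambda>x. E x + t *\<^sub>R ?d x) (\<lambda>x. E x + t *\<^sub>R ?d x) = a E E + 2 * t * a E ?d + t\<^sup>2 * a ?d ?d"
        by (rule form_square_lin[OF H[OF E(1)] H[OF d]])
      moreover have "l (\<lambda>x. E x + t *\<^sub>R ?d x) = l E + t * l ?d" by (rule l_lin[OF E(1) d])
      moreover have "G (\<lambda>x. E x + t *\<^sub>R ?d x) \<le> (1 - t) * G E + t * G v"
        using t by (intro Gconv E(1) v) auto
      moreover have "F E \<le> F (\<lambda>x. E x + t *\<^sub>R ?d x)" by (rule min[OF lin[OF E(1) d]])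
      ultimately show "0 \<le> t * (a E ?d + G v - G E - l ?d) + t\<^sup>2 * (a ?d ?d / 2)"
        unfolding F_def by (simp add: algebra_simps add_divide_distrib)
    qed
    then show "a E ?d + G v - G E \<ge> (\<integral>x. f x \<bullet> (v x - E x) \<partial>M)" by (simp add: l_def)
  qed
qed

end

section \<open>Solutions of the variational inequality and of the penalized system\<close>

text \<open>The three branches are a single difference of squared positive parts. Continuity is then
  visible without gluing the pieces at 1 - 1 / (2 \<gamma>) and 1 + 1 / (2 \<gamma>).\<close>

lemma max_pen_eq:
  assumes "\<gamma> > 0"
  shows "max_pen \<gamma> x = 1 + \<gamma> / 2 * (max 0 (x - 1 + 1 / (2 * \<gamma>)))\<^sup>2 - \<gamma> / 2 * (max 0 (x - 1 - 1 / (2 * \<gamma>)))\<^sup>2"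
proof -
  define \<delta> where "\<delta> = 1 / (2 * \<gamma>)"
  have \<delta>: "\<delta> > 0" "\<gamma> = 1 / (2 * \<delta>)" using assms by (auto simp: \<delta>_def)
  consider "x - 1 \<ge> \<delta>" | "\<bar>x - 1\<bar> < \<delta>" | "x - 1 \<le> - \<delta>" by linarith
  then show ?thesis
  proof cases
    case 1
    have "\<gamma> / 2 * (x - 1 + \<delta>)\<^sup>2 - \<gamma> / 2 * (x - 1 - \<delta>)\<^sup>2 = x - 1"
      using \<delta> by (simp add: field_simps power2_eq_square)
    then show ?thesis using 1 \<delta>(1) unfolding max_pen_def \<delta>_def[symmetric] by (simp add: max_def)
  next
    case 2
    then show ?thesis using \<delta>(1) unfolding max_pen_def \<delta>_def[symmetric] by (auto simp: max_def)
  next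
    case 3
    then show ?thesis using \<delta>(1) unfolding max_pen_def \<delta>_def[symmetric] by (auto simp: max_def)
  qed
qed

lemma continuous_on_max_pen:
  assumes "\<gamma> > 0" shows "continuous_on UNIV (max_pen \<gamma>)"
proof -
  have "max_pen \<gamma> = (\<lambda>x. 1 + \<gamma> / 2 * (max 0 (x - 1 + 1 / (2 * \<gamma>)))\<^sup>2
      - \<gamma> / 2 * (max 0 (x - 1 - 1 / (2 * \<gamma>)))\<^sup>2)"
    by (rule ext) (rule max_pen_eq[OF assms])
  then show ?thesis by (simp only:) (intro continuous_intros)
qed

text \<open>On the middle branch the excess over 1 and the excess over x are both squares divided by
  4 \<delta>, with \<delta> = 1 / (2 \<gamma>). The last bound adds the largest excess over x on the
  low branch, 1, and the one on the middle branch, \<delta>.\<close>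

lemma max_pen_bounds:
  assumes "\<gamma> > 0"
  shows "1 \<le> max_pen \<gamma> x" "x \<le> max_pen \<gamma> x" "0 \<le> x \<Longrightarrow> max_pen \<gamma> x - x \<le> 1 + 1 / (2 * \<gamma>)"
proof -
  define \<delta> where "\<delta> = 1 / (2 * \<gamma>)"
  have \<delta>: "\<delta> > 0" "\<gamma> = 1 / (2 * \<delta>)" using assms by (auto simp: \<delta>_def)
  have mid: "max_pen \<gamma> x = 1 + (x - 1 + \<delta>)\<^sup>2 / (4 * \<delta>)" "max_pen \<gamma> x - x = (x - 1 - \<delta>)\<^sup>2 / (4 * \<delta>)"
    if "\<bar>x - 1\<bar> < \<delta>"
  proof -
    show "max_pen \<gamma> x = 1 + (x - 1 + \<delta>)\<^sup>2 / (4 * \<delta>)"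
      using that \<delta> unfolding max_pen_def \<delta>_def[symmetric] by auto
    then show "max_pen \<gamma> x - x = (x - 1 - \<delta>)\<^sup>2 / (4 * \<delta>)"
      using \<delta>(1) by (simp add: field_simps power2_eq_square)
  qed
  have low: "max_pen \<gamma> x = 1" if "x - 1 \<le> - \<delta>"
    using that \<delta> unfolding max_pen_def \<delta>_def[symmetric] by auto
  have high: "max_pen \<gamma> x = x" if "x - 1 \<ge> \<delta>"
    using that unfolding max_pen_def \<delta>_def[symmetric] by auto
  have nn: "0 \<le> (x - 1 + \<delta>)\<^sup>2 / (4 * \<delta>)" "0 \<le> (x - 1 - \<delta>)\<^sup>2 / (4 * \<delta>)" using \<delta> by auto
  consider "x - 1 \<ge> \<delta>" | "\<bar>x - 1\<bar> < \<delta>" | "x - 1 \<le> - \<delta>" by linarith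
  note c = this
  show "1 \<le> max_pen \<gamma> x"
    using c by cases (use \<delta> mid low high nn in auto)
  show "x \<le> max_pen \<gamma> x"
    using c
  proof cases
    case 2
    then show ?thesis using mid(2)[OF 2] nn(2) by linarith
  qed (use \<delta> low high in auto)
  have "max_pen \<gamma> x - x \<le> 1 + \<delta>" if "0 \<le> x"
    using c
  proof cases
    case 2
    have "(x - 1 - \<delta>)\<^sup>2 \<le> (2 * \<delta>)\<^sup>2" using 2 by (intro abs_le_square_iff[THEN iffD1]) auto
    then have "(x - 1 - \<delta>)\<^sup>2 / (4 * \<delta>) \<le> \<delta>" using \<delta>(1) by (simp add: field_simps power2_eq_square)
    then show ?thesis using mid(2)[OF 2] by simp
  qed (use \<delta> low high that in auto)
  then show "0 \<le> x \<Longrightarrow> max_pen \<gamma> x - x \<le> 1 + 1 / (2 * \<gamma>)" by (simp add: \<delta>_def)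
qed

text \<open>Written without division: x / max_pen x is nondecreasing on nonnegative x. This
  monotonicity makes the potential of the penalized field convex.\<close>

lemma max_pen_quotient_mono:
  assumes "\<gamma> > 0" "0 \<le> x" "x \<le> y"
  shows "x * max_pen \<gamma> y \<le> y * max_pen \<gamma> x"
proof -
  define \<delta> where "\<delta> = 1 / (2 * \<gamma>)"
  have \<delta>: "\<delta> > 0" "\<gamma> = 1 / (2 * \<delta>)" using assms by (auto simp: \<delta>_def)
  have mid: "max_pen \<gamma> x = 1 + (x - 1 + \<delta>)\<^sup>2 / (4 * \<delta>)" if "\<bar>x - 1\<bar> \<le> \<delta>" "x - 1 < \<delta>" for x
    using that \<delta> unfolding max_pen_def \<delta>_def[symmetric] by auto
  have low: "max_pen \<gamma> x = 1" if "x - 1 \<le> - \<delta>" for x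
    using that \<delta> unfolding max_pen_def \<delta>_def[symmetric] by auto
  have high: "max_pen \<gamma> x = x" if "x - 1 \<ge> \<delta>" for x
    using that unfolding max_pen_def \<delta>_def[symmetric] by auto
  \<comment> \<open>On the middle branch the difference factors through y - x, and the remaining
    factor is nonnegative because x y \<le> (1 + \<delta>)^2 and (1 + \<delta>)^2 - (1 - \<delta>)^2
    = 4 \<delta>.\<close>
  have mm: "x * max_pen \<gamma> y \<le> y * max_pen \<gamma> x"
    if "0 \<le> x" "x \<le> y" "\<bar>x - 1\<bar> \<le> \<delta>" "\<bar>y - 1\<bar> \<le> \<delta>" "y - 1 < \<delta>" for x y
  proof -
    have "y * max_pen \<gamma> x - x * max_pen \<gamma> y
      = y * (1 + (x - 1 + \<delta>)\<^sup>2 / (4 * \<delta>)) - x * (1 + (y - 1 + \<delta>)\<^sup>2 / (4 * \<delta>))"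
      using mid[of x] mid[of y] that by simp
    also have "\<dots> = (y - x) * (1 + ((1 - \<delta>)\<^sup>2 - x * y) / (4 * \<delta>))"
      using \<delta>(1) by (simp add: field_simps power2_eq_square)
    also have "\<dots> \<ge> 0"
    proof (rule mult_nonneg_nonneg)
      have "x * y \<le> (1 + \<delta>) * (1 + \<delta>)" using that \<delta> by (intro mult_mono) auto
      then have "x * y - (1 - \<delta>)\<^sup>2 \<le> 4 * \<delta>" by (simp add: power2_eq_square algebra_simps)
      then show "0 \<le> 1 + ((1 - \<delta>)\<^sup>2 - x * y) / (4 * \<delta>)" using \<delta>(1) by (simp add: field_simps)
    qed (use that in auto)
    finally show ?thesis by simp
  qed
  consider "y - 1 \<ge> \<delta>" | "y - 1 \<le> - \<delta>" | "\<bar>y - 1\<bar> < \<delta>" "\<bar>x - 1\<bar> \<le> \<delta>" | "\<bar>y - 1\<bar> < \<delta>" "x - 1 \<le> - \<delta>"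
    using assms(3) by linarith
  then show ?thesis
  proof cases
    case 1
    have "x * y \<le> max_pen \<gamma> x * y"
      using max_pen_bounds(2)[OF assms(1), of x] assms(2,3) by (intro mult_right_mono) auto
    then show ?thesis using high[OF 1] by (simp add: mult.commute)
  next
    case 2
    then show ?thesis using low[of x] low[of y] assms by simp
  next
    case 3
    then show ?thesis using mm[of x y] assms by auto
  next
    case 4
    \<comment> \<open>When x and y lie on different branches, the comparison goes through the
      junction 1 - \<delta>, where the low and the middle formula agree.\<close>
    have "(1 - \<delta>) * max_pen \<gamma> y \<le> y * max_pen \<gamma> (1 - \<delta>)"
      using 4 assms \<delta>(1) by (intro mm) auto
    moreover have "x * max_pen \<gamma> y \<le> (1 - \<delta>) * max_pen \<gamma> y"
      using 4 max_pen_bounds(1)[OF assms(1), of y] by (intro mult_right_mono) auto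
    ultimately show ?thesis using low[of x] low[of "1 - \<delta>"] 4 by simp
  qed
qed

text \<open>The penalized multiplier as a map of the field value. It equals j v / |v| once \<gamma>
  |v| \<ge> 1 + 1 / (2 \<gamma>), so it is a continuous regularization of the subdifferential of j
  |v|.\<close>

definition pen_field :: "real \<Rightarrow> real \<Rightarrow> R3 \<Rightarrow> R3" where
  "pen_field j \<gamma> v = (j * \<gamma> / max_pen \<gamma> (\<gamma> * norm v)) *\<^sub>R v"

lemma continuous_on_pen_field:
  assumes "\<gamma> > 0" shows "continuous_on UNIV (pen_field j \<gamma>)"
proof -
  have "max_pen \<gamma> (\<gamma> * norm v) \<noteq> 0" for v :: R3
    using max_pen_bounds(1)[OF assms, of "\<gamma> * norm v"] by auto
  then show ?thesis
    unfolding pen_field_def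
    by (auto intro!: continuous_intros continuous_on_compose2[OF continuous_on_max_pen[OF assms]])
qed

lemma norm_pen_field_le:
  assumes "\<gamma> > 0" "j > 0" shows "norm (pen_field j \<gamma> v) \<le> j"
proof -
  define m where "m = max_pen \<gamma> (\<gamma> * norm v)"
  have m: "1 \<le> m" "\<gamma> * norm v \<le> m" using max_pen_bounds[OF assms(1)] by (auto simp: m_def)
  have "norm (pen_field j \<gamma> v) = j * (\<gamma> * norm v) / m"
    using assms m by (simp add: pen_field_def m_def[symmetric])
  also have "\<dots> \<le> j" using m assms by (simp add: divide_le_eq)
  finally show ?thesis .
qed

text \<open>The only source of the penalization error. With s = |v| and m the value of
  \<open>max_pen\<close> at \<gamma> s, the gap is j / \<gamma> times \<gamma> s / m times m -
  \<gamma> s, where the second factor is at most 1 and the third at most 1 + 1 / (2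
  \<gamma>).\<close>

lemma pen_field_inner_ge:
  assumes "\<gamma> > 0" "j > 0"
  shows "j * norm v - pen_field j \<gamma> v \<bullet> v \<le> j * (1 + 1 / (2 * \<gamma>)) / \<gamma>"
proof -
  define s where "s = norm v"
  define m where "m = max_pen \<gamma> (\<gamma> * s)"
  have s: "0 \<le> s" by (simp add: s_def)
  have m: "1 \<le> m" "\<gamma> * s \<le> m" "m - \<gamma> * s \<le> 1 + 1 / (2 * \<gamma>)"
    using max_pen_bounds[OF assms(1)] s assms by (auto simp: m_def)
  have "j * norm v - pen_field j \<gamma> v \<bullet> v = j * s - j * \<gamma> / m * (s * s)"
    by (simp add: pen_field_def s_def m_def dot_square_norm power2_eq_square)
  also have "\<dots> = j / \<gamma> * ((\<gamma> * s) / m * (m - \<gamma> * s))"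
    using assms m(1) by (simp add: field_simps)
  also have "\<dots> \<le> j / \<gamma> * (1 * (1 + 1 / (2 * \<gamma>)))"
    using assms m s by (intro mult_left_mono mult_mono) (auto simp: divide_le_eq_1)
  finally show ?thesis by simp
qed

text \<open>The field is radial with nondecreasing profile p, so the primitive P of p lies above its
  tangents. Since v . (u - v) \<le> |v| (|u| - |v|), this supporting line property carries over to
  the function P of the norm. The potential is used only through the subgradient inequality.\<close>

lemma pen_field_potential:
  assumes \<gamma>: "\<gamma> > 0" and j: "j > 0"
  obtains \<Phi> :: "R3 \<Rightarrow> real" where "\<And>v. 0 \<le> \<Phi> v" "\<And>u v. \<Phi> v + pen_field j \<gamma> v \<bullet> (u - v) \<le> \<Phi> u"
proof -
  define p where "p s = j * \<gamma> * s / max_pen \<gamma> (\<gamma> * s)" for s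
  have mp: "0 < max_pen \<gamma> s" for s using max_pen_bounds(1)[OF \<gamma>, of s] by simp
  then have mp0: "max_pen \<gamma> s \<noteq> 0" for s by (metis less_irrefl)
  have cp: "continuous_on UNIV p"
    unfolding p_def by (auto intro!: continuous_intros continuous_on_compose2[OF continuous_on_max_pen[OF \<gamma>]] mp0)
  then have ip: "p integrable_on {x..y}" for x y
    by (intro integrable_continuous_real continuous_on_subset[OF cp]) auto
  have p0: "0 \<le> p s" if "0 \<le> s" for s
    using that \<gamma> j mp[of "\<gamma> * s"] by (simp add: p_def)
  have mono: "p s \<le> p t" if "0 \<le> s" "s \<le> t" for s t
  proof -
    have "\<gamma> * s * max_pen \<gamma> (\<gamma> * t) \<le> \<gamma> * t * max_pen \<gamma> (\<gamma> * s)"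
      using that \<gamma> by (intro max_pen_quotient_mono) auto
    then have "\<gamma> * s / max_pen \<gamma> (\<gamma> * s) \<le> \<gamma> * t / max_pen \<gamma> (\<gamma> * t)"
      using mp by (simp add: divide_le_eq le_divide_eq pos_le_divide_eq mult.commute mult.left_commute)
    then have "j * (\<gamma> * s / max_pen \<gamma> (\<gamma> * s)) \<le> j * (\<gamma> * t / max_pen \<gamma> (\<gamma> * t))"
      using j by (intro mult_left_mono) auto
    then show ?thesis by (simp add: p_def mult.assoc)
  qed
  define P where "P s = integral {0..s} p" for s
  have P: "p s * (t - s) \<le> P t - P s" if "0 \<le> s" "0 \<le> t" for s t
  proof (cases "s \<le> t")
    case True
    have "P t - P s = integral {s..t} p"
      unfolding P_def using Henstock_Kurzweil_Integration.integral_combine[of 0 s t p] that True ip by simp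
    also have "\<dots> \<ge> integral {s..t} (\<lambda>_. p s)"
      using that True ip by (intro integral_le) (auto intro: mono)
    finally show ?thesis using True by (simp add: mult.commute)
  next
    case False
    have "P s - P t = integral {t..s} p"
      unfolding P_def using Henstock_Kurzweil_Integration.integral_combine[of 0 t s p] that False ip by simp
    also have "\<dots> \<le> integral {t..s} (\<lambda>_. p s)"
      using that False ip by (intro integral_le) (auto intro: mono)
    finally show ?thesis using False by (simp add: algebra_simps)
  qed
  show thesis
  proof (rule that[of "\<lambda>v. P (norm v)"])
    show "0 \<le> P (norm v)" for v :: R3
      unfolding P_def using p0 ip by (intro integral_nonneg) auto
    show "P (norm v) + pen_field j \<gamma> v \<bullet> (u - v) \<le> P (norm u)" for u v :: R3
    proof -
      define k where "k = j * \<gamma> / max_pen \<gamma> (\<gamma> * norm v)"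
      have k: "0 \<le> k" using \<gamma> j mp[of "\<gamma> * norm v"] by (simp add: k_def)
      have "v \<bullet> (u - v) \<le> norm v * (norm u - norm v)"
        using norm_cauchy_schwarz[of v u] by (simp add: inner_diff_right dot_square_norm power2_eq_square algebra_simps)
      then have "k * (v \<bullet> (u - v)) \<le> k * (norm v * (norm u - norm v))" by (rule mult_left_mono[OF _ k])
      also have "\<dots> = p (norm v) * (norm u - norm v)" by (simp add: p_def k_def)
      also have "\<dots> \<le> P (norm u) - P (norm v)" by (rule P) auto
      finally show ?thesis by (simp add: pen_field_def k_def)
    qed
  qed
qed

section \<open>Existence of solutions on a given shape\<close>

context curl_form
begin

lemma subdomain_measure:
  assumes "open \<omega>" "\<omega> \<subseteq> \<Omega>"
  shows "\<omega> \<in> sets lebesgue" "finite_measure (lebesgue_on \<omega>)"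
    "measure (lebesgue_on \<omega>) (space (lebesgue_on \<omega>)) \<le> measure M (space M)"
proof -
  show s: "\<omega> \<in> sets lebesgue" using assms by simp
  have "bounded \<omega>" using assms(2) bounded_\<Omega> bounded_subset by blast
  \<comment> \<open>A shape is itself a bounded open set, so the finiteness of the measure is
    inherited from the locale.\<close>
  with assms(1) interpret w: curl_domain \<omega> by unfold_locales
  show "finite_measure (lebesgue_on \<omega>)" by (rule w.fin.finite_measure_axioms)
  have "measure lebesgue \<omega> \<le> measure lebesgue \<Omega>"
    using assms bounded_\<Omega> open_\<Omega>
    by (intro measure_mono_fmeasurable) (auto simp: bounded_set_imp_lmeasurable)
  then show "measure (lebesgue_on \<omega>) (space (lebesgue_on \<omega>)) \<le> measure M (space M)"
    using s sets_\<Omega> by (simp add: measure_restrict_space)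
qed

text \<open>The constant involves the measure of \<Omega>, so it is the same for all shapes.\<close>

lemma l1_subdomain_le:
  assumes \<omega>: "open \<omega>" "\<omega> \<subseteq> \<Omega>" and v: "sqint M v"
  shows "integrable (lebesgue_on \<omega>) (\<lambda>x. norm (v x))"
    "(\<integral>x. norm (v x) \<partial>lebesgue_on \<omega>) \<le> l2norm M v * sqrt (measure M (space M))"
proof -
  interpret w: finite_measure "lebesgue_on \<omega>" by (rule subdomain_measure(2)[OF \<omega>])
  note s = sqint_lebesgue_on_subset[OF sets_\<Omega> subdomain_measure(1)[OF \<omega>] \<omega>(2) v]
  show "integrable (lebesgue_on \<omega>) (\<lambda>x. norm (v x))" by (rule w.sqint_integrable_norm[OF s(1)])
  have "(\<integral>x. norm (v x) \<partial>lebesgue_on \<omega>) \<le> l2norm (lebesgue_on \<omega>) v * sqrt (measure (lebesgue_on \<omega>) (space (lebesgue_on \<omega>)))"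
    by (rule w.l1_le_l2[OF s(1)])
  also have "\<dots> \<le> l2norm M v * sqrt (measure M (space M))"
    using s(2) subdomain_measure(3)[OF \<omega>] by (intro mult_mono) auto
  finally show "(\<integral>x. norm (v x) \<partial>lebesgue_on \<omega>) \<le> l2norm M v * sqrt (measure M (space M))" .
qed

text \<open>Pointwise convexity and Lipschitz continuity of \<Phi> pass to the functional that
  integrates it over \<omega>; its Lipschitz constant in the graph norm comes from the bound of L1
  by L2 norms. The integrability statement lets later arguments combine the integrals of
  \<Phi>.\<close>

lemma superposition_variational_inequality:
  fixes \<Phi> :: "R3 \<Rightarrow> real"
  assumes \<omega>: "open \<omega>" "\<omega> \<subseteq> \<Omega>" and j: "j \<ge> 0" and nonneg: "\<And>u. 0 \<le> \<Phi> u"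
    and Lip: "\<And>u v. \<bar>\<Phi> u - \<Phi> v\<bar> \<le> j * norm (u - v)"
    and conv: "\<And>u v t. 0 \<le> t \<Longrightarrow> t \<le> 1 \<Longrightarrow> \<Phi> (u + t *\<^sub>R (v - u)) \<le> (1 - t) * \<Phi> u + t * \<Phi> v"
    and f: "sqint M f"
  obtains E where "E \<in> H0curl \<Omega>" "\<forall>v\<in>H0curl \<Omega>.
      a E (\<lambda>x. v x - E x) + (\<integral>x. \<Phi> (v x) \<partial>lebesgue_on \<omega>) - (\<integral>x. \<Phi> (E x) \<partial>lebesgue_on \<omega>)
        \<ge> (\<integral>x. f x \<bullet> (v x - E x) \<partial>M)" "\<forall>v\<in>H0curl \<Omega>. integrable (lebesgue_on \<omega>) (\<lambda>x. \<Phi> (v x))"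
proof -
  let ?W = "lebesgue_on \<omega>"
  interpret w: finite_measure ?W by (rule subdomain_measure(2)[OF \<omega>])
  have cont: "continuous_on UNIV \<Phi>"
  proof (rule lipschitz_on_continuous_on[of j])
    show "j-lipschitz_on UNIV \<Phi>"
      using Lip j by (intro lipschitz_onI) (auto simp: dist_norm)
  qed
  have sq: "sqint M v" if "v \<in> H0curl \<Omega>" for v using that H0curl_Hcurl Hcurl_sqint by blast
  have int: "integrable ?W (\<lambda>x. \<Phi> (v x))" if v: "v \<in> H0curl \<Omega>" for v
  proof (rule Bochner_Integration.integrable_bound)
    show "integrable ?W (\<lambda>x. \<Phi> 0 + j * norm (v x))"
      using l1_subdomain_le(1)[OF \<omega> sq[OF v]] by simp
    have "v \<in> borel_measurable ?W"
      by (rule measurable_lebesgue_on_subset[OF sqint_measurable[OF sq[OF v]] \<omega>(2)])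
    then show "(\<lambda>x. \<Phi> (v x)) \<in> borel_measurable ?W"
      by (rule borel_measurable_continuous_on[OF cont])
    show "AE x in ?W. norm (\<Phi> (v x)) \<le> norm (\<Phi> 0 + j * norm (v x))"
    proof (rule AE_I2)
      fix x
      have "0 \<le> j * norm (v x)" using j by simp
      then show "norm (\<Phi> (v x)) \<le> norm (\<Phi> 0 + j * norm (v x))"
        using Lip[of "v x" 0] nonneg[of 0] nonneg[of "v x"] by simp
    qed
  qed
  obtain E where E: "E \<in> H0curl \<Omega>" "\<And>v. v \<in> H0curl \<Omega> \<Longrightarrow>
      a E (\<lambda>x. v x - E x) + (\<integral>x. \<Phi> (v x) \<partial>?W) - (\<integral>x. \<Phi> (E x) \<partial>?W) \<ge> (\<integral>x. f x \<bullet> (v x - E x) \<partial>M)"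
  proof (rule energy_variational_inequality[of "\<lambda>v. \<integral>x. \<Phi> (v x) \<partial>?W" "j * sqrt (measure M (space M))" f])
    show "0 \<le> (\<integral>x. \<Phi> (v x) \<partial>?W)" for v using nonneg by simp
    show "sqint M f" by (rule f)
    show "(\<integral>x. \<Phi> (u x + t *\<^sub>R (v x - u x)) \<partial>?W) \<le> (1 - t) * (\<integral>x. \<Phi> (u x) \<partial>?W) + t * (\<integral>x. \<Phi> (v x) \<partial>?W)"
      if u: "u \<in> H0curl \<Omega>" and v: "v \<in> H0curl \<Omega>" and t: "0 \<le> t" "t \<le> 1" for u v t
    proof -
      have "(\<lambda>x. u x + t *\<^sub>R (v x - u x)) \<in> H0curl \<Omega>"
        by (intro H0curl_add H0curl_scaleR H0curl_diff u v)
      then have "(\<integral>x. \<Phi> (u x + t *\<^sub>R (v x - u x)) \<partial>?W) \<le> (\<integral>x. (1 - t) * \<Phi> (u x) + t * \<Phi> (v x) \<partial>?W)"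
        using int[OF u] int[OF v] conv[OF t] by (intro integral_mono int) auto
      then show ?thesis using int[OF u] int[OF v] by simp
    qed
    show "\<bar>(\<integral>x. \<Phi> (u x) \<partial>?W) - (\<integral>x. \<Phi> (v x) \<partial>?W)\<bar> \<le> j * sqrt (measure M (space M)) * Hcurl_norm \<Omega> (\<lambda>x. u x - v x)"
      if u: "u \<in> H0curl \<Omega>" and v: "v \<in> H0curl \<Omega>" for u v
    proof -
      note d = H0curl_diff[OF u v]
      note l1 = l1_subdomain_le[OF \<omega> sq[OF d]]
      have "\<bar>(\<integral>x. \<Phi> (u x) \<partial>?W) - (\<integral>x. \<Phi> (v x) \<partial>?W)\<bar> = \<bar>\<integral>x. \<Phi> (u x) - \<Phi> (v x) \<partial>?W\<bar>"
        using int[OF u] int[OF v] by simp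
      also have "\<dots> \<le> (\<integral>x. \<bar>\<Phi> (u x) - \<Phi> (v x)\<bar> \<partial>?W)" by (rule integral_abs_bound)
      also have "\<dots> \<le> (\<integral>x. j * norm (u x - v x) \<partial>?W)"
        using int[OF u] int[OF v] l1(1) Lip by (intro integral_mono) auto
      also have "\<dots> = j * (\<integral>x. norm (u x - v x) \<partial>?W)" by simp
      also have "\<dots> \<le> j * (Hcurl_norm \<Omega> (\<lambda>x. u x - v x) * sqrt (measure M (space M)))"
      proof (rule mult_left_mono[OF _ j])
        have "(\<integral>x. norm (u x - v x) \<partial>?W) \<le> l2norm M (\<lambda>x. u x - v x) * sqrt (measure M (space M))" by (rule l1(2))
        also have "\<dots> \<le> Hcurl_norm \<Omega> (\<lambda>x. u x - v x) * sqrt (measure M (space M))"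
          by (intro mult_right_mono l2norm_le_Hcurl_norm H0curl_Hcurl d) simp
        finally show "(\<integral>x. norm (u x - v x) \<partial>?W) \<le> Hcurl_norm \<Omega> (\<lambda>x. u x - v x) * sqrt (measure M (space M))" .
      qed
      finally show ?thesis by (simp add: mult_ac)
    qed
  qed blast
  show thesis by (rule that[OF E(1)]) (use E(2) int in blast)+
qed

lemma VI_solution_exists:
  assumes \<omega>: "open \<omega>" "\<omega> \<subseteq> \<Omega>" and j: "j > 0" and f: "square_integrable \<Omega> f"
  shows "\<exists>E. VI_solution \<Omega> \<nu> \<epsilon> j f \<omega> E"
proof -
  have conv: "j * norm (u + t *\<^sub>R (v - u)) \<le> (1 - t) * (j * norm u) + t * (j * norm v)"
    if "0 \<le> t" "t \<le> 1" for u v :: R3 and t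
  proof -
    have "norm (u + t *\<^sub>R (v - u)) = norm ((1 - t) *\<^sub>R u + t *\<^sub>R v)"
      by (simp add: algebra_simps)
    also have "\<dots> \<le> (1 - t) * norm u + t * norm v"
      using norm_triangle_ineq[of "(1 - t) *\<^sub>R u" "t *\<^sub>R v"] that by simp
    finally have "j * norm (u + t *\<^sub>R (v - u)) \<le> j * ((1 - t) * norm u + t * norm v)"
      using j by (intro mult_left_mono) auto
    then show ?thesis by (simp add: algebra_simps)
  qed
  have Lip: "\<bar>j * norm u - j * norm v\<bar> \<le> j * norm (u - v)" for u v :: R3
  proof -
    have "\<bar>j * norm u - j * norm v\<bar> = j * \<bar>norm u - norm v\<bar>"
      using j by (simp add: right_diff_distrib[symmetric] abs_mult)
    also have "\<dots> \<le> j * norm (u - v)" using j by (intro mult_left_mono norm_triangle_ineq3) auto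
    finally show ?thesis .
  qed
  obtain E where "E \<in> H0curl \<Omega>" "\<forall>v\<in>H0curl \<Omega>.
      a E (\<lambda>x. v x - E x) + (\<integral>x. j * norm (v x) \<partial>lebesgue_on \<omega>) - (\<integral>x. j * norm (E x) \<partial>lebesgue_on \<omega>)
        \<ge> (\<integral>x. f x \<bullet> (v x - E x) \<partial>M)"
    by (rule superposition_variational_inequality[of \<omega> j "\<lambda>v. j * norm v" f])
       (use \<omega> j f conv Lip in \<open>auto simp: square_integrable_eq\<close>)
  then show ?thesis unfolding VI_solution_def by (intro exI[of _ E]) simp
qed

text \<open>The energy with the potential of \<open>pen_field\<close> yields a variational
  inequality. To recover the equation, the subgradient inequality is used at displaced fields E + t
  z and t tends to 0, so continuity of \<open>pen_field\<close> takes the place of differentiability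
  of the potential.\<close>

lemma penalized_solution_exists:
  assumes \<omega>: "open \<omega>" "\<omega> \<subseteq> \<Omega>" and j: "j > 0" and \<gamma>: "\<gamma> > 0" and f: "square_integrable \<Omega> f"
  shows "\<exists>p. penalized_solution \<Omega> \<nu> \<epsilon> j f \<gamma> \<omega> p"
proof -
  let ?W = "lebesgue_on \<omega>" and ?g = "pen_field j \<gamma>"
  interpret w: finite_measure ?W by (rule subdomain_measure(2)[OF \<omega>])
  obtain \<Phi> :: "R3 \<Rightarrow> real" where \<Phi>: "\<And>v. 0 \<le> \<Phi> v" "\<And>u v. \<Phi> v + ?g v \<bullet> (u - v) \<le> \<Phi> u"
    by (rule pen_field_potential[OF \<gamma> j]) blast
  have gb: "norm (?g v) \<le> j" for v by (rule norm_pen_field_le[OF \<gamma> j])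
  have half: "\<Phi> v - \<Phi> u \<le> j * norm (u - v)" for u v
  proof -
    have "\<Phi> v - \<Phi> u \<le> ?g v \<bullet> (v - u)" using \<Phi>(2)[of v u] by (simp add: inner_diff_right)
    also have "\<dots> \<le> norm (?g v) * norm (v - u)" by (rule norm_cauchy_schwarz)
    also have "\<dots> \<le> j * norm (v - u)" by (intro mult_right_mono gb) simp
    finally show ?thesis by (simp add: norm_minus_commute)
  qed
  have Lip: "\<bar>\<Phi> u - \<Phi> v\<bar> \<le> j * norm (u - v)" for u v
    using half[of u v] half[of v u] by (simp add: norm_minus_commute)
  have conv: "\<Phi> (u + t *\<^sub>R (v - u)) \<le> (1 - t) * \<Phi> u + t * \<Phi> v" if t: "0 \<le> t" "t \<le> 1" for u v t
  proof -
    let ?z = "u + t *\<^sub>R (v - u)"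
    have "(1 - t) * (\<Phi> ?z + ?g ?z \<bullet> (u - ?z)) \<le> (1 - t) * \<Phi> u" "t * (\<Phi> ?z + ?g ?z \<bullet> (v - ?z)) \<le> t * \<Phi> v"
      using t by (auto simp only: diff_ge_0_iff_ge intro!: mult_left_mono \<Phi>(2))
    \<comment> \<open>The weighted inner products cancel because (1 - t) (u - z) + t (v - z) = 0 at
      the intermediate point z.\<close>
    moreover have "(1 - t) * (\<Phi> ?z + ?g ?z \<bullet> (u - ?z)) + t * (\<Phi> ?z + ?g ?z \<bullet> (v - ?z)) = \<Phi> ?z"
      by (simp add: inner_diff_right inner_add_right algebra_simps)
    ultimately show ?thesis by linarith
  qed
  obtain E where E0: "E \<in> H0curl \<Omega>" "\<forall>v\<in>H0curl \<Omega>.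
      a E (\<lambda>x. v x - E x) + (\<integral>x. \<Phi> (v x) \<partial>?W) - (\<integral>x. \<Phi> (E x) \<partial>?W) \<ge> (\<integral>x. f x \<bullet> (v x - E x) \<partial>M)"
    "\<forall>v\<in>H0curl \<Omega>. integrable ?W (\<lambda>x. \<Phi> (v x))"
    by (rule superposition_variational_inequality[OF \<omega> less_imp_le[OF j] \<Phi>(1) Lip conv f[unfolded square_integrable_eq]])
  note E = E0(1) E0(2,3)[rule_format]
  have meas: "v \<in> borel_measurable ?W" "integrable ?W (\<lambda>x. norm (v x))" if "v \<in> H0curl \<Omega>" for v
    by (rule measurable_lebesgue_on_subset[OF sqint_measurable[OF Hcurl_sqint(1)[OF H0curl_Hcurl[OF that]]] \<omega>(2)],
        rule l1_subdomain_le(1)[OF \<omega> Hcurl_sqint(1)[OF H0curl_Hcurl[OF that]]])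
  have gm: "(\<lambda>x. ?g (v x)) \<in> borel_measurable ?W" if "v \<in> H0curl \<Omega>" for v
    by (rule borel_measurable_continuous_on[OF continuous_on_pen_field[OF \<gamma>] meas(1)[OF that]])
  have gi: "integrable ?W (\<lambda>x. ?g (v x) \<bullet> z x)" "\<And>x. \<bar>?g (v x) \<bullet> z x\<bar> \<le> j * norm (z x)"
    if v: "v \<in> H0curl \<Omega>" and z: "z \<in> H0curl \<Omega>" for v z
  proof -
    show b: "\<bar>?g (v x) \<bullet> z x\<bar> \<le> j * norm (z x)" for x
    proof -
      have "\<bar>?g (v x) \<bullet> z x\<bar> \<le> norm (?g (v x)) * norm (z x)" by (rule Cauchy_Schwarz_ineq2)
      also have "\<dots> \<le> j * norm (z x)" by (intro mult_right_mono gb) simp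
      finally show ?thesis .
    qed
    show "integrable ?W (\<lambda>x. ?g (v x) \<bullet> z x)"
    proof (rule Bochner_Integration.integrable_bound)
      show "integrable ?W (\<lambda>x. j * norm (z x))" using meas(2)[OF z] by simp
      show "(\<lambda>x. ?g (v x) \<bullet> z x) \<in> borel_measurable ?W"
        using gm[OF v] meas(1)[OF z] by (rule borel_measurable_inner)
      show "AE x in ?W. norm (?g (v x) \<bullet> z x) \<le> norm (j * norm (z x))"
        using b j by (intro AE_I2) (simp add: abs_mult)
    qed
  qed
  have half_eq: "(\<integral>x. f x \<bullet> z x \<partial>M) \<le> a E z + (\<integral>x. ?g (E x) \<bullet> z x \<partial>?W)" if z: "z \<in> H0curl \<Omega>" for z
  proof -
    have Et: "(\<lambda>x. E x + t *\<^sub>R z x) \<in> H0curl \<Omega>" for t by (intro H0curl_add H0curl_scaleR E(1) z)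
    \<comment> \<open>The subgradient taken at the displaced point bounds the increment of \<Phi>
      from above; the one at E would bound it from below.\<close>
    have le: "(\<integral>x. f x \<bullet> z x \<partial>M) \<le> a E z + (\<integral>x. ?g (E x + t *\<^sub>R z x) \<bullet> z x \<partial>?W)" if t: "t > 0" for t
    proof -
      have "t * (\<integral>x. f x \<bullet> z x \<partial>M) \<le> t * a E z + (\<integral>x. \<Phi> (E x + t *\<^sub>R z x) \<partial>?W) - (\<integral>x. \<Phi> (E x) \<partial>?W)"
        using E(2)[OF Et[of t]] form_scale_right[OF H0curl_Hcurl[OF E(1)] H0curl_Hcurl[OF z], of t] by simp
      also have "\<dots> = t * a E z + (\<integral>x. \<Phi> (E x + t *\<^sub>R z x) - \<Phi> (E x) \<partial>?W)"
        using E(3)[OF Et] E(3)[OF E(1)] by simp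
      also have "\<dots> \<le> t * a E z + (\<integral>x. t * (?g (E x + t *\<^sub>R z x) \<bullet> z x) \<partial>?W)"
      proof (intro add_left_mono integral_mono)
        show "\<Phi> (E x + t *\<^sub>R z x) - \<Phi> (E x) \<le> t * (?g (E x + t *\<^sub>R z x) \<bullet> z x)" for x
          using \<Phi>(2)[of "E x + t *\<^sub>R z x" "E x"] by simp
      qed (use gi(1)[OF Et z] E(3)[OF Et] E(3)[OF E(1)] in auto)
      also have "\<dots> = t * (a E z + (\<integral>x. ?g (E x + t *\<^sub>R z x) \<bullet> z x \<partial>?W))" by (simp add: distrib_left)
      finally show ?thesis using t by simp
    qed
    have "(\<lambda>n. \<integral>x. ?g (E x + (1 / real (Suc n)) *\<^sub>R z x) \<bullet> z x \<partial>?W) \<longlonglongrightarrow> (\<integral>x. ?g (E x) \<bullet> z x \<partial>?W)"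
    proof (rule integral_dominated_convergence[where w="\<lambda>x. j * norm (z x)"])
      show "integrable ?W (\<lambda>x. j * norm (z x))" using meas(2)[OF z] by simp
      show "AE x in ?W. (\<lambda>n. ?g (E x + (1 / real (Suc n)) *\<^sub>R z x) \<bullet> z x) \<longlonglongrightarrow> ?g (E x) \<bullet> z x"
      proof (intro AE_I2 tendsto_inner tendsto_const)
        fix x
        have "(\<lambda>n. E x + (1 / real (Suc n)) *\<^sub>R z x) \<longlonglongrightarrow> E x + 0 *\<^sub>R z x"
          by (intro tendsto_intros LIMSEQ_Suc[OF lim_1_over_n])
        then show "(\<lambda>n. ?g (E x + (1 / real (Suc n)) *\<^sub>R z x)) \<longlonglongrightarrow> ?g (E x)"
          using continuous_on_pen_field[OF \<gamma>, of j]
          by (intro isCont_tendsto_compose[of _ ?g]) (auto simp: continuous_on_eq_continuous_at)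
      qed
      show "AE x in ?W. norm (?g (E x + (1 / real (Suc n)) *\<^sub>R z x) \<bullet> z x) \<le> j * norm (z x)" for n
        using gi(2)[OF Et z] by simp
    qed (use gi(1)[OF Et z] gi(1)[OF E(1) z] in auto)
    then have "(\<lambda>n. a E z + (\<integral>x. ?g (E x + (1 / real (Suc n)) *\<^sub>R z x) \<bullet> z x \<partial>?W)) \<longlonglongrightarrow> a E z + (\<integral>x. ?g (E x) \<bullet> z x \<partial>?W)"
      by (intro tendsto_add tendsto_const)
    then show ?thesis
      by (rule LIMSEQ_le_const) (use le in auto)
  qed
  \<comment> \<open>The inequality for z and for -z together give equality.\<close>
  have eq: "a E z + (\<integral>x. ?g (E x) \<bullet> z x \<partial>?W) = (\<integral>x. f x \<bullet> z x \<partial>M)" if z: "z \<in> H0curl \<Omega>" for z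
    using half_eq[OF z] half_eq[OF H0curl_scaleR[OF z, of "-1"]]
      form_scale_right[OF H0curl_Hcurl[OF E(1)] H0curl_Hcurl[OF z], of "-1"] by simp
  have "penalized_solution \<Omega> \<nu> \<epsilon> j f \<gamma> \<omega> (E, \<lambda>x. ?g (E x))"
    unfolding penalized_solution_def split_conv ess_bounded_def
    using E(1) gm[OF E(1)] gb eq by (auto simp: pen_field_def intro!: exI[of _ j])
  then show ?thesis by blast
qed

end

section \<open>Compactness of the admissible shapes\<close>

text \<open>For a unit vector e, the projection onto the hyperplane orthogonal to e. Composition
  with it brings chart functions, whose hyperplanes vary with the axis, to one common
  domain.\<close>

definition perp :: "R3 \<Rightarrow> R3 \<Rightarrow> R3" where
  "perp e z = z - (z \<bullet> e) *\<^sub>R e"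

lemma perp_simps:
  assumes "norm e = 1"
  shows "perp e z \<bullet> e = 0" "z = perp e z + (z \<bullet> e) *\<^sub>R e" "norm (perp e z) \<le> norm z" "\<bar>z \<bullet> e\<bar> \<le> norm z"
    "perp e (perp e z) = perp e z" "perp e (y - z) = perp e y - perp e z"
proof -
  have ee: "e \<bullet> e = 1" using assms by (simp add: dot_square_norm)
  show o: "perp e z \<bullet> e = 0" by (simp add: perp_def inner_diff_left ee)
  then show "perp e (perp e z) = perp e z" by (simp add: perp_def[of e "perp e z"])
  show "z = perp e z + (z \<bullet> e) *\<^sub>R e" by (simp add: perp_def)
  have "(norm z)\<^sup>2 = (norm (perp e z))\<^sup>2 + (z \<bullet> e)\<^sup>2"
    unfolding power2_norm_eq_inner perp_def
    by (simp add: inner_diff_left inner_diff_right ee inner_commute power2_eq_square)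
  then have "(norm (perp e z))\<^sup>2 \<le> (norm z)\<^sup>2" by simp
  then show "norm (perp e z) \<le> norm z" by (rule power2_le_imp_le) simp
  show "\<bar>z \<bullet> e\<bar> \<le> norm z" using Cauchy_Schwarz_ineq2[of z e] assms by simp
  show "perp e (y - z) = perp e y - perp e z" by (simp add: perp_def inner_diff_left algebra_simps)
qed

text \<open>The body of \<open>lipschitz_chart\<close> with axis and function exposed, so that both
  can be followed along a sequence.\<close>

definition graph_chart :: "R3 set \<Rightarrow> R3 \<Rightarrow> real \<Rightarrow> real \<Rightarrow> real \<Rightarrow> R3 \<Rightarrow> (R3 \<Rightarrow> real) \<Rightarrow> bool" where
  "graph_chart S x L r h e \<phi> \<longleftrightarrow> norm e = 1 \<and> L-lipschitz_on {y. y \<bullet> e = 0} \<phi> \<and>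
     (\<forall>y t. y \<bullet> e = 0 \<and> norm y < r \<and> \<bar>t\<bar> < h \<longrightarrow> (x + y + t *\<^sub>R e \<in> S \<longleftrightarrow> t < \<phi> y))"

lemma lipschitz_chart_iff: "lipschitz_chart S x L r h \<longleftrightarrow> (\<exists>e \<phi>. graph_chart S x L r h e \<phi>)"
  by (simp add: lipschitz_chart_def graph_chart_def)

lemma graph_chart_mem:
  assumes "graph_chart S x L r h e \<phi>" "norm (perp e (z - x)) < r" "\<bar>(z - x) \<bullet> e\<bar> < h"
  shows "z \<in> S \<longleftrightarrow> (z - x) \<bullet> e < \<phi> (perp e (z - x))"
proof -
  have e: "norm e = 1" using assms(1) by (simp add: graph_chart_def)
  have "x + perp e (z - x) + ((z - x) \<bullet> e) *\<^sub>R e = z"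
    using perp_simps(2)[OF e, of "z - x"] by (simp add: algebra_simps)
  then show ?thesis
    using assms perp_simps(1)[OF e, of "z - x"] unfolding graph_chart_def by metis
qed

text \<open>A boundary point is not in the open set, so it is not below the graph. If it were
  strictly above, a whole neighbourhood would miss the set, by continuity of the chart
  function.\<close>

lemma graph_chart_frontier:
  assumes S: "open S" and c: "graph_chart S x L r h e \<phi>" and z: "z \<in> frontier S"
    and zr: "norm (perp e (z - x)) < r" "\<bar>(z - x) \<bullet> e\<bar> < h"
  shows "(z - x) \<bullet> e = \<phi> (perp e (z - x))"
proof (rule ccontr)
  let ?d = "\<lambda>z. (z - x) \<bullet> e - \<phi> (perp e (z - x))"
  have e: "norm e = 1" and Lip: "L-lipschitz_on {y. y \<bullet> e = 0} \<phi>" using c by (auto simp: graph_chart_def)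
  assume "(z - x) \<bullet> e \<noteq> \<phi> (perp e (z - x))"
  then have "?d z \<noteq> 0" by simp
  have "z \<notin> S" using z S by (simp add: frontier_def interior_open)
  then have "0 \<le> ?d z" using graph_chart_mem[OF c zr] by simp
  with \<open>?d z \<noteq> 0\<close> have pos: "0 < ?d z" by simp
  have cperp: "continuous_on UNIV (\<lambda>z. perp e (z - x))"
    unfolding perp_def by (intro continuous_intros)
  have cd: "continuous_on UNIV ?d"
    by (intro continuous_intros continuous_on_compose2[OF lipschitz_on_continuous_on[OF Lip] cperp])
       (auto simp: perp_simps(1)[OF e])
  define U where "U = {w. 0 < ?d w} \<inter> {w. norm (perp e (w - x)) < r} \<inter> {w. \<bar>(w - x) \<bullet> e\<bar> < h}"
  have "open U"
    unfolding U_def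
    by (intro open_Int open_Collect_less[OF continuous_on_const cd]
        open_Collect_less[OF continuous_on_norm[OF cperp] continuous_on_const])
       (intro open_Collect_less continuous_intros)
  moreover have "z \<in> U" using pos zr by (simp add: U_def)
  moreover have "U \<inter> S = {}" using graph_chart_mem[OF c] by (fastforce simp: U_def)
  ultimately have "z \<notin> closure S" using open_Int_closure_eq_empty by blast
  then show False using z by (simp add: frontier_def)
qed

text \<open>With the Lipschitz constant this normalization gives the uniform bound for
  Arzela-Ascoli, and it survives passage to the limit.\<close>

lemma graph_chart_zero:
  assumes "open S" "graph_chart S x L r h e \<phi>" "x \<in> frontier S" "0 < r" "0 < h"
  shows "\<phi> 0 = 0"
  using graph_chart_frontier[OF assms(1-3)] assms by (simp add: perp_def)

text \<open>The assumptions \<open>inner\<close> and \<open>outer\<close> are what Hausdorff convergence of the complements of the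
  \<open>W n\<close> gives; \<open>closest_point\<close> extends the limit \<open>g\<close>, known on a ball only, to a Lipschitz function.\<close>

lemma graph_chart_limit:
  fixes W :: "nat \<Rightarrow> R3 set"
  assumes op: "open \<omega>"
    and inner: "\<And>z. z \<in> \<omega> \<Longrightarrow> \<forall>\<^sub>F n in sequentially. z \<in> W n"
    and outer: "\<And>z. z \<notin> \<omega> \<Longrightarrow> \<exists>w. (\<forall>n. w n \<notin> W n) \<and> w \<longlonglongrightarrow> z"
    and ch: "\<And>n. graph_chart (W n) (y n) L r h (e n) (\<phi> n)"
    and y: "y \<longlonglongrightarrow> x" and e: "e \<longlonglongrightarrow> e0" and L: "0 \<le> L" and r: "0 < r"
    and unif: "\<And>\<delta>. 0 < \<delta> \<Longrightarrow> \<exists>N. \<forall>n z. n \<ge> N \<and> z \<in> cball 0 r \<longrightarrow> norm (\<phi> n (perp (e n) z) - g z) < \<delta>"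
  shows "graph_chart \<omega> x L r h e0 (\<lambda>z. g (closest_point (cball 0 r) z))"
proof -
  have en: "norm (e n) = 1" and Lip: "L-lipschitz_on {y. y \<bullet> e n = 0} (\<phi> n)" for n
    using ch[of n] by (auto simp: graph_chart_def)
  have e0: "norm e0 = 1"
    using LIMSEQ_unique[OF tendsto_norm[OF e]] en by simp
  have Lip': "\<bar>\<phi> n (perp (e n) u) - \<phi> n (perp (e n) v)\<bar> \<le> L * norm (u - v)" for n u v
  proof -
    have "\<bar>\<phi> n (perp (e n) u) - \<phi> n (perp (e n) v)\<bar> \<le> L * norm (perp (e n) u - perp (e n) v)"
      using lipschitz_onD[OF Lip[of n], of "perp (e n) u" "perp (e n) v"] perp_simps(1)[OF en]
      by (simp add: dist_norm)
    also have "\<dots> \<le> L * norm (u - v)"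
      using perp_simps(3)[OF en, of n "u - v"] perp_simps(6)[OF en, of n u v] L by (simp add: mult_left_mono)
    finally show ?thesis .
  qed
  have lim: "(\<lambda>n. \<phi> n (perp (e n) z)) \<longlonglongrightarrow> g z" if "z \<in> cball 0 r" for z
  proof (rule LIMSEQ_I)
    fix \<delta> :: real assume "0 < \<delta>"
    from unif[OF this] that show "\<exists>no. \<forall>n\<ge>no. norm (\<phi> n (perp (e n) z) - g z) < \<delta>" by blast
  qed
  have Lg: "\<bar>g u - g v\<bar> \<le> L * norm (u - v)" if "u \<in> cball 0 r" "v \<in> cball 0 r" for u v
  proof (rule LIMSEQ_le_const2)
    show "(\<lambda>n. \<bar>\<phi> n (perp (e n) u) - \<phi> n (perp (e n) v)\<bar>) \<longlonglongrightarrow> \<bar>g u - g v\<bar>"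
      by (intro tendsto_intros lim that)
  qed (use Lip' in auto)
  have cp: "closest_point (cball 0 r) z \<in> cball 0 r" for z :: R3
    using r by (intro closest_point_in_set) auto
  have lipG: "L-lipschitz_on {y. y \<bullet> e0 = 0} (\<lambda>z. g (closest_point (cball 0 r) z))"
  proof (rule lipschitz_onI[OF _ L])
    fix u v :: R3
    have "dist (g (closest_point (cball 0 r) u)) (g (closest_point (cball 0 r) v))
        \<le> L * dist (closest_point (cball 0 r) u) (closest_point (cball 0 r) v)"
      using Lg[OF cp cp] by (simp add: dist_norm)
    also have "\<dots> \<le> L * dist u v"
      using closest_point_lipschitz[of "cball (0::R3) r" u v] r L by (intro mult_left_mono) auto
    finally show "dist (g (closest_point (cball 0 r) u)) (g (closest_point (cball 0 r) v)) \<le> L * dist u v" .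
  qed
  \<comment> \<open>For points w n tending to a point of the limit cylinder, the chart coordinates
    converge, and eventually membership in \<open>W n\<close> is decided by comparing height and
    graph. Both inclusions follow from this.\<close>
  have key: "(\<lambda>n. (w n - y n) \<bullet> e n) \<longlonglongrightarrow> t"
    "(\<lambda>n. \<phi> n (perp (e n) (w n - y n))) \<longlonglongrightarrow> g u"
    "\<forall>\<^sub>F n in sequentially. w n \<in> W n \<longleftrightarrow> (w n - y n) \<bullet> e n < \<phi> n (perp (e n) (w n - y n))"
    if w: "w \<longlonglongrightarrow> x + u + t *\<^sub>R e0" and u: "u \<bullet> e0 = 0" "norm u < r" and t: "\<bar>t\<bar> < h" for w u t
  proof -
    have e00: "e0 \<bullet> e0 = 1" using e0 by (simp add: dot_square_norm)
    have d: "(\<lambda>n. w n - y n) \<longlonglongrightarrow> u + t *\<^sub>R e0"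
      using tendsto_diff[OF w y] by (simp add: algebra_simps)
    have "(\<lambda>n. (w n - y n) \<bullet> e n) \<longlonglongrightarrow> (u + t *\<^sub>R e0) \<bullet> e0" by (intro tendsto_intros d e)
    then show 1: "(\<lambda>n. (w n - y n) \<bullet> e n) \<longlonglongrightarrow> t" using u e00 by (simp add: inner_add_left)
    have "(\<lambda>n. perp (e n) (w n - y n)) \<longlonglongrightarrow> (u + t *\<^sub>R e0) - t *\<^sub>R e0"
      unfolding perp_def by (intro tendsto_intros d e 1)
    then have p: "(\<lambda>n. perp (e n) (w n - y n)) \<longlonglongrightarrow> u" by simp
    have "(\<lambda>n. \<phi> n (perp (e n) (w n - y n)) - \<phi> n (perp (e n) u)) \<longlonglongrightarrow> 0"
    proof (rule Lim_null_comparison)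
      show "\<forall>\<^sub>F n in sequentially. norm (\<phi> n (perp (e n) (w n - y n)) - \<phi> n (perp (e n) u))
          \<le> L * norm (perp (e n) (w n - y n) - u)"
        using Lip'[of _ "perp (e _) (w _ - y _)" u] perp_simps(5)[OF en] by (intro always_eventually allI) (metis real_norm_def)
      have "(\<lambda>n. L * norm (perp (e n) (w n - y n) - u)) \<longlonglongrightarrow> L * norm (u - u)"
        by (intro tendsto_intros p)
      then show "(\<lambda>n. L * norm (perp (e n) (w n - y n) - u)) \<longlonglongrightarrow> 0" by simp
    qed
    from tendsto_add[OF this lim[of u]] u show "(\<lambda>n. \<phi> n (perp (e n) (w n - y n))) \<longlonglongrightarrow> g u" by simp
    have "\<forall>\<^sub>F n in sequentially. norm (perp (e n) (w n - y n)) < r"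
      by (rule order_tendstoD(2)[OF tendsto_norm[OF p] u(2)])
    moreover have "\<forall>\<^sub>F n in sequentially. \<bar>(w n - y n) \<bullet> e n\<bar> < h"
      by (rule order_tendstoD(2)[OF tendsto_rabs[OF 1] t])
    ultimately show "\<forall>\<^sub>F n in sequentially. w n \<in> W n \<longleftrightarrow> (w n - y n) \<bullet> e n < \<phi> n (perp (e n) (w n - y n))"
      by eventually_elim (rule graph_chart_mem[OF ch])
  qed
  have "x + u + t *\<^sub>R e0 \<in> \<omega> \<longleftrightarrow> t < g u" if u: "u \<bullet> e0 = 0" "norm u < r" and t: "\<bar>t\<bar> < h" for u t
  proof
    assume lt: "t < g u"
    show "x + u + t *\<^sub>R e0 \<in> \<omega>"
    proof (rule ccontr)
      assume "x + u + t *\<^sub>R e0 \<notin> \<omega>"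
      then obtain w where w: "\<And>n. w n \<notin> W n" "w \<longlonglongrightarrow> x + u + t *\<^sub>R e0" using outer by blast
      note k = key[OF w(2) u t]
      have "g u \<le> t"
      proof (rule tendsto_le[OF _ k(1,2)])
        show "\<forall>\<^sub>F n in sequentially. \<phi> n (perp (e n) (w n - y n)) \<le> (w n - y n) \<bullet> e n"
          using k(3) by eventually_elim (use w(1) in \<open>auto simp: not_less\<close>)
      qed simp
      with lt show False by simp
    qed
  next
    assume z: "x + u + t *\<^sub>R e0 \<in> \<omega>"
    \<comment> \<open>The limit of strict inequalities would give only t \<le> g u. Since \<omega>
      is open, a point slightly higher is still in it, and applying the limit there restores
      strictness.\<close>
    have "\<forall>\<^sub>F s in at_right 0. t + s < h" "\<forall>\<^sub>F s in at_right 0. x + u + (t + s) *\<^sub>R e0 \<in> \<omega>"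
    proof -
      have "((\<lambda>s. t + s) \<longlongrightarrow> t + 0) (at_right 0)" by (intro tendsto_intros)
      from order_tendstoD(2)[OF this, of h] t show "\<forall>\<^sub>F s in at_right 0. t + s < h" by simp
      have "((\<lambda>s. x + u + (t + s) *\<^sub>R e0) \<longlongrightarrow> x + u + (t + 0) *\<^sub>R e0) (at_right 0)" by (intro tendsto_intros)
      then show "\<forall>\<^sub>F s in at_right 0. x + u + (t + s) *\<^sub>R e0 \<in> \<omega>" using z op by (intro topological_tendstoD) auto
    qed
    moreover have "\<forall>\<^sub>F s in at_right 0. (0::real) < s" by (simp add: eventually_at_filter)
    ultimately have "\<forall>\<^sub>F s in at_right 0. t + s < h \<and> x + u + (t + s) *\<^sub>R e0 \<in> \<omega> \<and> 0 < s"
      by eventually_elim simp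
    then obtain s where s: "t + s < h" "x + u + (t + s) *\<^sub>R e0 \<in> \<omega>" "0 < s"
      using eventually_happens'[OF trivial_limit_at_right_real] by blast
    then have "\<bar>t + s\<bar> < h" using t by auto
    note k = key[OF tendsto_const u this]
    have "t + s \<le> g u"
    proof (rule tendsto_le[OF _ k(2,1)])
      show "\<forall>\<^sub>F n in sequentially. (x + u + (t + s) *\<^sub>R e0 - y n) \<bullet> e n \<le> \<phi> n (perp (e n) (x + u + (t + s) *\<^sub>R e0 - y n))"
        using k(3) inner[OF s(2)] by eventually_elim auto
    qed simp
    with s(3) show "t < g u" by simp
  qed
  moreover have "closest_point (cball 0 r) u = u" if "norm u < r" for u :: R3
    using that by (intro closest_point_self) auto
  ultimately show ?thesis
    using e0 lipG by (simp add: graph_chart_def)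
qed

text \<open>Boundaries come near x only along some indices, so shapes and centres are selected
  first; then the axes converge by compactness of the sphere and the chart functions by
  Arzela-Ascoli. The value 0 at the origin records that the limit graph passes through x
  itself.\<close>

lemma graph_chart_subsequence:
  fixes W :: "nat \<Rightarrow> R3 set"
  assumes op: "open \<omega>" and W: "\<And>n. open (W n)"
    and inner: "\<And>z. z \<in> \<omega> \<Longrightarrow> \<forall>\<^sub>F n in sequentially. z \<in> W n"
    and outer: "\<And>z. z \<notin> \<omega> \<Longrightarrow> \<exists>w. (\<forall>n. w n \<notin> W n) \<and> w \<longlonglongrightarrow> z"
    and ch: "\<And>n x. x \<in> frontier (W n) \<Longrightarrow> lipschitz_chart (W n) x L r h"
    and pos: "0 < L" "0 < r" "0 < h"
    and near: "\<And>\<delta>. 0 < \<delta> \<Longrightarrow> \<exists>\<^sub>F n in sequentially. \<exists>y\<in>frontier (W n). dist y x < \<delta>"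
  obtains e \<psi> where "graph_chart \<omega> x L r h e \<psi>" "\<psi> 0 = 0"
proof -
  have "\<exists>n>m. \<exists>y\<in>frontier (W n). dist y x < 1 / real (Suc j)" for m j
  proof -
    have "\<exists>\<^sub>F n in sequentially. \<exists>y\<in>frontier (W n). dist y x < 1 / real (Suc j)"
      by (rule near) simp
    then show ?thesis unfolding frequently_sequentially by (meson Suc_le_eq)
  qed
  \<comment> \<open>The index is shifted because the recursive choice must supply the bound for the
    successor of j.\<close>
  then have step: "\<exists>n. m < n \<and> (\<exists>y\<in>frontier (W n). dist y x < 1 / real (Suc (Suc j)))" for m j by blast
  obtain k where k: "strict_mono k" "\<And>j. \<exists>y\<in>frontier (W (k j)). dist y x < 1 / real (Suc j)"
  proof -
    obtain n0 where n0: "\<exists>y\<in>frontier (W n0). dist y x < 1 / real (Suc 0)"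
      using \<open>\<And>m j. \<exists>n>m. \<exists>y\<in>frontier (W n). dist y x < 1 / real (Suc j)\<close>[of 0 0] by blast
    obtain k where "\<And>j. \<exists>y\<in>frontier (W (k j)). dist y x < 1 / real (Suc j)" "\<And>j. k j < k (Suc j)"
      using dependent_nat_choice[of "\<lambda>j n. \<exists>y\<in>frontier (W n). dist y x < 1 / real (Suc j)" "\<lambda>j m n. m < n"]
        n0 step by metis
    moreover from this(2) have "strict_mono k" by (simp add: strict_mono_Suc_iff)
    ultimately show thesis by (intro that[of k])
  qed
  from k(2) obtain y where y: "\<And>j. y j \<in> frontier (W (k j))" "\<And>j. dist (y j) x < 1 / real (Suc j)" by metis
  have ylim: "y \<longlonglongrightarrow> x"
  proof (rule tendsto_dist_iff[THEN iffD2], rule Lim_null_comparison)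
    show "\<forall>\<^sub>F j in sequentially. norm (dist (y j) x) \<le> 1 / real (Suc j)"
      using y(2) by (intro always_eventually) (auto intro: less_imp_le)
  qed (rule LIMSEQ_Suc[OF lim_1_over_n])
  from ch[OF y(1)] obtain e \<phi> where c: "\<And>j. graph_chart (W (k j)) (y j) L r h (e j) (\<phi> j)"
    unfolding lipschitz_chart_iff by metis
  have en: "norm (e j) = 1" and Lip: "L-lipschitz_on {y. y \<bullet> e j = 0} (\<phi> j)" for j
    using c[of j] by (auto simp: graph_chart_def)
  have z0: "\<phi> j 0 = 0" for j
    by (rule graph_chart_zero[OF W c y(1) pos(2,3)])
  have "compact (sphere (0::R3) 1)" by simp
  moreover have "\<forall>j. e j \<in> sphere 0 1" using en by simp
  ultimately obtain e0 l where l: "strict_mono l" "(e \<circ> l) \<longlonglongrightarrow> e0"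
    unfolding compact_def by metis
  \<comment> \<open>Projection makes these functions equi-Lipschitz on one ball, although their
    original hyperplanes differ.\<close>
  define F where "F j z = \<phi> (l j) (perp (e (l j)) z)" for j z
  have FL: "\<bar>F j u - F j v\<bar> \<le> L * norm (u - v)" for j u v
  proof -
    have "\<bar>F j u - F j v\<bar> \<le> L * norm (perp (e (l j)) u - perp (e (l j)) v)"
      using lipschitz_onD[OF Lip, of "perp (e (l j)) u" "l j" "perp (e (l j)) v"] perp_simps(1)[OF en]
      by (simp add: dist_norm F_def)
    also have "\<dots> \<le> L * norm (u - v)"
      using perp_simps(3)[OF en, of _ "u - v"] perp_simps(6)[OF en, of _ u v] pos(1) by (simp add: mult_left_mono)
    finally show ?thesis .
  qed
  have F0: "F j 0 = 0" for j by (simp add: F_def perp_def z0)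
  obtain g m where g: "strict_mono (m :: nat \<Rightarrow> nat)"
    "\<And>\<delta>. 0 < \<delta> \<Longrightarrow> \<exists>N. \<forall>n z. n \<ge> N \<and> z \<in> cball 0 r \<longrightarrow> norm (F (m n) z - g z) < \<delta>"
  proof (rule Arzela_Ascoli[of "cball (0::R3) r" F "L * r"])
    show "norm (F n z) \<le> L * r" if "z \<in> cball 0 r" for n z
    proof -
      have "norm (F n z) \<le> L * norm z" using FL[of n z 0] F0 by simp
      also have "\<dots> \<le> L * r" using that pos by (intro mult_left_mono) auto
      finally show ?thesis .
    qed
    show "\<exists>d>0. \<forall>n v. v \<in> cball 0 r \<and> norm (u - v) < d \<longrightarrow> norm (F n u - F n v) < \<delta>"
      if "0 < \<delta>" for u \<delta>
    proof (intro exI[of _ "\<delta> / L"] conjI allI impI)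
      fix n v assume "v \<in> cball 0 r \<and> norm (u - v) < \<delta> / L"
      then have "L * norm (u - v) < \<delta>" using pos(1) by (simp add: pos_less_divide_eq mult.commute)
      with FL[of n u v] show "norm (F n u - F n v) < \<delta>" by simp
    qed (use that pos in simp)
  qed (use that in auto)
  define s where "s = l \<circ> m"
  have s: "strict_mono s" unfolding s_def by (rule strict_mono_o[OF l(1) g(1)])
  have ks: "strict_mono (k \<circ> s)" by (rule strict_mono_o[OF k(1) s])
  have "graph_chart \<omega> x L r h e0 (\<lambda>z. g (closest_point (cball 0 r) z))"
  proof (rule graph_chart_limit[where W="\<lambda>n. W (k (s n))" and y="\<lambda>n. y (s n)" and e="\<lambda>n. e (s n)" and \<phi>="\<lambda>n. \<phi> (s n)"])
    show "\<forall>\<^sub>F n in sequentially. z \<in> W (k (s n))" if "z \<in> \<omega>" for z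
      using eventually_subseq[OF ks inner[OF that]] by simp
    show "\<exists>w. (\<forall>n. w n \<notin> W (k (s n))) \<and> w \<longlonglongrightarrow> z" if z: "z \<notin> \<omega>" for z
    proof -
      obtain w where "\<forall>n. w n \<notin> W n" "w \<longlonglongrightarrow> z" using outer[OF z] by blast
      then show ?thesis
        using LIMSEQ_subseq_LIMSEQ[OF _ ks] by (intro exI[of _ "w \<circ> (k \<circ> s)"]) auto
    qed
    show "(\<lambda>n. y (s n)) \<longlonglongrightarrow> x" using LIMSEQ_subseq_LIMSEQ[OF ylim s] by (simp add: o_def)
    show "(\<lambda>n. e (s n)) \<longlonglongrightarrow> e0" using LIMSEQ_subseq_LIMSEQ[OF l(2) g(1)] by (simp add: o_def s_def)
    show "\<exists>N. \<forall>n z. n \<ge> N \<and> z \<in> cball 0 r \<longrightarrow> norm (\<phi> (s n) (perp (e (s n)) z) - g z) < \<delta>" if "0 < \<delta>" for \<delta>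
      using g(2)[OF that] by (simp add: F_def s_def)
  qed (use op c pos in auto)
  moreover have "g 0 = 0"
  proof (rule LIMSEQ_unique)
    show "(\<lambda>n. F (m n) 0) \<longlonglongrightarrow> g 0"
    proof (rule LIMSEQ_I)
      fix \<delta> :: real assume "0 < \<delta>"
      from g(2)[OF this] obtain N where "\<forall>n z. n \<ge> N \<and> z \<in> cball 0 r \<longrightarrow> norm (F (m n) z - g z) < \<delta>" ..
      moreover have "0 \<in> cball (0::R3) r" using pos by simp
      ultimately show "\<exists>no. \<forall>n\<ge>no. norm (F (m n) 0 - g 0) < \<delta>" by blast
    qed
    show "(\<lambda>n. F (m n) 0) \<longlonglongrightarrow> 0" by (simp add: F0)
  qed
  then have "g (closest_point (cball 0 r) 0) = 0" using pos by (simp add: closest_point_self)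
  ultimately show thesis by (rule that)
qed

text \<open>Locally the boundary is contained in the image of a hyperplane under a map with
  Lipschitz constant 1 + L, and such maps preserve null sets.\<close>

lemma negligible_frontier_chart:
  assumes S: "open S" and ch: "\<And>x. x \<in> frontier S \<Longrightarrow> lipschitz_chart S x L r h" and pos: "0 < r" "0 < h"
  shows "negligible (frontier S)"
proof (subst locally_negligible_alt, rule ballI)
  fix x assume x: "x \<in> frontier S"
  obtain e \<phi> where c: "graph_chart S x L r h e \<phi>" using ch[OF x] by (auto simp: lipschitz_chart_iff)
  have e: "norm e = 1" and Lip: "L-lipschitz_on {y. y \<bullet> e = 0} \<phi>" using c by (auto simp: graph_chart_def)
  let ?U = "frontier S \<inter> ball x (min r h)"
  have "?U \<subseteq> (\<lambda>y. x + y + \<phi> y *\<^sub>R e) ` {y. e \<bullet> y = 0}"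
  proof
    fix z assume z: "z \<in> ?U"
    then have nz: "norm (z - x) < r" "norm (z - x) < h" by (auto simp: dist_norm norm_minus_commute)
    have b: "norm (perp e (z - x)) < r" "\<bar>(z - x) \<bullet> e\<bar> < h"
      using perp_simps(3)[OF e, of "z - x"] perp_simps(4)[OF e, of "z - x"] nz by linarith+
    have "(z - x) \<bullet> e = \<phi> (perp e (z - x))" using graph_chart_frontier[OF S c _ b] z by blast
    then have "z = x + perp e (z - x) + \<phi> (perp e (z - x)) *\<^sub>R e"
      using perp_simps(2)[OF e, of "z - x"] by (simp add: algebra_simps)
    then show "z \<in> (\<lambda>y. x + y + \<phi> y *\<^sub>R e) ` {y. e \<bullet> y = 0}"
      using perp_simps(1)[OF e, of "z - x"] by (intro image_eqI[of _ _ "perp e (z - x)"]) (auto simp: inner_commute)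
  qed
  moreover have "negligible ((\<lambda>y. x + y + \<phi> y *\<^sub>R e) ` {y. e \<bullet> y = 0})"
  proof (rule negligible_locally_Lipschitz_image)
    have "e \<noteq> 0" using e by auto
    then show "negligible {y. e \<bullet> y = 0}" by (intro negligible_hyperplane) simp
    fix y assume y: "y \<in> {y. e \<bullet> y = 0}"
    show "\<exists>T B. open T \<and> y \<in> T \<and>
      (\<forall>z\<in>{y. e \<bullet> y = 0} \<inter> T. norm ((x + z + \<phi> z *\<^sub>R e) - (x + y + \<phi> y *\<^sub>R e)) \<le> B * norm (z - y))"
    proof (intro exI[of _ UNIV] exI[of _ "1 + L"] conjI ballI)
      fix z assume z: "z \<in> {y. e \<bullet> y = 0} \<inter> UNIV"
      have "(x + z + \<phi> z *\<^sub>R e) - (x + y + \<phi> y *\<^sub>R e) = (z - y) + (\<phi> z - \<phi> y) *\<^sub>R e" by (simp add: algebra_simps)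
      also have "norm \<dots> \<le> norm (z - y) + norm ((\<phi> z - \<phi> y) *\<^sub>R e)" by (rule norm_triangle_ineq)
      also have "norm ((\<phi> z - \<phi> y) *\<^sub>R e) \<le> L * norm (z - y)"
        using lipschitz_onD[OF Lip, of z y] y z e by (simp add: dist_norm inner_commute)
      finally show "norm ((x + z + \<phi> z *\<^sub>R e) - (x + y + \<phi> y *\<^sub>R e)) \<le> (1 + L) * norm (z - y)"
        by (simp add: distrib_right)
    qed auto
  qed simp
  ultimately have "negligible ?U" using negligible_subset by blast
  then show "\<exists>U. openin (top_of_set (frontier S)) U \<and> x \<in> U \<and> negligible U"
    using x pos by (intro exI[of _ ?U]) (auto simp: openin_open)
qed

text \<open>The bound e also supplies the boundedness from above without which the supremum could
  not be compared with its members.\<close>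

lemma hausdorff_distance_le:
  assumes "K \<noteq> {}" "M \<noteq> {}" "\<And>x. x \<in> K \<Longrightarrow> infdist x M \<le> e" "\<And>y. y \<in> M \<Longrightarrow> infdist y K \<le> e"
  shows "0 \<le> hausdorff_distance K M" "hausdorff_distance K M \<le> e"
proof -
  show "hausdorff_distance K M \<le> e"
    unfolding hausdorff_distance_def using assms by (auto intro!: max.boundedI cSUP_least)
  obtain x where x: "x \<in> K" using assms(1) by blast
  have "0 \<le> infdist x M" by (rule infdist_nonneg)
  also have "\<dots> \<le> (SUP x\<in>K. infdist x M)"
    using assms(3) x by (intro cSUP_upper bdd_aboveI2[of _ _ e])
  finally show "0 \<le> hausdorff_distance K M" unfolding hausdorff_distance_def by simp
qed

text \<open>The last three conclusions together are what yields convergence of the indicators almost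
  everywhere: the boundary of the limit is null, and off it every point is eventually inside or
  eventually outside.\<close>

theorem admissible_compact:
  assumes B: "open B" "bounded B" "B \<noteq> {}" and pos: "0 < L" "0 < r" "0 < h"
    and W: "\<And>n::nat. W n \<in> admissible B L r h"
  obtains k \<omega> where "strict_mono k" "\<omega> \<in> admissible B L r h" "converges_hausdorff B (\<lambda>n. W (k n)) \<omega>"
    "negligible (frontier \<omega>)"
    "\<forall>z\<in>\<omega>. \<forall>\<^sub>F n in sequentially. z \<in> W (k n)"
    "\<forall>z. z \<notin> closure \<omega> \<longrightarrow> (\<forall>\<^sub>F n in sequentially. z \<notin> W (k n))"
proof -
  let ?C = "closure B"
  have C: "compact ?C" using B by (simp add: compact_closure)
  have Wo: "open (W n)" and WB: "W n \<subseteq> B" and Wc: "x \<in> frontier (W n) \<Longrightarrow> lipschitz_chart (W n) x L r h" for n x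
    using W[of n] by (auto simp: admissible_def)
  have "?C \<noteq> B"
  proof
    assume "?C = B"
    then have "closed B" by (metis closed_closure)
    then have "B = UNIV" using B clopen by blast
    with B(2) show False by (simp add: not_bounded_UNIV)
  qed
  \<comment> \<open>A bounded nonempty open set is not closed. This boundary point lies in all
    complements \<open>K n\<close>, which makes them nonempty and bounds the distance functions by
    R.\<close>
  then obtain b where b: "b \<in> ?C" "b \<notin> B" using closure_subset[of B] by blast
  define K where "K n = ?C - W n" for n
  have bK: "b \<in> K n" for n using b WB by (auto simp: K_def)
  have Kc: "compact (K n)" for n using C Wo by (auto simp: K_def intro: compact_diff)
  have Kne: "K n \<noteq> {}" for n using bK by blast
  have lip: "\<bar>infdist u (K n) - infdist v (K n)\<bar> \<le> norm (u - v)" for n u v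
    using infdist_triangle_abs[of u "K n" v] by (simp add: dist_norm)
  obtain R where R: "\<And>u v. u \<in> ?C \<Longrightarrow> v \<in> ?C \<Longrightarrow> dist u v \<le> R"
    using compact_imp_bounded[OF C] by (auto simp: bounded_two_points)
  obtain d k where d: "continuous_on ?C d" "strict_mono (k :: nat \<Rightarrow> nat)"
    "\<And>e. 0 < e \<Longrightarrow> \<exists>N. \<forall>n x. n \<ge> N \<and> x \<in> ?C \<longrightarrow> norm (infdist x (K (k n)) - d x) < e"
  proof (rule Arzela_Ascoli[of ?C "\<lambda>n x. infdist x (K n)" R])
    show "norm (infdist x (K n)) \<le> R" if "x \<in> ?C" for n x
      using infdist_le[OF bK, of x n] R[OF that b(1)] infdist_nonneg[of x "K n"] by simp
    show "\<exists>d>0. \<forall>n y. y \<in> ?C \<and> norm (x - y) < d \<longrightarrow> norm (infdist x (K n) - infdist y (K n)) < e"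
      if "0 < e" for x e
      using that lip by (intro exI[of _ e]) (auto intro: order_le_less_trans)
  qed (use C that in auto)
  \<comment> \<open>The future Hausdorff limit of the complements: the points of the closure of B
    whose distances to them tend to 0.\<close>
  define K0 where "K0 = {x \<in> ?C. d x = 0}"
  define \<omega> where "\<omega> = B - K0"
  have dlim: "(\<lambda>n. infdist x (K (k n))) \<longlonglongrightarrow> d x" if "x \<in> ?C" for x
  proof (rule LIMSEQ_I)
    fix e :: real assume "0 < e"
    from d(3)[OF this] that show "\<exists>no. \<forall>n\<ge>no. norm (infdist x (K (k n)) - d x) < e" by blast
  qed
  have d0: "0 \<le> d x" if "x \<in> ?C" for x
    by (rule LIMSEQ_le_const[OF dlim[OF that]]) (auto simp: infdist_nonneg)
  have K0c: "closed K0"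
  proof -
    have "closed (?C \<inter> d -` {0})" by (intro continuous_closed_preimage d(1)) auto
    moreover have "?C \<inter> d -` {0} = K0" by (auto simp: K0_def)
    ultimately show ?thesis by simp
  qed
  have CB: "?C - B \<subseteq> K0"
  proof
    fix x assume x: "x \<in> ?C - B"
    then have "infdist x (K (k n)) = 0" for n using WB by (auto simp: K_def intro!: infdist_zero)
    then have "d x = 0" using LIMSEQ_unique[OF dlim, of x 0] x by simp
    with x show "x \<in> K0" by (simp add: K0_def)
  qed
  have C\<omega>: "?C - \<omega> = K0" using CB closure_subset[of B] by (auto simp: \<omega>_def K0_def)
  have op: "open \<omega>" using B(1) K0c by (auto simp: \<omega>_def open_Diff)
  have inner: "\<forall>\<^sub>F n in sequentially. z \<in> W (k n)" if z: "z \<in> \<omega>" for z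
  proof -
    have zC: "z \<in> ?C" and dz: "d z > 0" using z d0[of z] closure_subset[of B] by (auto simp: \<omega>_def K0_def less_le)
    from order_tendstoD(1)[OF dlim[OF zC] dz]
    show ?thesis
    proof eventually_elim
      case (elim n)
      then have "z \<notin> K (k n)" using infdist_zero[of z "K (k n)"] by auto
      then show ?case using zC by (simp add: K_def)
    qed
  qed
  have outer: "\<exists>w. (\<forall>n. w n \<notin> W (k n)) \<and> w \<longlonglongrightarrow> z" if z: "z \<notin> \<omega>" for z
  proof (cases "z \<in> B")
    case False
    then show ?thesis using WB by (intro exI[of _ "\<lambda>n. z"]) auto
  next
    case True
    then have zK: "z \<in> ?C" "d z = 0" using z by (auto simp: \<omega>_def K0_def)
    have "\<exists>w. w \<in> K (k n) \<and> infdist z (K (k n)) = dist z w" for n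
      using infdist_attains_inf[OF compact_imp_closed[OF Kc] Kne] by metis
    then obtain w where w: "\<And>n. w n \<in> K (k n)" "\<And>n. infdist z (K (k n)) = dist z (w n)" by metis
    have "(\<lambda>n. dist (w n) z) \<longlonglongrightarrow> 0" using dlim[OF zK(1)] zK(2) w(2) by (simp add: dist_commute)
    then have "w \<longlonglongrightarrow> z" by (simp add: tendsto_dist_iff[symmetric])
    with w(1) show ?thesis by (intro exI[of _ w]) (auto simp: K_def)
  qed
  \<comment> \<open>A segment from a point of the shape to a point outside crosses the boundary, and
    balls are convex.\<close>
  have seg: "\<exists>y\<in>frontier (W (k n)). dist y z < \<delta>" if "p \<in> W (k n)" "q \<notin> W (k n)" "dist p z < \<delta>" "dist q z < \<delta>" for n p q z \<delta>
  proof -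
    have "closed_segment p q \<inter> frontier (W (k n)) \<noteq> {}"
      using that by (intro connected_Int_frontier) auto
    then obtain y where y: "y \<in> closed_segment p q" "y \<in> frontier (W (k n))" by blast
    have "closed_segment p q \<subseteq> ball z \<delta>"
      using that by (intro closed_segment_subset) (auto simp: dist_commute)
    with y(1) have "y \<in> ball z \<delta>" by blast
    with y(2) show ?thesis by (metis dist_commute mem_ball)
  qed
  have sub: "\<exists>e \<psi>. graph_chart \<omega> x L r h e \<psi> \<and> \<psi> 0 = 0"
    if near: "\<And>\<delta>. 0 < \<delta> \<Longrightarrow> \<exists>\<^sub>F n in sequentially. \<exists>y\<in>frontier (W (k n)). dist y x < \<delta>" for x
  proof (rule graph_chart_subsequence[of \<omega> "\<lambda>n. W (k n)" L r h x])
    show "\<exists>\<^sub>F n in sequentially. \<exists>y\<in>frontier (W (k n)). dist y x < \<delta>" if "0 < \<delta>" for \<delta>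
      by (rule near[OF that])
    show "\<exists>w. (\<forall>n. w n \<notin> W (k n)) \<and> w \<longlonglongrightarrow> z" if "z \<notin> \<omega>" for z by (rule outer[OF that])
    show "\<forall>\<^sub>F n in sequentially. z \<in> W (k n)" if "z \<in> \<omega>" for z by (rule inner[OF that])
  qed (use op Wo Wc pos in blast)+
  have chart: "lipschitz_chart \<omega> x L r h" if x: "x \<in> frontier \<omega>" for x
  proof -
    have x': "x \<notin> \<omega>" "x \<in> closure \<omega>" using x op by (auto simp: frontier_def interior_open)
    obtain w where w: "\<And>n. w n \<notin> W (k n)" "w \<longlonglongrightarrow> x" using outer[OF x'(1)] by blast
    have "\<exists>\<^sub>F n in sequentially. \<exists>y\<in>frontier (W (k n)). dist y x < \<delta>" if \<delta>: "0 < \<delta>" for \<delta>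
    proof -
      obtain p where p: "p \<in> \<omega>" "dist p x < \<delta>" using x'(2) \<delta> by (auto simp: closure_approachable)
      have "\<forall>\<^sub>F n in sequentially. dist (w n) x < \<delta>" using w(2) \<delta> by (rule tendstoD)
      with inner[OF p(1)] have "\<forall>\<^sub>F n in sequentially. \<exists>y\<in>frontier (W (k n)). dist y x < \<delta>"
        by eventually_elim (rule seg[OF _ w(1) p(2)])
      then show ?thesis by (rule eventually_frequently[OF trivial_limit_sequentially])
    qed
    from sub[OF this] show ?thesis by (auto simp: lipschitz_chart_iff)
  qed
  have out: "\<forall>\<^sub>F n in sequentially. z \<notin> W (k n)" if z: "z \<notin> closure \<omega>" for z
  proof (rule ccontr)
    assume "\<not> ?thesis"
    then have fr: "\<exists>\<^sub>F n in sequentially. z \<in> W (k n)" by (simp add: frequently_def)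
    have "z \<notin> \<omega>" using z closure_subset by blast
    then obtain w where w: "\<And>n. w n \<notin> W (k n)" "w \<longlonglongrightarrow> z" using outer by blast
    have "\<exists>\<^sub>F n in sequentially. \<exists>y\<in>frontier (W (k n)). dist y z < \<delta>" if \<delta>: "0 < \<delta>" for \<delta>
    proof -
      have ev: "\<forall>\<^sub>F n in sequentially. dist (w n) z < \<delta>" using w(2) \<delta> by (rule tendstoD)
      have "\<exists>\<^sub>F n in sequentially. z \<in> W (k n) \<and> dist (w n) z < \<delta>"
        using frequently_eventually_frequently[OF fr ev] .
      then show ?thesis
        by (rule frequently_mono[rotated]) (use seg[OF _ w(1)] \<delta> in auto)
    qed
    from sub[OF this] obtain e \<psi> where c: "graph_chart \<omega> z L r h e \<psi>" "\<psi> 0 = 0" by blast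
    have e: "norm e = 1" using c by (simp add: graph_chart_def)
    have "z \<in> closure \<omega>"
      unfolding closure_approachable
    proof (intro allI impI)
      fix \<delta> :: real assume \<delta>: "0 < \<delta>"
      define t where "t = min (\<delta> / 2) (h / 2)"
      have t: "0 < t" "t < \<delta>" "t < h" using \<delta> pos by (auto simp: t_def)
      \<comment> \<open>The limit graph passes through z, so points just below z belong to \<omega>;
        t < h keeps them inside the cylinder.\<close>
      have "z + 0 + (- t) *\<^sub>R e \<in> \<omega>"
        using c t pos unfolding graph_chart_def by (metis abs_minus_cancel abs_of_pos inner_zero_left neg_less_0_iff_less norm_zero)
      moreover have "dist (z + 0 + (- t) *\<^sub>R e) z < \<delta>" using t e by (simp add: dist_norm)
      ultimately show "\<exists>y\<in>\<omega>. dist y z < \<delta>" by blast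
    qed
    with z show False by simp
  qed
  \<comment> \<open>Nearest points in the complements accumulate at a point at distance
    \<open>d x\<close> from x. Uniform convergence makes d vanish there, so it belongs to
    \<open>K0\<close>.\<close>
  have le_d: "infdist x K0 \<le> d x" if x: "x \<in> ?C" for x
  proof -
    have "\<exists>w. w \<in> K (k n) \<and> infdist x (K (k n)) = dist x w" for n
      using infdist_attains_inf[OF compact_imp_closed[OF Kc] Kne] by metis
    then obtain w where w: "\<And>n. w n \<in> K (k n)" "\<And>n. infdist x (K (k n)) = dist x (w n)" by metis
    have wC: "w n \<in> ?C" for n using w(1) by (auto simp: K_def)
    then obtain w0 l where l: "w0 \<in> ?C" "strict_mono l" "(w \<circ> l) \<longlonglongrightarrow> w0"
      using C unfolding compact_def by metis
    have "(\<lambda>n. d (w (l n))) \<longlonglongrightarrow> d w0"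
      using d(1) l wC by (auto simp: continuous_on_sequentially o_def)
    moreover have "(\<lambda>n. d (w (l n))) \<longlonglongrightarrow> 0"
    proof (rule LIMSEQ_I)
      fix e :: real assume "0 < e"
      then obtain N where N: "\<And>n x. n \<ge> N \<Longrightarrow> x \<in> ?C \<Longrightarrow> norm (infdist x (K (k n)) - d x) < e" using d(3) by blast
      show "\<exists>no. \<forall>n\<ge>no. norm (d (w (l n)) - 0) < e"
      proof (intro exI[of _ N] allI impI)
        fix n assume "N \<le> n"
        then have "N \<le> l n" using seq_suble[OF l(2), of n] by simp
        from N[OF this wC, of "l n"] show "norm (d (w (l n)) - 0) < e" using w(1)[of "l n"] by simp
      qed
    qed
    ultimately have "d w0 = 0" by (rule LIMSEQ_unique)
    with l(1) have "w0 \<in> K0" by (simp add: K0_def)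
    then have "infdist x K0 \<le> dist x w0" by (rule infdist_le)
    also have "dist x w0 = d x"
    proof (rule LIMSEQ_unique)
      show "(\<lambda>n. dist x (w (l n))) \<longlonglongrightarrow> dist x w0" using l(3) by (intro tendsto_intros) (simp add: o_def)
      show "(\<lambda>n. dist x (w (l n))) \<longlonglongrightarrow> d x"
        using LIMSEQ_subseq_LIMSEQ[OF dlim[OF x] l(2)] w(2) by (simp add: o_def)
    qed
    finally show ?thesis .
  qed
  have "converges_hausdorff B (\<lambda>n. W (k n)) \<omega>"
    unfolding converges_hausdorff_def C\<omega> K_def[symmetric]
  proof (rule LIMSEQ_I)
    fix e :: real assume e: "0 < e"
    then obtain N where N: "\<And>n x. n \<ge> N \<Longrightarrow> x \<in> ?C \<Longrightarrow> norm (infdist x (K (k n)) - d x) < e / 2"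
      using d(3)[of "e / 2"] by auto
    show "\<exists>no. \<forall>n\<ge>no. norm (hausdorff_distance (K (k n)) K0 - 0) < e"
    proof (intro exI[of _ N] allI impI)
      fix n assume n: "N \<le> n"
      have "K0 \<noteq> {}" using CB b by blast
      \<comment> \<open>On \<open>K (k n)\<close> its own distance function vanishes and on
        \<open>K0\<close> the limit d does, so uniform closeness of the two gives both halves of the
        Hausdorff bound.\<close>
      have 1: "infdist x K0 \<le> e / 2" if x: "x \<in> K (k n)" for x
      proof -
        have xC: "x \<in> ?C" using x by (simp add: K_def)
        show ?thesis using N[OF n xC] le_d[OF xC] x by simp
      qed
      have 2: "infdist x (K (k n)) \<le> e / 2" if x: "x \<in> K0" for x
        using N[OF n, of x] x by (simp add: K0_def)
      show "norm (hausdorff_distance (K (k n)) K0 - 0) < e"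
        using hausdorff_distance_le[OF Kne \<open>K0 \<noteq> {}\<close> 1 2] e by simp
    qed
  qed
  moreover have "\<omega> \<in> admissible B L r h" using op chart by (auto simp: admissible_def \<omega>_def)
  moreover have "negligible (frontier \<omega>)" by (rule negligible_frontier_chart[OF op chart pos(2,3)])
  ultimately show thesis using d(2) inner out by (intro that[of k \<omega>] ballI allI impI)
qed

section \<open>Multipliers and the penalization error\<close>

context curl_domain
begin

text \<open>Minimizing sequences of \<open>(l2norm M v)\<^sup>2 / 2 - l v\<close> over \<open>H0curl \<Omega>\<close> are Cauchy in \<open>L\<^sup>2\<close> only, so the
  representing function need not lie in \<open>H0curl \<Omega>\<close>.\<close>

lemma H0curl_l2_representation:
  assumes lin: "\<And>u v t. u \<in> H0curl \<Omega> \<Longrightarrow> v \<in> H0curl \<Omega> \<Longrightarrow> l (\<lambda>x. u x + t *\<^sub>R v x) = l u + t * l v"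
    and bd: "\<And>v. v \<in> H0curl \<Omega> \<Longrightarrow> \<bar>l v\<bar> \<le> K * l2norm M v"
  obtains lam where "sqint M lam" "\<forall>v\<in>H0curl \<Omega>. (\<integral>x. lam x \<bullet> v x \<partial>M) = l v"
proof -
  have sq: "sqint M v" if "v \<in> H0curl \<Omega>" for v using that H0curl_Hcurl Hcurl_sqint by blast
  define F where "F v = (l2norm M v)\<^sup>2 / 2 - l v" for v
  define q where "q u v = (l2norm M (\<lambda>x. u x - v x))\<^sup>2 / 8" for u v :: "R3 \<Rightarrow> R3"
  have F_lin: "F (\<lambda>x. u x + t *\<^sub>R v x) = F u + t * ((\<integral>x. u x \<bullet> v x \<partial>M) - l v) + t\<^sup>2 * ((l2norm M v)\<^sup>2 / 2)"
    if u: "u \<in> H0curl \<Omega>" and v: "v \<in> H0curl \<Omega>" for u v t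
    using l2norm_square_lin[OF sq[OF u] sq[OF v], of t] lin[OF u v, of t]
    by (simp add: F_def add_divide_distrib right_diff_distrib)
  obtain s where s: "\<And>n::nat. s n \<in> H0curl \<Omega>" "(\<lambda>n. F (s n)) \<longlonglongrightarrow> Inf (F ` H0curl \<Omega>)"
    "\<And>e. e > 0 \<Longrightarrow> \<exists>N. \<forall>m\<ge>N. \<forall>n\<ge>N. q (s m) (s n) < e" "\<And>v. v \<in> H0curl \<Omega> \<Longrightarrow> Inf (F ` H0curl \<Omega>) \<le> F v"
  proof (rule minimizing_sequence[of "H0curl \<Omega>" "- K\<^sup>2 / 2" F q])
    show "H0curl \<Omega> \<noteq> {}" using H0curl_zero by blast
    \<comment> \<open>The lower bound comes from the square of the L2 norm of v minus K.\<close>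
    show "- K\<^sup>2 / 2 \<le> F v" if "v \<in> H0curl \<Omega>" for v
    proof -
      have "0 \<le> (l2norm M v - K)\<^sup>2" by simp
      then have "2 * (K * l2norm M v) \<le> (l2norm M v)\<^sup>2 + K\<^sup>2" by (simp add: power2_diff mult_ac)
      then have "K * l2norm M v \<le> (l2norm M v)\<^sup>2 / 2 + K\<^sup>2 / 2" by linarith
      then show ?thesis using bd[OF that] by (simp add: F_def)
    qed
    show "\<exists>w\<in>H0curl \<Omega>. F w \<le> (F u + F v) / 2 - q u v" if u: "u \<in> H0curl \<Omega>" and v: "v \<in> H0curl \<Omega>" for u v
    proof (rule bexI)
      note d = H0curl_diff[OF v u]
      show "(\<lambda>x. u x + (1/2) *\<^sub>R (v x - u x)) \<in> H0curl \<Omega>" by (intro H0curl_add H0curl_scaleR u d)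
      show "F (\<lambda>x. u x + (1/2) *\<^sub>R (v x - u x)) \<le> (F u + F v) / 2 - q u v"
        using F_lin[OF u d, of "1/2"] F_lin[OF u d, of 1]
        by (simp add: q_def l2norm_minus_commute[of M u v] power2_eq_square field_simps)
    qed
  qed blast+
  obtain lam where lam: "sqint M lam" "(\<lambda>n. l2norm M (\<lambda>x. s n x - lam x)) \<longlonglongrightarrow> 0"
  proof (rule fin.l2_complete[of s])
    fix e :: real assume e: "e > 0"
    then have "e\<^sup>2 / 8 > 0" by simp
    from s(3)[OF this] obtain N where N: "\<forall>m\<ge>N. \<forall>n\<ge>N. q (s m) (s n) < e\<^sup>2 / 8" ..
    show "\<exists>N. \<forall>m\<ge>N. \<forall>n\<ge>N. l2norm M (\<lambda>x. s m x - s n x) < e"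
    proof (intro exI[of _ N] allI impI)
      fix m n assume "m \<ge> N" "n \<ge> N"
      with N have "q (s m) (s n) < e\<^sup>2 / 8" by blast
      then have "(l2norm M (\<lambda>x. s m x - s n x))\<^sup>2 < e\<^sup>2" by (simp add: q_def)
      then show "l2norm M (\<lambda>x. s m x - s n x) < e"
        by (rule power_less_imp_less_base) (use e in simp)
    qed
  qed (use sq s(1) in blast)+
  \<comment> \<open>F need not make sense at \<open>lam\<close>. Instead \<open>s n\<close> is
    perturbed by t v and n tends to infinity; the values of F at \<open>s n\<close> tend to the
    infimum, which cancels and leaves the first order condition at \<open>lam\<close>.\<close>
  have ge: "l v \<le> (\<integral>x. lam x \<bullet> v x \<partial>M)" if v: "v \<in> H0curl \<Omega>" for v
  proof -
    have lim: "(\<lambda>n. \<integral>x. s n x \<bullet> v x \<partial>M) \<longlonglongrightarrow> (\<integral>x. lam x \<bullet> v x \<partial>M)"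
      by (rule l2_inner_tendsto[OF sq[OF s(1)] lam sq[OF v] sq[OF v]]) (simp add: l2norm_def)
    have "0 \<le> t * ((\<integral>x. lam x \<bullet> v x \<partial>M) - l v) + t\<^sup>2 * ((l2norm M v)\<^sup>2 / 2)" for t
    proof -
      have "(\<lambda>n. F (s n) + t * ((\<integral>x. s n x \<bullet> v x \<partial>M) - l v) + t\<^sup>2 * ((l2norm M v)\<^sup>2 / 2)) \<longlonglongrightarrow>
          Inf (F ` H0curl \<Omega>) + t * ((\<integral>x. lam x \<bullet> v x \<partial>M) - l v) + t\<^sup>2 * ((l2norm M v)\<^sup>2 / 2)"
        by (intro tendsto_intros s(2) lim)
      moreover have "Inf (F ` H0curl \<Omega>) \<le> F (s n) + t * ((\<integral>x. s n x \<bullet> v x \<partial>M) - l v) + t\<^sup>2 * ((l2norm M v)\<^sup>2 / 2)" for n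
        using s(4)[OF H0curl_add[OF s(1) H0curl_scaleR[OF v]], of n t] F_lin[OF s(1) v, of n t] by simp
      ultimately have "Inf (F ` H0curl \<Omega>) \<le> Inf (F ` H0curl \<Omega>) + t * ((\<integral>x. lam x \<bullet> v x \<partial>M) - l v) + t\<^sup>2 * ((l2norm M v)\<^sup>2 / 2)"
        by (intro LIMSEQ_le_const) auto
      then show ?thesis by simp
    qed
    then have "0 \<le> (\<integral>x. lam x \<bullet> v x \<partial>M) - l v" by (rule linear_term_nonneg)
    then show ?thesis by simp
  qed
  have l0: "l (\<lambda>x. 0) = 0" using lin[OF H0curl_zero H0curl_zero, of 1] by simp
  show thesis
  proof (rule that[OF lam(1)], rule ballI)
    fix v assume v: "v \<in> H0curl \<Omega>"
    have "l (\<lambda>x. (-1) *\<^sub>R v x) = - l v" using lin[OF H0curl_zero v, of "-1"] l0 by simp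
    then show "(\<integral>x. lam x \<bullet> v x \<partial>M) = l v"
      using ge[OF v] ge[OF H0curl_scaleR[OF v, of "-1"]] by simp
  qed
qed

end

section \<open>Existence of the multiplier and comparison of the two problems\<close>

context curl_form
begin

lemma VI_solutionD:
  assumes "VI_solution \<Omega> \<nu> \<epsilon> j f \<omega> E"
  shows "E \<in> H0curl \<Omega>"
    "v \<in> H0curl \<Omega> \<Longrightarrow> a E (\<lambda>x. v x - E x) + j * (\<integral>x. norm (v x) \<partial>lebesgue_on \<omega>) - j * (\<integral>x. norm (E x) \<partial>lebesgue_on \<omega>)
        \<ge> (\<integral>x. f x \<bullet> (v x - E x) \<partial>M)"
  using assms by (auto simp: VI_solution_def)

lemma sqint_H0curl: "v \<in> H0curl \<Omega> \<Longrightarrow> sqint M v"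
  using H0curl_Hcurl Hcurl_sqint by blast

lemma dual_multiplier_exists:
  assumes \<omega>: "open \<omega>" "\<omega> \<subseteq> \<Omega>" and j: "j > 0" and f: "square_integrable \<Omega> f"
    and VI: "VI_solution \<Omega> \<nu> \<epsilon> j f \<omega> E"
  shows "\<exists>lam. dual_multiplier \<Omega> \<nu> \<epsilon> j f \<omega> E lam"
proof -
  let ?W = "lebesgue_on \<omega>"
  note E = VI_solutionD(1)[OF VI] and vi = VI_solutionD(2)[OF VI]
  note sets_\<omega> = subdomain_measure(1)[OF \<omega>]
  note restr = integral_lebesgue_on_subset[OF sets_\<Omega> sets_\<omega> \<omega>(2)]
  have f': "sqint M f" using f by (simp add: square_integrable_eq)
  note l1 = l1_subdomain_le[OF \<omega> sqint_H0curl]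
  define l where "l v = (\<integral>x. f x \<bullet> v x \<partial>M) - a E v" for v
  have l_lin: "l (\<lambda>x. u x + t *\<^sub>R v x) = l u + t * l v" if u: "u \<in> H0curl \<Omega>" and v: "v \<in> H0curl \<Omega>" for u v t
    using form_lin_right[OF H0curl_Hcurl[OF E] H0curl_Hcurl[OF u] H0curl_Hcurl[OF v], of 1 t]
      sqint_inner_integrable[OF f' sqint_H0curl[OF u]] sqint_inner_integrable[OF f' sqint_H0curl[OF v]]
    by (simp add: l_def inner_add_right right_diff_distrib)
  \<comment> \<open>The variational inequality is tested with v + E and the norm split by the
    triangle inequality.\<close>
  have l_le: "l v \<le> j * (\<integral>x. norm (v x) \<partial>?W)" if v: "v \<in> H0curl \<Omega>" for v
  proof -
    have "(\<integral>x. norm (v x + E x) \<partial>?W) \<le> (\<integral>x. norm (v x) + norm (E x) \<partial>?W)"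
      by (intro integral_mono Bochner_Integration.integrable_add l1(1) v E H0curl_add norm_triangle_ineq)
    also have "\<dots> = (\<integral>x. norm (v x) \<partial>?W) + (\<integral>x. norm (E x) \<partial>?W)"
      using l1(1)[OF v] l1(1)[OF E] by simp
    finally have "j * (\<integral>x. norm (v x + E x) \<partial>?W) \<le> j * ((\<integral>x. norm (v x) \<partial>?W) + (\<integral>x. norm (E x) \<partial>?W))"
      using j by (intro mult_left_mono) auto
    with vi[OF H0curl_add[OF v E]] show ?thesis by (simp add: l_def distrib_left)
  qed
  have l0: "l (\<lambda>x. 0) = 0" using l_lin[OF H0curl_zero H0curl_zero, of 1] by simp
  have l_abs: "\<bar>l v\<bar> \<le> j * (\<integral>x. norm (v x) \<partial>?W)" if v: "v \<in> H0curl \<Omega>" for v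
    using l_le[OF v] l_le[OF H0curl_scaleR[OF v, of "-1"]] l_lin[OF H0curl_zero v, of "-1"] l0 by simp
  obtain lam where lam: "sqint M lam" "\<forall>v\<in>H0curl \<Omega>. (\<integral>x. lam x \<bullet> v x \<partial>M) = l v"
  proof (rule H0curl_l2_representation[of l "j * sqrt (measure M (space M))"])
    show "\<bar>l v\<bar> \<le> j * sqrt (measure M (space M)) * l2norm M v" if v: "v \<in> H0curl \<Omega>" for v
    proof -
      have "j * (\<integral>x. norm (v x) \<partial>?W) \<le> j * (l2norm M v * sqrt (measure M (space M)))"
        using j l1(2)[OF v] by (intro mult_left_mono) auto
      with l_abs[OF v] show ?thesis by (simp add: mult_ac)
    qed
  qed (use l_lin in blast)+
  have int_ind: "integrable M (\<lambda>x. j * indicator \<omega> x)"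
    using restr(3)[of "\<lambda>x. 1::real"] by simp
  have bnd: "AE x in M. norm (lam x) \<le> j * indicator \<omega> x"
  proof (rule AE_norm_le_if_test_le[OF open_\<Omega> fin.sqint_integrable[OF lam(1)] int_ind])
    fix \<phi> assume "\<phi> \<in> test_functions \<Omega>"
    then have \<phi>: "\<phi> \<in> H0curl \<Omega>" by (rule test_H0curl)
    have "(\<integral>x. lam x \<bullet> \<phi> x \<partial>M) \<le> j * (\<integral>x. norm (\<phi> x) \<partial>?W)" using lam(2) \<phi> l_le[OF \<phi>] by simp
    also have "\<dots> = (\<integral>x. j * indicator \<omega> x * norm (\<phi> x) \<partial>M)"
      unfolding restr(2) by (simp add: mult.assoc)
    finally show "(\<integral>x. lam x \<bullet> \<phi> x \<partial>M) \<le> (\<integral>x. j * indicator \<omega> x * norm (\<phi> x) \<partial>M)" .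
  qed
  have zero: "(\<integral>x. lam x \<bullet> v x \<partial>?W) = (\<integral>x. lam x \<bullet> v x \<partial>M)" if v: "v \<in> H0curl \<Omega>" for v
    unfolding restr(2)
  proof (rule integral_cong_AE)
    note i = sqint_inner_integrable[OF lam(1) sqint_H0curl[OF v]]
    show "(\<lambda>x. indicator \<omega> x *\<^sub>R (lam x \<bullet> v x)) \<in> borel_measurable M"
      by (rule borel_measurable_integrable[OF restr(3)[OF i]])
    show "(\<lambda>x. lam x \<bullet> v x) \<in> borel_measurable M" by (rule borel_measurable_integrable[OF i])
    show "AE x in M. indicator \<omega> x *\<^sub>R (lam x \<bullet> v x) = lam x \<bullet> v x"
      using bnd by eventually_elim (auto simp: indicator_def split: if_splits)
  qed
  have bndW: "AE x in ?W. norm (lam x) \<le> j"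
    using AE_lebesgue_on_subset[OF sets_\<Omega> sets_\<omega> \<omega>(2) bnd]
  proof eventually_elim
    case (elim x)
    then show ?case using j by (cases "x \<in> \<omega>") auto
  qed
  have iW: "integrable ?W (\<lambda>x. lam x \<bullet> E x)"
    by (rule restr(1)[OF sqint_inner_integrable[OF lam(1) sqint_H0curl[OF E]]])
  have leE: "AE x in ?W. 0 \<le> j * norm (E x) - lam x \<bullet> E x"
    using bndW
  proof eventually_elim
    case (elim x)
    have "lam x \<bullet> E x \<le> norm (lam x) * norm (E x)" by (rule norm_cauchy_schwarz)
    also have "\<dots> \<le> j * norm (E x)" using elim by (intro mult_right_mono) auto
    finally show ?case by simp
  qed
  \<comment> \<open>Testing with 0 gives the reverse integral inequality. As lam . E \<le> j |E|
    holds pointwise, equality must hold almost everywhere.\<close>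
  have "j * (\<integral>x. norm (E x) \<partial>?W) \<le> l E"
    using vi[OF H0curl_zero] form_scale_right[OF H0curl_Hcurl[OF E] H0curl_Hcurl[OF E], of "-1"] by (simp add: l_def)
  then have le0: "(\<integral>x. j * norm (E x) - lam x \<bullet> E x \<partial>?W) \<le> 0"
    using lam(2) E zero[OF E] iW l1(1)[OF E] by simp
  have intd: "integrable ?W (\<lambda>x. j * norm (E x) - lam x \<bullet> E x)" using iW l1(1)[OF E] by simp
  have "(\<integral>x. j * norm (E x) - lam x \<bullet> E x \<partial>?W) = 0"
    using le0 integral_nonneg_AE[OF leE] by linarith
  then have "AE x in ?W. j * norm (E x) - lam x \<bullet> E x = 0"
    using integral_nonneg_eq_0_iff_AE[OF intd leE] by simp
  then have eqE: "AE x in ?W. lam x \<bullet> E x = j * norm (E x)" by eventually_elim simp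
  have "lam \<in> borel_measurable ?W"
    by (rule measurable_lebesgue_on_subset[OF sqint_measurable[OF lam(1)] \<omega>(2)])
  moreover have "\<forall>v\<in>H0curl \<Omega>. a E v + (\<integral>x. lam x \<bullet> v x \<partial>?W) = (\<integral>x. f x \<bullet> v x \<partial>M)"
    using lam(2) zero by (simp add: l_def)
  ultimately have "dual_multiplier \<Omega> \<nu> \<epsilon> j f \<omega> E lam"
    unfolding dual_multiplier_def ess_bounded_def using bndW eqE by blast
  then show ?thesis by (intro exI[of _ lam])
qed

lemma indicator_diff_sqint:
  assumes "open \<omega>1" "open \<omega>2"
  shows "sqint M (\<lambda>x. indicator \<omega>1 x - indicator \<omega>2 x :: real)"
proof (rule sqint_diff)
  have "sqint M (\<lambda>x. indicator S x :: real)" if "open S" for S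
  proof (rule sqint_bound[OF fin.sqint_const[of "1::real"]])
    show "(\<lambda>x. indicator S x :: real) \<in> borel_measurable M"
      using that by (intro measurable_restrict_space1 borel_measurable_indicator) simp
  qed (auto simp: indicator_def)
  then show "sqint M (\<lambda>x. indicator \<omega>1 x :: real)" "sqint M (\<lambda>x. indicator \<omega>2 x :: real)"
    using assms by blast+
qed

text \<open>The penalized equation is tested with E2 - E1 and the variational inequality with E1.
  Pointwise, lam . (E2 - E1) \<le> j |E2| - j |E1| + k, where k is the gap from
  \<open>pen_field_inner_ge\<close>; the two nonsmooth terms then differ only where the shapes
  do.\<close>

lemma penalization_estimate:
  assumes \<omega>1: "open \<omega>1" "\<omega>1 \<subseteq> \<Omega>" and \<omega>2: "open \<omega>2" "\<omega>2 \<subseteq> \<Omega>" and j: "j > 0" and \<gamma>: "\<gamma> > 0"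
    and f: "square_integrable \<Omega> f"
    and pen: "penalized_solution \<Omega> \<nu> \<epsilon> j f \<gamma> \<omega>1 (E1, lam)"
    and VI: "VI_solution \<Omega> \<nu> \<epsilon> j f \<omega>2 E2"
  shows "a (\<lambda>x. E2 x - E1 x) (\<lambda>x. E2 x - E1 x)
    \<le> j * l2norm M (\<lambda>x. indicator \<omega>1 x - indicator \<omega>2 x :: real) * Hcurl_norm \<Omega> (\<lambda>x. E2 x - E1 x)
      + j * (1 + 1 / (2 * \<gamma>)) / \<gamma> * measure M (space M)"
proof -
  let ?W1 = "lebesgue_on \<omega>1" and ?W2 = "lebesgue_on \<omega>2" and ?d = "\<lambda>x. E2 x - E1 x"
  interpret w1: finite_measure ?W1 by (rule subdomain_measure(2)[OF \<omega>1])
  define k where "k = j * (1 + 1 / (2 * \<gamma>)) / \<gamma>"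
  have k: "0 \<le> k" using j \<gamma> by (simp add: k_def)
  have E1: "E1 \<in> H0curl \<Omega>" and lam_m: "lam \<in> borel_measurable ?W1"
    and eq: "\<And>v. v \<in> H0curl \<Omega> \<Longrightarrow> a E1 v + (\<integral>x. lam x \<bullet> v x \<partial>?W1) = (\<integral>x. f x \<bullet> v x \<partial>M)"
    and lam: "AE x in ?W1. lam x = pen_field j \<gamma> (E1 x)"
    using pen by (auto simp: penalized_solution_def ess_bounded_def pen_field_def)
  note E2 = VI_solutionD(1)[OF VI]
  note d = H0curl_diff[OF E2 E1]
  note sq = sqint_H0curl[OF E1] sqint_H0curl[OF E2] sqint_H0curl[OF d]
  have "a E2 (\<lambda>x. E1 x - E2 x) = - a E2 ?d"
    using form_scale_right[OF H0curl_Hcurl[OF E2] H0curl_Hcurl[OF d], of "-1"] by simp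
  moreover have "(\<integral>x. f x \<bullet> (E1 x - E2 x) \<partial>M) = - (\<integral>x. f x \<bullet> ?d x \<partial>M)"
    unfolding Bochner_Integration.integral_minus[symmetric]
    by (intro Bochner_Integration.integral_cong) (auto simp: inner_diff_right)
  moreover have "a ?d ?d = a E2 ?d - a E1 ?d"
    by (rule form_diff_left[OF H0curl_Hcurl[OF E2] H0curl_Hcurl[OF E1] H0curl_Hcurl[OF d]])
  ultimately have main: "a ?d ?d \<le> (\<integral>x. lam x \<bullet> ?d x \<partial>?W1) + j * ((\<integral>x. norm (E1 x) \<partial>?W2) - (\<integral>x. norm (E2 x) \<partial>?W2))"
    using VI_solutionD(2)[OF VI E1] eq[OF d] by (simp add: right_diff_distrib)
  have "(\<integral>x. lam x \<bullet> ?d x \<partial>?W1) \<le> (\<integral>x. j * norm (E2 x) - j * norm (E1 x) + k \<partial>?W1)"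
  proof (rule integral_mono_AE)
    show "AE x in ?W1. lam x \<bullet> ?d x \<le> j * norm (E2 x) - j * norm (E1 x) + k"
      using lam
    proof eventually_elim
      case (elim x)
      have "pen_field j \<gamma> (E1 x) \<bullet> E2 x \<le> norm (pen_field j \<gamma> (E1 x)) * norm (E2 x)" by (rule norm_cauchy_schwarz)
      also have "\<dots> \<le> j * norm (E2 x)" by (intro mult_right_mono norm_pen_field_le \<gamma> j) simp
      finally show ?case
        using pen_field_inner_ge[OF \<gamma> j, of "E1 x"] elim by (simp add: inner_diff_right k_def)
    qed
    show "integrable ?W1 (\<lambda>x. j * norm (E2 x) - j * norm (E1 x) + k)"
      using l1_subdomain_le(1)[OF \<omega>1 sq(1)] l1_subdomain_le(1)[OF \<omega>1 sq(2)] by simp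
    show "integrable ?W1 (\<lambda>x. lam x \<bullet> ?d x)"
    proof (rule Bochner_Integration.integrable_bound)
      show "integrable ?W1 (\<lambda>x. j * norm (?d x))" using l1_subdomain_le(1)[OF \<omega>1 sq(3)] by simp
      show "(\<lambda>x. lam x \<bullet> ?d x) \<in> borel_measurable ?W1"
        by (rule borel_measurable_inner[OF lam_m measurable_lebesgue_on_subset[OF sqint_measurable[OF sq(3)] \<omega>1(2)]])
      show "AE x in ?W1. norm (lam x \<bullet> ?d x) \<le> norm (j * norm (?d x))"
        using lam
      proof eventually_elim
        case (elim x)
        have "norm (lam x \<bullet> ?d x) \<le> norm (lam x) * norm (?d x)" unfolding real_norm_def by (rule Cauchy_Schwarz_ineq2)
        also have "\<dots> \<le> j * norm (?d x)"
          unfolding elim by (intro mult_right_mono norm_pen_field_le \<gamma> j) simp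
        finally show ?case using j by (simp add: abs_mult)
      qed
    qed
  qed
  also have "\<dots> = j * ((\<integral>x. norm (E2 x) \<partial>?W1) - (\<integral>x. norm (E1 x) \<partial>?W1)) + k * measure ?W1 (space ?W1)"
    using l1_subdomain_le(1)[OF \<omega>1 sq(1)] l1_subdomain_le(1)[OF \<omega>1 sq(2)] by (simp add: right_diff_distrib mult.commute)
  also have "k * measure ?W1 (space ?W1) \<le> k * measure M (space M)"
    by (rule mult_left_mono[OF subdomain_measure(3)[OF \<omega>1] k])
  finally have lam_le: "(\<integral>x. lam x \<bullet> ?d x \<partial>?W1)
    \<le> j * ((\<integral>x. norm (E2 x) \<partial>?W1) - (\<integral>x. norm (E1 x) \<partial>?W1)) + k * measure M (space M)" by simp
  note r1 = integral_lebesgue_on_subset[OF sets_\<Omega> subdomain_measure(1)[OF \<omega>1] \<omega>1(2)]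
  note r2 = integral_lebesgue_on_subset[OF sets_\<Omega> subdomain_measure(1)[OF \<omega>2] \<omega>2(2)]
  note n = fin.sqint_integrable_norm[OF sq(1)] fin.sqint_integrable_norm[OF sq(2)]
  let ?i = "\<lambda>x. indicator \<omega>1 x - indicator \<omega>2 x :: real"
  \<comment> \<open>The four norm integrals collapse into one, weighted by the difference of the
    indicators. Both fields enter through |E2| - |E1|, so their distance appears on the
    right.\<close>
  have "(\<integral>x. norm (E2 x) \<partial>?W1) - (\<integral>x. norm (E1 x) \<partial>?W1) + ((\<integral>x. norm (E1 x) \<partial>?W2) - (\<integral>x. norm (E2 x) \<partial>?W2))
      = (\<integral>x. ?i x * (norm (E2 x) - norm (E1 x)) \<partial>M)"
    unfolding r1(2) r2(2)
    using r1(3)[OF n(1)] r1(3)[OF n(2)] r2(3)[OF n(1)] r2(3)[OF n(2)] by (simp add: algebra_simps)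
  also have "\<dots> \<le> (\<integral>x. norm (?i x) * norm (?d x) \<partial>M)"
  proof (rule integral_mono)
    have eq: "?i x * (norm (E2 x) - norm (E1 x)) = indicator \<omega>1 x *\<^sub>R norm (E2 x) - indicator \<omega>1 x *\<^sub>R norm (E1 x)
      - (indicator \<omega>2 x *\<^sub>R norm (E2 x) - indicator \<omega>2 x *\<^sub>R norm (E1 x))" for x
      by (simp add: algebra_simps)
    show "integrable M (\<lambda>x. ?i x * (norm (E2 x) - norm (E1 x)))"
      unfolding eq using r1(3)[OF n(1)] r1(3)[OF n(2)] r2(3)[OF n(1)] r2(3)[OF n(2)]
      by (intro Bochner_Integration.integrable_diff)
    show "integrable M (\<lambda>x. norm (?i x) * norm (?d x))"
      by (rule sqint_norm_mult_integrable[OF indicator_diff_sqint[OF \<omega>1(1) \<omega>2(1)] sq(3)])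
    fix x
    have "?i x * (norm (E2 x) - norm (E1 x)) \<le> \<bar>?i x * (norm (E2 x) - norm (E1 x))\<bar>" by simp
    also have "\<dots> = norm (?i x) * \<bar>norm (E2 x) - norm (E1 x)\<bar>" by (simp add: abs_mult)
    also have "\<dots> \<le> norm (?i x) * norm (?d x)" by (intro mult_left_mono norm_triangle_ineq3) simp
    finally show "?i x * (norm (E2 x) - norm (E1 x)) \<le> norm (?i x) * norm (?d x)" .
  qed
  also have "\<dots> \<le> l2norm M ?i * l2norm M ?d"
    by (rule l2_Cauchy_Schwarz_norm[OF indicator_diff_sqint[OF \<omega>1(1) \<omega>2(1)] sq(3)])
  also have "\<dots> \<le> l2norm M ?i * Hcurl_norm \<Omega> ?d"
    by (intro mult_left_mono l2norm_le_Hcurl_norm H0curl_Hcurl d) simp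
  finally have "j * ((\<integral>x. norm (E2 x) \<partial>?W1) - (\<integral>x. norm (E1 x) \<partial>?W1) + ((\<integral>x. norm (E1 x) \<partial>?W2) - (\<integral>x. norm (E2 x) \<partial>?W2)))
      \<le> j * (l2norm M ?i * Hcurl_norm \<Omega> ?d)"
    using j by (intro mult_left_mono) auto
  with main lam_le have "a ?d ?d \<le> j * (l2norm M ?i * Hcurl_norm \<Omega> ?d) + k * measure M (space M)"
    by (simp add: distrib_left)
  then show ?thesis by (simp add: k_def mult.assoc)
qed

end

section \<open>Convergence\<close>

text \<open>Young's inequality: the square of c x - A is nonnegative, which absorbs the linear term
  into half of the quadratic one.\<close>

lemma quadratic_estimate:
  fixes c x A K :: real
  assumes c: "0 < c" and le: "c * x\<^sup>2 \<le> A * x + K"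
  shows "x\<^sup>2 \<le> A\<^sup>2 / c\<^sup>2 + 2 * K / c"
proof -
  have "0 \<le> (c * x - A)\<^sup>2" by simp
  then have "2 * c * (A * x) \<le> c * (c * x\<^sup>2) + A\<^sup>2" by (simp add: power2_eq_square algebra_simps)
  moreover have "2 * c * (c * x\<^sup>2) \<le> 2 * c * (A * x + K)" using c le by (intro mult_left_mono) auto
  ultimately have "c\<^sup>2 * x\<^sup>2 \<le> A\<^sup>2 + 2 * c * K" by (simp add: power2_eq_square algebra_simps)
  then have "x\<^sup>2 \<le> (A\<^sup>2 + 2 * c * K) / c\<^sup>2" using c by (simp add: pos_le_divide_eq mult.commute)
  also have "\<dots> = A\<^sup>2 / c\<^sup>2 + 2 * K / c" using c by (simp add: add_divide_distrib power2_eq_square)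
  finally show ?thesis .
qed

section \<open>Convergence of characteristic functions\<close>

context curl_domain
begin

lemma indicator_L1_tendsto:
  assumes W: "\<And>n. open (W n)" "open \<omega>"
    and lim: "AE x in M. (\<lambda>n. indicator (W n) x) \<longlonglongrightarrow> (indicator \<omega> x :: real)"
  shows "(\<lambda>n. \<integral>x. \<bar>indicator (W n) x - indicator \<omega> x :: real\<bar> \<partial>M) \<longlonglongrightarrow> 0"
proof -
  have ind: "(\<lambda>x. indicator S x :: real) \<in> borel_measurable M" if "open S" for S
    using that by (intro measurable_restrict_space1 borel_measurable_indicator) simp
  have "(\<lambda>n. \<integral>x. \<bar>indicator (W n) x - indicator \<omega> x :: real\<bar> \<partial>M) \<longlonglongrightarrow> (\<integral>x. 0 \<partial>M)"
  proof (rule integral_dominated_convergence[where w="\<lambda>x. 1"])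
    show "AE x in M. (\<lambda>n. \<bar>indicator (W n) x - indicator \<omega> x :: real\<bar>) \<longlonglongrightarrow> 0"
      using lim
    proof eventually_elim
      case (elim x)
      then have "(\<lambda>n. \<bar>indicator (W n) x - indicator \<omega> x\<bar>) \<longlonglongrightarrow> \<bar>indicator \<omega> x - indicator \<omega> x :: real\<bar>"
        by (intro tendsto_intros)
      then show ?case by simp
    qed
    show "(\<lambda>x. \<bar>indicator (W n) x - indicator \<omega> x :: real\<bar>) \<in> borel_measurable M" for n
      using ind[OF W(1)] ind[OF W(2)] by (intro borel_measurable_abs borel_measurable_diff)
    show "AE x in M. norm \<bar>indicator (W n) x - indicator \<omega> x :: real\<bar> \<le> 1" for n
      by (intro AE_I2) (auto simp: indicator_def)
  qed auto
  then show ?thesis by simp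
qed

text \<open>A difference of indicators has absolute value 0 or 1, which powers leave unchanged, so
  all exponents p reduce to p = 1.\<close>

lemma converges_char_iff_L1:
  "converges_char \<Omega> W \<omega> \<longleftrightarrow> (\<lambda>n. \<integral>x. \<bar>indicator (W n) x - indicator \<omega> x :: real\<bar> \<partial>M) \<longlonglongrightarrow> 0"
proof -
  let ?D = "\<lambda>n. \<integral>x. \<bar>indicator (W n) x - indicator \<omega> x :: real\<bar> \<partial>M"
  have pw: "\<bar>indicator (W n) x - indicator \<omega> x :: real\<bar> powr p = \<bar>indicator (W n) x - indicator \<omega> x\<bar>"
    if "p \<ge> 1" for n x p
    using that by (auto simp: indicator_def)
  have "(\<lambda>n. ?D n powr (1 / p)) \<longlonglongrightarrow> 0" if D: "?D \<longlonglongrightarrow> 0" and p: "p \<ge> 1" for p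
  proof (rule tendsto_zero_powrI[OF D tendsto_const])
    show "0 < 1 / p" using p by simp
    show "\<forall>\<^sub>F n in sequentially. 0 \<le> ?D n" by (intro always_eventually allI integral_nonneg_AE AE_I2) simp
  qed
  moreover have "?D \<longlonglongrightarrow> 0" if "(\<lambda>n. ?D n powr (1 / 1)) \<longlonglongrightarrow> 0"
  proof -
    have "?D n powr (1 / 1) = ?D n" for n by simp
    with that show ?thesis by simp
  qed
  moreover have "(\<integral>x. \<bar>indicator (W n) x - indicator \<omega> x :: real\<bar> powr p \<partial>M) = ?D n" if "p \<ge> 1" for n p
    unfolding pw[OF that] ..
  ultimately show ?thesis
    unfolding converges_char_def by force
qed

lemma l2norm_indicator_diff:
  "l2norm M (\<lambda>x. indicator \<omega>1 x - indicator \<omega>2 x :: real)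
    = sqrt (\<integral>x. \<bar>indicator \<omega>1 x - indicator \<omega>2 x :: real\<bar> \<partial>M)"
  unfolding l2norm_def
  by (intro arg_cong[where f=sqrt] Bochner_Integration.integral_cong) (auto simp: indicator_def)

end

section \<open>Strong convergence of fields, costs and multipliers\<close>

context curl_form
begin

lemma E_sol_VI:
  assumes "open \<omega>" "\<omega> \<subseteq> \<Omega>" "j > 0" "square_integrable \<Omega> f"
  shows "VI_solution \<Omega> \<nu> \<epsilon> j f \<omega> (E_sol \<Omega> \<nu> \<epsilon> j f \<omega>)"
  unfolding E_sol_def by (rule someI_ex[OF VI_solution_exists[OF assms]])

lemma lam_sol_multiplier:
  assumes "open \<omega>" "\<omega> \<subseteq> \<Omega>" "j > 0" "square_integrable \<Omega> f"
  shows "dual_multiplier \<Omega> \<nu> \<epsilon> j f \<omega> (E_sol \<Omega> \<nu> \<epsilon> j f \<omega>) (lam_sol \<Omega> \<nu> \<epsilon> j f \<omega>)"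
  unfolding lam_sol_def by (rule someI_ex[OF dual_multiplier_exists[OF assms E_sol_VI[OF assms]]])

lemma E_pen_penalized:
  assumes "open \<omega>" "\<omega> \<subseteq> \<Omega>" "j > 0" "\<gamma> > 0" "square_integrable \<Omega> f"
  shows "penalized_solution \<Omega> \<nu> \<epsilon> j f \<gamma> \<omega> (E_pen \<Omega> \<nu> \<epsilon> j f \<gamma> \<omega>, lam_pen \<Omega> \<nu> \<epsilon> j f \<gamma> \<omega>)"
  unfolding E_pen_def lam_pen_def prod.collapse
  by (rule someI_ex[OF penalized_solution_exists[OF assms]])

text \<open>Applied twice: with the minimizing shapes and with a constant sequence of shapes, a
  fixed competitor.\<close>

theorem E_pen_tendsto_E_sol:
  assumes W: "\<And>n. open (W n)" "\<And>n. W n \<subseteq> \<Omega>" and \<omega>: "open \<omega>" "\<omega> \<subseteq> \<Omega>" and j: "j > 0"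
    and \<gamma>: "\<And>n. \<gamma> n > 0" "filterlim \<gamma> at_top sequentially" and f: "square_integrable \<Omega> f"
    and conv: "(\<lambda>n. \<integral>x. \<bar>indicator (W n) x - indicator \<omega> x :: real\<bar> \<partial>M) \<longlonglongrightarrow> 0"
  shows "(\<lambda>n. Hcurl_norm \<Omega> (\<lambda>x. E_pen \<Omega> \<nu> \<epsilon> j f (\<gamma> n) (W n) x - E_sol \<Omega> \<nu> \<epsilon> j f \<omega> x)) \<longlonglongrightarrow> 0"
proof -
  let ?E = "\<lambda>n. E_pen \<Omega> \<nu> \<epsilon> j f (\<gamma> n) (W n)" and ?Es = "E_sol \<Omega> \<nu> \<epsilon> j f \<omega>"
  note VI = E_sol_VI[OF \<omega> j f] and pen = E_pen_penalized[OF W(1) W(2) j \<gamma>(1) f]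
  have E0: "?Es \<in> H0curl \<Omega>" by (rule VI_solutionD(1)[OF VI])
  have E: "?E n \<in> H0curl \<Omega>" for n using pen[of n n] by (simp add: penalized_solution_def)
  obtain c where c: "c > 0" "\<And>u. u \<in> Hcurl \<Omega> \<Longrightarrow> c * (Hcurl_norm \<Omega> u)\<^sup>2 \<le> a u u"
    by (rule form_coercive) blast
  define h where "h n = Hcurl_norm \<Omega> (\<lambda>x. ?Es x - ?E n x)" for n
  define s where "s n = l2norm M (\<lambda>x. indicator (W n) x - indicator \<omega> x :: real)" for n
  define K where "K n = j * (1 + 1 / (2 * \<gamma> n)) / \<gamma> n * measure M (space M)" for n
  have le: "(h n)\<^sup>2 \<le> (j * s n)\<^sup>2 / c\<^sup>2 + 2 * K n / c" for n
  proof (rule quadratic_estimate[OF c(1)])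
    have "c * (h n)\<^sup>2 \<le> a (\<lambda>x. ?Es x - ?E n x) (\<lambda>x. ?Es x - ?E n x)"
      unfolding h_def by (rule c(2)[OF H0curl_Hcurl[OF H0curl_diff[OF E0 E]]])
    also have "\<dots> \<le> j * s n * h n + K n"
      unfolding h_def s_def K_def by (rule penalization_estimate[OF W(1) W(2) \<omega> j \<gamma>(1) f pen VI])
    finally show "c * (h n)\<^sup>2 \<le> j * s n * h n + K n" .
  qed
  have s0: "s \<longlonglongrightarrow> 0"
    unfolding s_def l2norm_indicator_diff using tendsto_real_sqrt[OF conv] by simp
  have inv: "(\<lambda>n. inverse (\<gamma> n)) \<longlonglongrightarrow> 0"
    by (rule tendsto_inverse_0_at_top[OF \<gamma>(2)])
  have "(\<lambda>n. j * (1 + inverse (\<gamma> n) / 2) * inverse (\<gamma> n) * measure M (space M)) \<longlonglongrightarrow>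
      j * (1 + 0 / 2) * 0 * measure M (space M)"
    by (intro tendsto_intros inv) auto
  moreover have "K n = j * (1 + inverse (\<gamma> n) / 2) * inverse (\<gamma> n) * measure M (space M)" for n
    unfolding K_def divide_inverse inverse_mult_distrib by (simp only: mult_1_left mult_ac)
  then have "K = (\<lambda>n. j * (1 + inverse (\<gamma> n) / 2) * inverse (\<gamma> n) * measure M (space M))" by (rule ext)
  ultimately have K0: "K \<longlonglongrightarrow> 0" by simp
  have "(\<lambda>n. (j * s n)\<^sup>2 / c\<^sup>2 + 2 * K n / c) \<longlonglongrightarrow> (j * 0)\<^sup>2 / c\<^sup>2 + 2 * 0 / c"
    by (intro tendsto_intros s0 K0) (use c(1) in auto)
  then have "(\<lambda>n. (j * s n)\<^sup>2 / c\<^sup>2 + 2 * K n / c) \<longlonglongrightarrow> 0" by simp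
  then have "(\<lambda>n. (h n)\<^sup>2) \<longlonglongrightarrow> 0"
    by (rule real_tendsto_sandwich[rotated 3, where f="\<lambda>n. 0"]) (use le in auto)
  then have "(\<lambda>n. sqrt ((h n)\<^sup>2)) \<longlonglongrightarrow> sqrt 0" by (rule tendsto_real_sqrt)
  moreover have "sqrt ((h n)\<^sup>2) = Hcurl_norm \<Omega> (\<lambda>x. ?E n x - ?Es x)" for n
    using Hcurl_norm_minus_commute[OF H0curl_Hcurl[OF E0] H0curl_Hcurl[OF E]] Hcurl_norm_nonneg
    by (simp add: h_def)
  ultimately show ?thesis by simp
qed

lemma cost_tendsto:
  assumes B: "open B" "B \<subseteq> \<Omega>" and \<kappa>: "C1_bounded B \<kappa>" and Ed: "C1_bounded B E\<^sub>d"
    and E: "\<And>n. E n \<in> H0curl \<Omega>" "E0 \<in> H0curl \<Omega>"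
    and W: "\<And>n. open (W n)" "\<And>n. W n \<subseteq> \<Omega>" and \<omega>: "open \<omega>" "\<omega> \<subseteq> \<Omega>"
    and conv: "(\<lambda>n. \<integral>x. \<bar>indicator (W n) x - indicator \<omega> x :: real\<bar> \<partial>M) \<longlonglongrightarrow> 0"
    and lim: "(\<lambda>n. Hcurl_norm \<Omega> (\<lambda>x. E n x - E0 x)) \<longlonglongrightarrow> 0"
  shows "(\<lambda>n. cost B \<kappa> E\<^sub>d (E n) (W n)) \<longlonglongrightarrow> cost B \<kappa> E\<^sub>d E0 \<omega>"
proof -
  let ?B = "lebesgue_on B"
  interpret b: finite_measure ?B by (rule subdomain_measure(2)[OF B])
  note sB = subdomain_measure(1)[OF B]
  have C1: "g \<in> borel_measurable ?B" "\<exists>C\<ge>0. \<forall>x\<in>B. norm (g x) \<le> C" if "C1_bounded B g"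
    for g :: "R3 \<Rightarrow> 'b::euclidean_space"
  proof -
    from that obtain g' where g': "\<forall>x\<in>B. (g has_derivative blinfun_apply (g' x)) (at x)" and bd: "bounded (g ` B)"
      unfolding C1_bounded_def by blast
    have "continuous_on B g"
      using g' by (intro continuous_at_imp_continuous_on ballI has_derivative_continuous) blast
    then show "g \<in> borel_measurable ?B" by (rule continuous_imp_measurable_on_sets_lebesgue[OF _ sB])
    obtain C where "\<forall>x\<in>B. norm (g x) \<le> C" using bd by (auto simp: bounded_iff)
    then show "\<exists>C\<ge>0. \<forall>x\<in>B. norm (g x) \<le> C" by (intro exI[of _ "max C 0"]) (auto simp: le_max_iff_disj)
  qed
  obtain Ck where Ck: "Ck \<ge> 0" "\<forall>x\<in>B. norm (\<kappa> x) \<le> Ck" using C1(2)[OF \<kappa>] by blast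
  obtain Cd where Cd: "Cd \<ge> 0" "\<forall>x\<in>B. norm (E\<^sub>d x) \<le> Cd" using C1(2)[OF Ed] by blast
  have Ed_sq: "sqint ?B E\<^sub>d"
  proof (rule sqint_bound[OF b.sqint_const[of "1::real"] C1(1)[OF Ed]])
    show "AE x in ?B. norm (E\<^sub>d x) \<le> Cd * norm (1::real)" using Cd by (intro AE_I2) auto
  qed
  have Bsq: "sqint ?B v" "l2norm ?B v \<le> Hcurl_norm \<Omega> v" if "v \<in> H0curl \<Omega>" for v
    using sqint_lebesgue_on_subset[OF sets_\<Omega> sB B(2) sqint_H0curl[OF that]]
      l2norm_le_Hcurl_norm[OF H0curl_Hcurl[OF that]] by auto
  have kb: "AE x in ?B. norm (\<kappa> x *\<^sub>R v x) \<le> Ck * norm (v x)" for v :: "R3 \<Rightarrow> R3"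
    using Ck by (intro AE_I2) (auto intro: mult_right_mono)
  have km: "(\<lambda>x. \<kappa> x *\<^sub>R v x) \<in> borel_measurable ?B" if "sqint ?B v" for v :: "R3 \<Rightarrow> R3"
    using C1(1)[OF \<kappa>] sqint_measurable[OF that] by (rule borel_measurable_scaleR)
  have ksq: "sqint ?B (\<lambda>x. \<kappa> x *\<^sub>R v x)" if "sqint ?B v" for v :: "R3 \<Rightarrow> R3"
    by (rule sqint_bound[OF that km[OF that] kb])
  define g where "g n x = E n x - E\<^sub>d x" for n x
  define g0 where "g0 x = E0 x - E\<^sub>d x" for x
  have gs: "sqint ?B (g n)" "sqint ?B g0" for n
    unfolding g_def[abs_def] g0_def[abs_def] by (intro sqint_diff Bsq E Ed_sq)+
  have gd: "g n x - g0 x = E n x - E0 x" for n x by (simp add: g_def g0_def)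
  have glim: "(\<lambda>n. l2norm ?B (\<lambda>x. g n x - g0 x)) \<longlonglongrightarrow> 0"
    unfolding gd
    by (rule real_tendsto_sandwich[OF _ _ tendsto_const lim]) (use Bsq(2)[OF H0curl_diff[OF E]] in auto)
  have klim: "(\<lambda>n. l2norm ?B (\<lambda>x. \<kappa> x *\<^sub>R g n x - \<kappa> x *\<^sub>R g0 x)) \<longlonglongrightarrow> 0"
  proof (rule real_tendsto_sandwich[OF _ _ tendsto_const])
    show "(\<lambda>n. Ck * l2norm ?B (\<lambda>x. g n x - g0 x)) \<longlonglongrightarrow> 0" using tendsto_mult_right_zero[OF glim] .
    show "\<forall>\<^sub>F n in sequentially. l2norm ?B (\<lambda>x. \<kappa> x *\<^sub>R g n x - \<kappa> x *\<^sub>R g0 x) \<le> Ck * l2norm ?B (\<lambda>x. g n x - g0 x)"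
      unfolding scaleR_diff_right[symmetric]
      using l2norm_mono[OF sqint_diff[OF gs] km[OF sqint_diff[OF gs]] kb Ck(1)] by (intro always_eventually allI)
  qed simp
  \<comment> \<open>The weighted square is an inner product of two strongly convergent sequences,
    since \<kappa> is bounded on B.\<close>
  have "(\<lambda>n. \<integral>x. (\<kappa> x *\<^sub>R g n x) \<bullet> g n x \<partial>?B) \<longlonglongrightarrow> (\<integral>x. (\<kappa> x *\<^sub>R g0 x) \<bullet> g0 x \<partial>?B)"
    by (rule l2_inner_tendsto[OF ksq[OF gs(1)] ksq[OF gs(2)] klim gs glim])
  then have first: "(\<lambda>n. \<integral>x. \<kappa> x * (norm (E n x - E\<^sub>d x))\<^sup>2 \<partial>?B) \<longlonglongrightarrow> (\<integral>x. \<kappa> x * (norm (E0 x - E\<^sub>d x))\<^sup>2 \<partial>?B)"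
    by (simp add: g_def g0_def power2_norm_eq_inner)
  have one: "(\<integral>x. 1 \<partial>lebesgue_on S) = (\<integral>x. (indicator S x :: real) \<partial>M)" "integrable M (\<lambda>x. indicator S x :: real)"
    if "open S" "S \<subseteq> \<Omega>" for S
  proof -
    note r = integral_lebesgue_on_subset[where f="\<lambda>x. 1::real", OF sets_\<Omega> subdomain_measure(1)[OF that] that(2)]
    show "(\<integral>x. 1 \<partial>lebesgue_on S) = (\<integral>x. (indicator S x :: real) \<partial>M)" unfolding r(2) by simp
    show "integrable M (\<lambda>x. indicator S x :: real)" using r(3) by simp
  qed
  have "(\<lambda>n. \<integral>x. 1 \<partial>lebesgue_on (W n)) \<longlonglongrightarrow> (\<integral>x. 1 \<partial>lebesgue_on \<omega> :: real)"
  proof (rule LIM_zero_cancel, rule Lim_null_comparison[OF _ conv])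
    show "\<forall>\<^sub>F n in sequentially. norm ((\<integral>x. 1 \<partial>lebesgue_on (W n)) - (\<integral>x. 1 \<partial>lebesgue_on \<omega>) :: real)
        \<le> (\<integral>x. \<bar>indicator (W n) x - indicator \<omega> x\<bar> \<partial>M)"
    proof (intro always_eventually allI)
      fix n
      have "(\<integral>x. 1 \<partial>lebesgue_on (W n)) - (\<integral>x. 1 \<partial>lebesgue_on \<omega>) = (\<integral>x. (indicator (W n) x - indicator \<omega> x :: real) \<partial>M)"
        using one[OF W] one[OF \<omega>] by simp
      then show "norm ((\<integral>x. 1 \<partial>lebesgue_on (W n)) - (\<integral>x. 1 \<partial>lebesgue_on \<omega>) :: real)
        \<le> (\<integral>x. \<bar>indicator (W n) x - indicator \<omega> x\<bar> \<partial>M)"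
        using integral_abs_bound[of M "\<lambda>x. indicator (W n) x - indicator \<omega> x :: real"] by simp
    qed
  qed
  then show ?thesis
    unfolding cost_def by (intro tendsto_intros first)
qed

lemma multiplier_integral:
  assumes W: "open W" "W \<subseteq> \<Omega>" and lam: "ess_bounded W lam" and v: "v \<in> H0curl \<Omega>"
  shows "(\<integral>x. lam x \<bullet> v x \<partial>lebesgue_on W) = (\<integral>x. extend_zero W lam x \<bullet> v x \<partial>M)"
    "integrable M (\<lambda>x. extend_zero W lam x \<bullet> v x)"
proof -
  note sW = subdomain_measure(1)[OF W]
  have eq: "indicator W x *\<^sub>R (lam x \<bullet> v x) = extend_zero W lam x \<bullet> v x" for x
    by (simp add: extend_zero_def indicator_def)
  show "(\<integral>x. lam x \<bullet> v x \<partial>lebesgue_on W) = (\<integral>x. extend_zero W lam x \<bullet> v x \<partial>M)"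
    unfolding integral_lebesgue_on_subset(2)[OF sets_\<Omega> sW W(2)] eq ..
  obtain C where C: "AE x in lebesgue_on W. norm (lam x) \<le> C" and m: "lam \<in> borel_measurable (lebesgue_on W)"
    using lam by (auto simp: ess_bounded_def)
  have "integrable (lebesgue_on W) (\<lambda>x. lam x \<bullet> v x)"
  proof (rule Bochner_Integration.integrable_bound)
    show "integrable (lebesgue_on W) (\<lambda>x. C * norm (v x))"
      using l1_subdomain_le(1)[OF W sqint_H0curl[OF v]] by simp
    show "(\<lambda>x. lam x \<bullet> v x) \<in> borel_measurable (lebesgue_on W)"
      by (rule borel_measurable_inner[OF m measurable_lebesgue_on_subset[OF sqint_measurable[OF sqint_H0curl[OF v]] W(2)]])
    show "AE x in lebesgue_on W. norm (lam x \<bullet> v x) \<le> norm (C * norm (v x))"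
      using C
    proof eventually_elim
      case (elim x)
      have "norm (lam x \<bullet> v x) \<le> norm (lam x) * norm (v x)" unfolding real_norm_def by (rule Cauchy_Schwarz_ineq2)
      also have "\<dots> \<le> C * norm (v x)" using elim by (intro mult_right_mono) auto
      also have "\<dots> \<le> norm (C * norm (v x))" by simp
      finally show ?case .
    qed
  qed
  then have "integrable lebesgue (\<lambda>x. indicator W x *\<^sub>R (lam x \<bullet> v x))"
    using sW by (simp add: integrable_restrict_space)
  moreover have "indicator \<Omega> x *\<^sub>R indicator W x *\<^sub>R (lam x \<bullet> v x) = indicator W x *\<^sub>R (lam x \<bullet> v x)" for x
    using W(2) by (auto simp: indicator_def)
  ultimately have "integrable M (\<lambda>x. indicator W x *\<^sub>R (lam x \<bullet> v x))"
    using sets_\<Omega> by (simp add: integrable_restrict_space del: scaleR_scaleR real_scaleR_def)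
  then show "integrable M (\<lambda>x. extend_zero W lam x \<bullet> v x)" unfolding eq .
qed

text \<open>The multipliers only enter through the functionals they define, so their dual distance is
  controlled by the distance of the fields.\<close>

lemma multiplier_dual_norm_le:
  assumes C: "C \<ge> 0" "\<And>u v. u \<in> Hcurl \<Omega> \<Longrightarrow> v \<in> Hcurl \<Omega> \<Longrightarrow> \<bar>a u v\<bar> \<le> C * Hcurl_norm \<Omega> u * Hcurl_norm \<Omega> v"
    and W: "open W" "W \<subseteq> \<Omega>" and \<omega>: "open \<omega>" "\<omega> \<subseteq> \<Omega>" and l: "ess_bounded W lam" "ess_bounded \<omega> lam0"
    and E: "E \<in> H0curl \<Omega>" "E0 \<in> H0curl \<Omega>"
    and eq: "\<forall>v\<in>H0curl \<Omega>. a E v + (\<integral>x. lam x \<bullet> v x \<partial>lebesgue_on W) = (\<integral>x. f x \<bullet> v x \<partial>M)"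
    and eq0: "\<forall>v\<in>H0curl \<Omega>. a E0 v + (\<integral>x. lam0 x \<bullet> v x \<partial>lebesgue_on \<omega>) = (\<integral>x. f x \<bullet> v x \<partial>M)"
  defines "g \<equiv> \<lambda>x. extend_zero W lam x - extend_zero \<omega> lam0 x"
  shows "0 \<le> H0curl_dual_norm \<Omega> g" "H0curl_dual_norm \<Omega> g \<le> C * Hcurl_norm \<Omega> (\<lambda>x. E x - E0 x)"
proof -
  let ?S = "{v \<in> H0curl \<Omega>. Hcurl_norm \<Omega> v \<le> 1}"
  have bd: "\<bar>\<integral>x. g x \<bullet> v x \<partial>M\<bar> \<le> C * Hcurl_norm \<Omega> (\<lambda>x. E x - E0 x)" if v: "v \<in> ?S" for v
  proof -
    have v': "v \<in> H0curl \<Omega>" "Hcurl_norm \<Omega> v \<le> 1" using v by auto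
    note m = multiplier_integral[OF W l(1) v'(1)] and m0 = multiplier_integral[OF \<omega> l(2) v'(1)]
    have "(\<integral>x. g x \<bullet> v x \<partial>M) = (\<integral>x. lam x \<bullet> v x \<partial>lebesgue_on W) - (\<integral>x. lam0 x \<bullet> v x \<partial>lebesgue_on \<omega>)"
      using m m0 by (simp add: g_def inner_diff_left)
    also have "\<dots> = - a (\<lambda>x. E x - E0 x) v"
      using bspec[OF eq v'(1)] bspec[OF eq0 v'(1)]
        form_diff_left[OF H0curl_Hcurl[OF E(1)] H0curl_Hcurl[OF E(2)] H0curl_Hcurl[OF v'(1)]] by simp
    finally have "\<bar>\<integral>x. g x \<bullet> v x \<partial>M\<bar> \<le> C * Hcurl_norm \<Omega> (\<lambda>x. E x - E0 x) * Hcurl_norm \<Omega> v"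
      using C(2)[OF H0curl_Hcurl[OF H0curl_diff[OF E]] H0curl_Hcurl[OF v'(1)]] by simp
    also have "\<dots> \<le> C * Hcurl_norm \<Omega> (\<lambda>x. E x - E0 x)"
      using C(1) v'(2) Hcurl_norm_nonneg by (intro mult_left_le) auto
    finally show ?thesis .
  qed
  have z: "(\<lambda>x. 0) \<in> ?S" using H0curl_zero Hcurl_norm_0 by simp
  show "H0curl_dual_norm \<Omega> g \<le> C * Hcurl_norm \<Omega> (\<lambda>x. E x - E0 x)"
    unfolding H0curl_dual_norm_def using z bd by (intro cSUP_least) blast+
  show "0 \<le> H0curl_dual_norm \<Omega> g"
    unfolding H0curl_dual_norm_def
  proof (rule order_trans[OF abs_ge_zero cSUP_upper[OF z]])
    show "bdd_above ((\<lambda>v. \<bar>\<integral>x. g x \<bullet> v x \<partial>M\<bar>) ` ?S)" using bd by (rule bdd_aboveI2)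
  qed
qed

end

theorem theorem5p3:
  fixes \<Omega> B :: "(real^3) set"
    and L r h j\<^sub>c :: real
    and \<epsilon> \<nu> :: "real^3 \<Rightarrow> real^3^3"
    and f E\<^sub>d :: "real^3 \<Rightarrow> real^3"
    and \<kappa> :: "real^3 \<Rightarrow> real"
    and \<gamma> :: "nat \<Rightarrow> real"
    and \<omega>s :: "nat \<Rightarrow> (real^3) set"
  assumes "bounded \<Omega>" and "lipschitz_domain \<Omega>"
    and "lipschitz_domain B" and "B \<subseteq> \<Omega>"
    and "C1_bounded B E\<^sub>d"
    and "C1_bounded B \<kappa>" and "\<forall>x\<in>B. \<kappa> x > 0"
    and "j\<^sub>c > 0"
    and "coefficient \<Omega> B \<epsilon>" and "coefficient \<Omega> B \<nu>"
    and "square_integrable \<Omega> f" and "C1_bounded B f"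
    and "L > 0" and "r > 0" and "h > 0"
    and "admissible B L r h \<noteq> {}"
    and "\<forall>n. \<gamma> n > 0" and "filterlim \<gamma> at_top sequentially"
    and "\<forall>n. is_arg_min (J_pen \<Omega> B \<nu> \<epsilon> j\<^sub>c f \<kappa> E\<^sub>d (\<gamma> n)) (\<lambda>\<omega>. \<omega> \<in> admissible B L r h) (\<omega>s n)"
  shows "\<exists>k \<omega>\<^sub>0. strict_mono k \<and>
     is_arg_min (J \<Omega> B \<nu> \<epsilon> j\<^sub>c f \<kappa> E\<^sub>d) (\<lambda>\<omega>. \<omega> \<in> admissible B L r h) \<omega>\<^sub>0 \<and>
     converges_hausdorff B (\<lambda>n. \<omega>s (k n)) \<omega>\<^sub>0 \<and>
     converges_char \<Omega> (\<lambda>n. \<omega>s (k n)) \<omega>\<^sub>0 \<and>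
     (\<lambda>n. Hcurl_norm \<Omega>
        (\<lambda>x. E_pen \<Omega> \<nu> \<epsilon> j\<^sub>c f (\<gamma> (k n)) (\<omega>s (k n)) x - E_sol \<Omega> \<nu> \<epsilon> j\<^sub>c f \<omega>\<^sub>0 x)) \<longlonglongrightarrow> 0 \<and>
     (\<lambda>n. H0curl_dual_norm \<Omega>
        (\<lambda>x. extend_zero (\<omega>s (k n)) (lam_pen \<Omega> \<nu> \<epsilon> j\<^sub>c f (\<gamma> (k n)) (\<omega>s (k n))) x
           - extend_zero \<omega>\<^sub>0 (lam_sol \<Omega> \<nu> \<epsilon> j\<^sub>c f \<omega>\<^sub>0) x)) \<longlonglongrightarrow> 0"
proof -
  note bounded_\<Omega> = assms(1) and B_\<Omega> = assms(4) and Ed = assms(5) and \<kappa> = assms(6) and j = assms(8)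
    and f = assms(11) and pos = assms(13-15) and \<gamma>_top = assms(18)
  have \<gamma>: "\<gamma> n > 0" for n using assms(17) by blast
  have B: "open B" "B \<noteq> {}" using assms(3) by (auto simp: lipschitz_domain_def)
  have "bounded B" using B_\<Omega> bounded_\<Omega> bounded_subset by blast
  interpret curl_form \<Omega> B \<nu> \<epsilon>
    by unfold_locales (use assms(1,2,9,10) in \<open>auto simp: lipschitz_domain_def\<close>)
  let ?A = "admissible B L r h"
  have A: "open \<omega>" "\<omega> \<subseteq> \<Omega>" if "\<omega> \<in> ?A" for \<omega> using that B_\<Omega> by (auto simp: admissible_def)
  have \<omega>s: "\<omega>s n \<in> ?A" for n using assms(19) by (simp add: is_arg_min_def)
  have min: "J_pen \<Omega> B \<nu> \<epsilon> j\<^sub>c f \<kappa> E\<^sub>d (\<gamma> n) (\<omega>s n) \<le> J_pen \<Omega> B \<nu> \<epsilon> j\<^sub>c f \<kappa> E\<^sub>d (\<gamma> n) \<omega>" if "\<omega> \<in> ?A" for n \<omega>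
    using assms(19) that by (fastforce simp: is_arg_min_def not_less)
  obtain k \<omega>0 where k: "strict_mono k" and \<omega>0: "\<omega>0 \<in> ?A"
    and hausdorff: "converges_hausdorff B (\<lambda>n. \<omega>s (k n)) \<omega>0" and null: "negligible (frontier \<omega>0)"
    and inner: "\<forall>z\<in>\<omega>0. \<forall>\<^sub>F n in sequentially. z \<in> \<omega>s (k n)"
    and outer: "\<forall>z. z \<notin> closure \<omega>0 \<longrightarrow> (\<forall>\<^sub>F n in sequentially. z \<notin> \<omega>s (k n))"
    by (rule admissible_compact[OF B(1) \<open>bounded B\<close> B(2) pos \<omega>s])
  note W = A[OF \<omega>s]
  \<comment> \<open>Off the null boundary each indicator sequence is eventually constant, so it
    converges almost everywhere.\<close>
  have "AE x in lebesgue. x \<notin> frontier \<omega>0"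
    using null by (intro AE_not_in) (simp add: negligible_iff_null_sets)
  then have "AE x in M. x \<notin> frontier \<omega>0"
    using sets_\<Omega> by (auto simp: AE_restrict_space_iff elim: eventually_mono)
  then have "AE x in M. (\<lambda>n. indicator (\<omega>s (k n)) x) \<longlonglongrightarrow> (indicator \<omega>0 x :: real)"
  proof eventually_elim
    case (elim x)
    show ?case
    proof (cases "x \<in> \<omega>0")
      case True
      have "\<forall>\<^sub>F n in sequentially. indicator (\<omega>s (k n)) x = (indicator \<omega>0 x :: real)"
        using bspec[OF inner True] by eventually_elim (simp add: True)
      then show ?thesis by (rule tendsto_eventually)
    next
      case False
      then have "x \<notin> closure \<omega>0" using elim A(1)[OF \<omega>0] by (simp add: frontier_def interior_open)
      from outer[rule_format, OF this] have "\<forall>\<^sub>F n in sequentially. indicator (\<omega>s (k n)) x = (indicator \<omega>0 x :: real)"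
        by eventually_elim (simp add: False)
      then show ?thesis by (rule tendsto_eventually)
    qed
  qed
  from indicator_L1_tendsto[OF W(1) A(1)[OF \<omega>0] this]
  have L1: "(\<lambda>n. \<integral>x. \<bar>indicator (\<omega>s (k n)) x - indicator \<omega>0 x :: real\<bar> \<partial>M) \<longlonglongrightarrow> 0" .
  have \<gamma>k: "filterlim (\<lambda>n. \<gamma> (k n)) at_top sequentially"
    by (rule filterlim_compose[OF \<gamma>_top filterlim_subseq[OF k]])
  let ?E = "\<lambda>n. E_pen \<Omega> \<nu> \<epsilon> j\<^sub>c f (\<gamma> (k n))" and ?l = "\<lambda>n. lam_pen \<Omega> \<nu> \<epsilon> j\<^sub>c f (\<gamma> (k n))"
  have pen: "penalized_solution \<Omega> \<nu> \<epsilon> j\<^sub>c f (\<gamma> (k n)) \<omega> (?E n \<omega>, ?l n \<omega>)" if "\<omega> \<in> ?A" for n \<omega>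
    by (rule E_pen_penalized[OF A[OF that] j \<gamma> f])
  have E: "?E n \<omega> \<in> H0curl \<Omega>" if "\<omega> \<in> ?A" for n \<omega>
    using pen[OF that, of n] by (simp add: penalized_solution_def)
  have E0: "E_sol \<Omega> \<nu> \<epsilon> j\<^sub>c f \<omega> \<in> H0curl \<Omega>" if "\<omega> \<in> ?A" for \<omega>
    by (rule VI_solutionD(1)[OF E_sol_VI[OF A[OF that] j f]])
  have Elim: "(\<lambda>n. Hcurl_norm \<Omega> (\<lambda>x. ?E n (\<omega>s (k n)) x - E_sol \<Omega> \<nu> \<epsilon> j\<^sub>c f \<omega>0 x)) \<longlonglongrightarrow> 0"
    by (rule E_pen_tendsto_E_sol[OF W A[OF \<omega>0] j \<gamma> \<gamma>k f L1])
  have J_lim: "(\<lambda>n. J_pen \<Omega> B \<nu> \<epsilon> j\<^sub>c f \<kappa> E\<^sub>d (\<gamma> (k n)) (\<omega>s (k n))) \<longlonglongrightarrow> J \<Omega> B \<nu> \<epsilon> j\<^sub>c f \<kappa> E\<^sub>d \<omega>0"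
    unfolding J_pen_def J_def
    by (rule cost_tendsto[OF B(1) B_\<Omega> \<kappa> Ed E[OF \<omega>s] E0[OF \<omega>0] W A[OF \<omega>0] L1 Elim])
  \<comment> \<open>The competitor itself is a recovery sequence: its penalized costs tend to its
    true cost, and minimality passes to the limit on both sides.\<close>
  have opt: "J \<Omega> B \<nu> \<epsilon> j\<^sub>c f \<kappa> E\<^sub>d \<omega>0 \<le> J \<Omega> B \<nu> \<epsilon> j\<^sub>c f \<kappa> E\<^sub>d \<omega>" if \<omega>: "\<omega> \<in> ?A" for \<omega>
  proof (rule LIMSEQ_le[OF J_lim])
    have c: "(\<lambda>n::nat. \<integral>x. \<bar>indicator \<omega> x - indicator \<omega> x :: real\<bar> \<partial>M) \<longlonglongrightarrow> 0" by simp
    have lim: "(\<lambda>n. Hcurl_norm \<Omega> (\<lambda>x. ?E n \<omega> x - E_sol \<Omega> \<nu> \<epsilon> j\<^sub>c f \<omega> x)) \<longlonglongrightarrow> 0"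
      by (rule E_pen_tendsto_E_sol[OF A[OF \<omega>] A[OF \<omega>] j \<gamma> \<gamma>k f c])
    show "(\<lambda>n. J_pen \<Omega> B \<nu> \<epsilon> j\<^sub>c f \<kappa> E\<^sub>d (\<gamma> (k n)) \<omega>) \<longlonglongrightarrow> J \<Omega> B \<nu> \<epsilon> j\<^sub>c f \<kappa> E\<^sub>d \<omega>"
      unfolding J_pen_def J_def
      by (rule cost_tendsto[OF B(1) B_\<Omega> \<kappa> Ed E[OF \<omega>] E0[OF \<omega>] A[OF \<omega>] A[OF \<omega>] c lim])
  qed (use min[OF \<omega>] in blast)
  obtain C where C: "C \<ge> 0" "\<And>u v. u \<in> Hcurl \<Omega> \<Longrightarrow> v \<in> Hcurl \<Omega> \<Longrightarrow> \<bar>a u v\<bar> \<le> C * Hcurl_norm \<Omega> u * Hcurl_norm \<Omega> v"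
    by (rule form_bounded) blast
  have pn: "ess_bounded (\<omega>s (k n)) (?l n (\<omega>s (k n)))"
    "\<forall>v\<in>H0curl \<Omega>. a (?E n (\<omega>s (k n))) v + (\<integral>x. ?l n (\<omega>s (k n)) x \<bullet> v x \<partial>lebesgue_on (\<omega>s (k n)))
      = (\<integral>x. f x \<bullet> v x \<partial>M)" for n
    using pen[OF \<omega>s, of n "k n"] by (simp_all add: penalized_solution_def)
  have ml: "ess_bounded \<omega>0 (lam_sol \<Omega> \<nu> \<epsilon> j\<^sub>c f \<omega>0)"
    "\<forall>v\<in>H0curl \<Omega>. a (E_sol \<Omega> \<nu> \<epsilon> j\<^sub>c f \<omega>0) v + (\<integral>x. lam_sol \<Omega> \<nu> \<epsilon> j\<^sub>c f \<omega>0 x \<bullet> v x \<partial>lebesgue_on \<omega>0)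
      = (\<integral>x. f x \<bullet> v x \<partial>M)"
    using lam_sol_multiplier[OF A[OF \<omega>0] j f] by (simp_all add: dual_multiplier_def)
  note dual_le = multiplier_dual_norm_le[OF C W A[OF \<omega>0] pn(1) ml(1) E[OF \<omega>s] E0[OF \<omega>0] pn(2) ml(2)]
  have "(\<lambda>n. C * Hcurl_norm \<Omega> (\<lambda>x. ?E n (\<omega>s (k n)) x - E_sol \<Omega> \<nu> \<epsilon> j\<^sub>c f \<omega>0 x)) \<longlonglongrightarrow> 0"
    by (rule tendsto_mult_right_zero[OF Elim])
  then have dual: "(\<lambda>n. H0curl_dual_norm \<Omega> (\<lambda>x. extend_zero (\<omega>s (k n)) (?l n (\<omega>s (k n))) x
        - extend_zero \<omega>0 (lam_sol \<Omega> \<nu> \<epsilon> j\<^sub>c f \<omega>0) x)) \<longlonglongrightarrow> 0"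
    by (rule real_tendsto_sandwich[rotated 3, where f="\<lambda>n. 0"]) (use dual_le in auto)
  have "is_arg_min (J \<Omega> B \<nu> \<epsilon> j\<^sub>c f \<kappa> E\<^sub>d) (\<lambda>\<omega>. \<omega> \<in> ?A) \<omega>0"
    using \<omega>0 opt by (fastforce simp: is_arg_min_def)
  moreover have "converges_char \<Omega> (\<lambda>n. \<omega>s (k n)) \<omega>0"
    unfolding converges_char_iff_L1 by (rule L1)
  ultimately show ?thesis
    using k hausdorff Elim dual by (intro exI[of _ k] exI[of _ \<omega>0] conjI)
qed

end
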